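(* Let $\Bbbk$ be a field, and let $L\colon \mathscr{C}at_{dgwu}(\Bbbk)\to \mathscr{C}at_{dg}(\Bbbk)$ and $R\colon\mathscr{C}at_{dg}(\Bbbk)\to\mathscr{C}at_{dgwu}(\Bbbk)$ be the functors described in the context. Then: (1) there is an adjunction $$\mathrm{Hom}_{\mathscr{C}at_{dg}(\Bbbk)}(L(C),A)\simeq\mathrm{Hom}_{\mathscr{C}at_{dgwu}(\Bbbk)}(C,R(A));$$ (2) the functors $L\colon \mathscr{C}at_{dgwu}(\Bbbk)\rightleftarrows \mathscr{C}at_{dg}(\Bbbk)\colon R$ form a Quillen pair of functors.
   Context: Complexes are cohomologically graded over the field $\Bbbk$. A non-unital dg category is a dg category without required identity morphisms. For a non-unital dg category $A$, let $\Bbbk_A$ have the same objects, $\Bbbk_A(X,X)=\Bbbk\cdot 1_X$, $\Bbbk_A(X,Y)=0$ for $X\neq Y$. Let $A\oplus\Bbbk_A$ be the unital dg category with the same objects, $(A\oplus \Bbbk_A)(X,Y)=A(X,Y)$ for $X\ne Y$ and $A(X,X)\oplus\Bbbk 1_X$ for $X=Y$, where $1_X$ is the strict identity of $X$; let $i\colon A\to A\oplus\Bbbk_A$ be the inclusion. A *weakly unital dg category* is a non-unital dg category $A$ with, for each object $X$, an element $\mathrm{id}_X\in A(X,X)^0$ with $d(\mathrm{id}_X)=0$, $\mathrm{id}_X\circ\mathrm{id}_X=\mathrm{id}_X$, and with an $A_\infty$ functor $p=p^A\colon A\oplus\Bbbk_A\to A$ (part of the structure; components $p_n$, $n\ge 1$,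 of degree $1-n$), identity on objects, such that $p\circ i=\mathrm{id}_A$ (that is, $p_1(f)=f$ for $f$ in $A$, and $p_n(f_1,\dots,f_n)=0$ for $n\ge2$ if all $f_i$ are in $A$), $p_1(1_X)=\mathrm{id}_X$ and $p_n(1_X,\dots,1_X)=0$ for $n\ge 2$. A *weakly unital dg functor* $F\colon C\to D$ is a dg functor of non-unital dg categories with $F\circ p^C=p^D\circ(F\oplus\mathrm{id})$, i.e. $F(p^C_n(f_1,\dots,f_n))=p^D_n(F(f_1),\dots,F(f_n))$ for all $n$ and all $f_i$ in $C\oplus \Bbbk_C$ (with $F(1_X)=1_{F(X)}$). Small weakly unital dg categories and these functors form $\mathscr{C}at_{dgwu}(\Bbbk)$. $\mathscr{C}at_{dg}(\Bbbk)$ is the category of small (strictly unital) dg categories and unital dg functors. For $C$ weakly unital, $H^0(C)$ is a $\Bbbk$-linear category with identities $[\mathrm{id}_X]$. Model structures: on both categories, weak equivalences are the functors $F\colon C\to D$ such that all maps $C(x,y)\to D(Fx,Fy)$ are quasi-isomorphisms and $H^0(F)$ is an equivalence of categories; fibrations are the functors $F\colon C\to D$ such that all maps $C(x,y)\to D(Fx,Fy)$ are component-wise surjective and, for any $x\in C$ and any closed degree 0 morphism $g\colon Fx\to z$ in $D$ which becomes an isomorphism in $H^0(D)$, there is a closed degree 0 morphism $f\colon x\to y$ in $C$, which becomes an isomorphism in $H^0(C)$, with $F(f)=g$. On $\mathscr{C}at_{dg}(\Bbbk)$ this is Tabuada's model structure; on $\mathscr{C}at_{dgwu}(\Bbbk)$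 it is the model structure constructed in the same paper (it is given that it exists). Cofibrations are the maps with the left lifting property with respect to acyclic fibrations. A Quillen pair is an adjoint pair whose left adjoint preserves cofibrations and trivial cofibrations (equivalently, whose right adjoint preserves fibrations and trivial fibrations). The functors: for a weakly unital dg category $C$, $L(C)=C/\mathcal{I}$, where $\mathcal{I}$ is the dg category-ideal generated by all $p_n(x_1,\dots,x_n)$ with $n\ge2$, $x_i\in C\oplus\Bbbk_C$; it is a strictly unital dg category with identities the classes of $\mathrm{id}_X$. For a strictly unital dg category $A$, $R(A)$ is $A$ with the weakly unital structure given by the dg functor $p_{dg}\colon A\oplus\Bbbk_A\to A$, i.e. $p_1|_A=\mathrm{id}$, $p_1(1_X)=\mathrm{id}_X$, $p_n=0$ for $n\ge2$. *)

theory Defs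
  imports "HOL-Algebra.Module" "HOL-Algebra.AbelCoset" "HOL-Library.FuncSet"
begin

section \<open>Categories, adjunctions, model structures\<close>

text \<open>Hom-sets need not be disjoint: an arrow is a triple (source, target, element of the hom-set),
  so composition takes the three objects as arguments.\<close>

record ('a, 'f) cat =
  Ob :: "'a set"
  Ar :: "'a \<Rightarrow> 'a \<Rightarrow> 'f set"
  Idt :: "'a \<Rightarrow> 'f"
  Cm :: "'a \<Rightarrow> 'a \<Rightarrow> 'a \<Rightarrow> 'f \<Rightarrow> 'f \<Rightarrow> 'f"  \<comment> \<open>\<open>Cm \<C> x y z g f\<close> is \<open>g\<close> after \<open>f\<close>, for \<open>f : x \<rightarrow> y\<close>, \<open>g : y \<rightarrow> z\<close>\<close>

definition category :: "('a, 'f, 'z) cat_scheme \<Rightarrow> bool" where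
  "category \<C> \<longleftrightarrow>
     (\<forall>x\<in>Ob \<C>. Idt \<C> x \<in> Ar \<C> x x) \<and>
     (\<forall>x\<in>Ob \<C>. \<forall>y\<in>Ob \<C>. \<forall>f\<in>Ar \<C> x y. Cm \<C> x y y (Idt \<C> y) f = f \<and> Cm \<C> x x y f (Idt \<C> x) = f) \<and>
     (\<forall>x\<in>Ob \<C>. \<forall>y\<in>Ob \<C>. \<forall>z\<in>Ob \<C>. \<forall>f\<in>Ar \<C> x y. \<forall>g\<in>Ar \<C> y z. Cm \<C> x y z g f \<in> Ar \<C> x z) \<and>
     (\<forall>w\<in>Ob \<C>. \<forall>x\<in>Ob \<C>. \<forall>y\<in>Ob \<C>. \<forall>z\<in>Ob \<C>. \<forall>f\<in>Ar \<C> w x. \<forall>g\<in>Ar \<C> x y. \<forall>h\<in>Ar \<C> y z.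
        Cm \<C> w y z h (Cm \<C> w x y g f) = Cm \<C> w x z (Cm \<C> x y z h g) f)"

definition iso_in :: "('a, 'f, 'z) cat_scheme \<Rightarrow> 'a \<Rightarrow> 'a \<Rightarrow> 'f \<Rightarrow> bool" where
  "iso_in \<C> x y f \<longleftrightarrow> f \<in> Ar \<C> x y \<and>
     (\<exists>g\<in>Ar \<C> y x. Cm \<C> x y x g f = Idt \<C> x \<and> Cm \<C> y x y f g = Idt \<C> y)"

record ('a, 'f, 'b, 'g) functr =
  FOb :: "'a \<Rightarrow> 'b"
  FAr :: "'a \<Rightarrow> 'a \<Rightarrow> 'f \<Rightarrow> 'g"

definition is_functor ::
  "('a, 'f, 'y) cat_scheme \<Rightarrow> ('b, 'g, 'z) cat_scheme \<Rightarrow> ('a, 'f, 'b, 'g) functr \<Rightarrow> bool" where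
  "is_functor \<C> \<D> T \<longleftrightarrow>
     (\<forall>x\<in>Ob \<C>. FOb T x \<in> Ob \<D> \<and> FAr T x x (Idt \<C> x) = Idt \<D> (FOb T x)) \<and>
     (\<forall>x\<in>Ob \<C>. \<forall>y\<in>Ob \<C>. \<forall>f\<in>Ar \<C> x y. FAr T x y f \<in> Ar \<D> (FOb T x) (FOb T y)) \<and>
     (\<forall>x\<in>Ob \<C>. \<forall>y\<in>Ob \<C>. \<forall>z\<in>Ob \<C>. \<forall>f\<in>Ar \<C> x y. \<forall>g\<in>Ar \<C> y z.
        FAr T x z (Cm \<C> x y z g f) =
          Cm \<D> (FOb T x) (FOb T y) (FOb T z) (FAr T y z g) (FAr T x y f))"

definition id_functor :: "('a, 'f, 'a, 'f) functr" where
  "id_functor = \<lparr>FOb = (\<lambda>x. x), FAr = (\<lambda>x y f. f)\<rparr>"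

definition comp_functor ::
  "('b, 'g, 'c, 'h) functr \<Rightarrow> ('a, 'f, 'b, 'g) functr \<Rightarrow> ('a, 'f, 'c, 'h) functr" where
  "comp_functor S T = \<lparr>FOb = (\<lambda>x. FOb S (FOb T x)),
     FAr = (\<lambda>x y f. FAr S (FOb T x) (FOb T y) (FAr T x y f))\<rparr>"

definition nat_isomorphic ::
  "('a, 'f, 'y) cat_scheme \<Rightarrow> ('b, 'g, 'z) cat_scheme \<Rightarrow>
   ('a, 'f, 'b, 'g) functr \<Rightarrow> ('a, 'f, 'b, 'g) functr \<Rightarrow> bool" where
  "nat_isomorphic \<C> \<D> S T \<longleftrightarrow> (\<exists>\<eta>.
     (\<forall>x\<in>Ob \<C>. iso_in \<D> (FOb S x) (FOb T x) (\<eta> x)) \<and>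
     (\<forall>x\<in>Ob \<C>. \<forall>y\<in>Ob \<C>. \<forall>f\<in>Ar \<C> x y.
        Cm \<D> (FOb S x) (FOb S y) (FOb T y) (\<eta> y) (FAr S x y f) =
        Cm \<D> (FOb S x) (FOb T x) (FOb T y) (FAr T x y f) (\<eta> x)))"

definition is_equivalence ::
  "('a, 'f, 'y) cat_scheme \<Rightarrow> ('b, 'g, 'z) cat_scheme \<Rightarrow> ('a, 'f, 'b, 'g) functr \<Rightarrow> bool" where
  "is_equivalence \<C> \<D> T \<longleftrightarrow> is_functor \<C> \<D> T \<and>
     (\<exists>S. is_functor \<D> \<C> S \<and>
        nat_isomorphic \<C> \<C> (comp_functor S T) id_functor \<and>
        nat_isomorphic \<D> \<D> (comp_functor T S) id_functor)"

definition adjunction ::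
  "('a, 'f, 'y) cat_scheme \<Rightarrow> ('b, 'g, 'z) cat_scheme \<Rightarrow>
   ('a, 'f, 'b, 'g) functr \<Rightarrow> ('b, 'g, 'a, 'f) functr \<Rightarrow> bool" where
  "adjunction \<C> \<D> L R \<longleftrightarrow>
     category \<C> \<and> category \<D> \<and> is_functor \<C> \<D> L \<and> is_functor \<D> \<C> R \<and>
     (\<exists>\<phi> :: 'a \<Rightarrow> 'b \<Rightarrow> 'g \<Rightarrow> 'f.
        (\<forall>c\<in>Ob \<C>. \<forall>a\<in>Ob \<D>. bij_betw (\<phi> c a) (Ar \<D> (FOb L c) a) (Ar \<C> c (FOb R a))) \<and>
        (\<forall>c\<in>Ob \<C>. \<forall>c'\<in>Ob \<C>. \<forall>a\<in>Ob \<D>. \<forall>a'\<in>Ob \<D>.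
           \<forall>h\<in>Ar \<C> c' c. \<forall>k\<in>Ar \<D> a a'. \<forall>u\<in>Ar \<D> (FOb L c) a.
             \<phi> c' a' (Cm \<D> (FOb L c') a a' k (Cm \<D> (FOb L c') (FOb L c) a u (FAr L c' c h))) =
             Cm \<C> c' (FOb R a) (FOb R a') (FAr R a a' k)
               (Cm \<C> c' c (FOb R a) (\<phi> c a u) h)))"

text \<open>\<open>i : a \<rightarrow> b\<close> has the left lifting property with respect to \<open>p : x \<rightarrow> y\<close>.\<close>

definition has_lift :: "('a, 'f, 'z) cat_scheme \<Rightarrow> 'a \<Rightarrow> 'a \<Rightarrow> 'f \<Rightarrow> 'a \<Rightarrow> 'a \<Rightarrow> 'f \<Rightarrow> bool" where
  "has_lift \<C> a b i x y p \<longleftrightarrow>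
     (\<forall>u\<in>Ar \<C> a x. \<forall>v\<in>Ar \<C> b y. Cm \<C> a x y p u = Cm \<C> a b y v i \<longrightarrow>
        (\<exists>h\<in>Ar \<C> b x. Cm \<C> a b x h i = u \<and> Cm \<C> b x y p h = v))"

record ('a, 'f) mcat = "('a, 'f) cat" +
  weq :: "'a \<Rightarrow> 'a \<Rightarrow> 'f \<Rightarrow> bool"
  fib :: "'a \<Rightarrow> 'a \<Rightarrow> 'f \<Rightarrow> bool"
  cof :: "'a \<Rightarrow> 'a \<Rightarrow> 'f \<Rightarrow> bool"

definition with_cofibrations ::
  "('a, 'f) cat \<Rightarrow> ('a \<Rightarrow> 'a \<Rightarrow> 'f \<Rightarrow> bool) \<Rightarrow> ('a \<Rightarrow> 'a \<Rightarrow> 'f \<Rightarrow> bool) \<Rightarrow> ('a, 'f) mcat" where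
  "with_cofibrations \<C> W F = cat.extend \<C>
     \<lparr>weq = W, fib = F,
      cof = (\<lambda>a b i. \<forall>x\<in>Ob \<C>. \<forall>y\<in>Ob \<C>. \<forall>p\<in>Ar \<C> x y. F x y p \<and> W x y p \<longrightarrow> has_lift \<C> a b i x y p)\<rparr>"

definition retract_closed ::
  "('a, 'f, 'z) cat_scheme \<Rightarrow> ('a \<Rightarrow> 'a \<Rightarrow> 'f \<Rightarrow> bool) \<Rightarrow> bool" where
  "retract_closed \<C> P \<longleftrightarrow>
     (\<forall>a\<in>Ob \<C>. \<forall>b\<in>Ob \<C>. \<forall>x\<in>Ob \<C>. \<forall>y\<in>Ob \<C>. \<forall>f\<in>Ar \<C> a b. \<forall>g\<in>Ar \<C> x y.
      \<forall>i\<in>Ar \<C> a x. \<forall>r\<in>Ar \<C> x a. \<forall>j\<in>Ar \<C> b y. \<forall>s\<in>Ar \<C> y b.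
        Cm \<C> a x a r i = Idt \<C> a \<and> Cm \<C> b y b s j = Idt \<C> b \<and>
        Cm \<C> a x y g i = Cm \<C> a b y j f \<and> Cm \<C> x a b f r = Cm \<C> x y b s g \<and>
        P x y g \<longrightarrow> P a b f)"

text \<open>A category with a (closed) model structure.  No limits or colimits are demanded.\<close>

definition model_structure :: "('a, 'f, 'z) mcat_scheme \<Rightarrow> bool" where
  "model_structure M \<longleftrightarrow> category M \<and>
     (\<forall>x\<in>Ob M. \<forall>y\<in>Ob M. \<forall>z\<in>Ob M. \<forall>f\<in>Ar M x y. \<forall>g\<in>Ar M y z.
        (weq M x y f \<and> weq M y z g \<longrightarrow> weq M x z (Cm M x y z g f)) \<and>
        (weq M x y f \<and> weq M x z (Cm M x y z g f) \<longrightarrow> weq M y z g) \<and>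
        (weq M y z g \<and> weq M x z (Cm M x y z g f) \<longrightarrow> weq M x y f)) \<and>
     retract_closed M (weq M) \<and> retract_closed M (fib M) \<and> retract_closed M (cof M) \<and>
     (\<forall>a\<in>Ob M. \<forall>b\<in>Ob M. \<forall>x\<in>Ob M. \<forall>y\<in>Ob M. \<forall>i\<in>Ar M a b. \<forall>p\<in>Ar M x y.
        cof M a b i \<and> fib M x y p \<and> (weq M a b i \<or> weq M x y p) \<longrightarrow> has_lift M a b i x y p) \<and>
     (\<forall>x\<in>Ob M. \<forall>y\<in>Ob M. \<forall>f\<in>Ar M x y.
        (\<exists>z\<in>Ob M. \<exists>i\<in>Ar M x z. \<exists>p\<in>Ar M z y.
           f = Cm M x z y p i \<and> cof M x z i \<and> weq M x z i \<and> fib M z y p) \<and>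
        (\<exists>z\<in>Ob M. \<exists>i\<in>Ar M x z. \<exists>p\<in>Ar M z y.
           f = Cm M x z y p i \<and> cof M x z i \<and> fib M z y p \<and> weq M z y p))"

definition left_quillen ::
  "('a, 'f, 'y) mcat_scheme \<Rightarrow> ('b, 'g, 'z) mcat_scheme \<Rightarrow> ('a, 'f, 'b, 'g) functr \<Rightarrow> bool" where
  "left_quillen M N L \<longleftrightarrow>
     (\<forall>x\<in>Ob M. \<forall>y\<in>Ob M. \<forall>f\<in>Ar M x y.
        (cof M x y f \<longrightarrow> cof N (FOb L x) (FOb L y) (FAr L x y f)) \<and>
        (cof M x y f \<and> weq M x y f \<longrightarrow>
           cof N (FOb L x) (FOb L y) (FAr L x y f) \<and> weq N (FOb L x) (FOb L y) (FAr L x y f)))"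

definition right_quillen ::
  "('a, 'f, 'y) mcat_scheme \<Rightarrow> ('b, 'g, 'z) mcat_scheme \<Rightarrow> ('a, 'f, 'b, 'g) functr \<Rightarrow> bool" where
  "right_quillen M N R \<longleftrightarrow>
     (\<forall>x\<in>Ob M. \<forall>y\<in>Ob M. \<forall>f\<in>Ar M x y.
        (fib M x y f \<longrightarrow> fib N (FOb R x) (FOb R y) (FAr R x y f)) \<and>
        (fib M x y f \<and> weq M x y f \<longrightarrow>
           fib N (FOb R x) (FOb R y) (FAr R x y f) \<and> weq N (FOb R x) (FOb R y) (FAr R x y f)))"

definition quillen_pair ::
  "('a, 'f, 'y) mcat_scheme \<Rightarrow> ('b, 'g, 'z) mcat_scheme \<Rightarrow>
   ('a, 'f, 'b, 'g) functr \<Rightarrow> ('b, 'g, 'a, 'f) functr \<Rightarrow> bool" where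
  "quillen_pair M N L R \<longleftrightarrow> adjunction M N L R \<and> left_quillen M N L"


section \<open>Non-unital dg categories and dg functors\<close>

text \<open>A dg category is given by its homogeneous morphisms, each carrying its source, target and
  degree (so the graded pieces of all hom-complexes, zeros included, are pairwise disjoint).
  Sums are only meaningful within one graded piece of one hom-complex.\<close>

record ('o, 'm, 'k) dgcat =
  Obj :: "'o set"
  Arr :: "'m set"
  Dom :: "'m \<Rightarrow> 'o"
  Cod :: "'m \<Rightarrow> 'o"
  Deg :: "'m \<Rightarrow> int"
  zer :: "'o \<Rightarrow> 'o \<Rightarrow> int \<Rightarrow> 'm"
  pls :: "'m \<Rightarrow> 'm \<Rightarrow> 'm"
  scl :: "'k \<Rightarrow> 'm \<Rightarrow> 'm"
  dif :: "'m \<Rightarrow> 'm"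
  cmp :: "'m \<Rightarrow> 'm \<Rightarrow> 'm"  \<comment> \<open>\<open>cmp A f g\<close> is \<open>f\<close> after \<open>g\<close>\<close>

definition Hom :: "('o, 'm, 'k, 'z) dgcat_scheme \<Rightarrow> 'o \<Rightarrow> 'o \<Rightarrow> int \<Rightarrow> 'm set" where
  "Hom A X Y n = {f \<in> Arr A. Dom A f = X \<and> Cod A f = Y \<and> Deg A f = n}"

text \<open>The vector space \<open>A(X,Y)\<^sup>n\<close>; the multiplicative fields of the record play no role.\<close>

definition HomM :: "('o, 'm, 'k, 'z) dgcat_scheme \<Rightarrow> 'o \<Rightarrow> 'o \<Rightarrow> int \<Rightarrow> ('k, 'm) module" where
  "HomM A X Y n = \<lparr>carrier = Hom A X Y n, mult = undefined, one = undefined,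
     zero = zer A X Y n, add = pls A, smult = scl A\<rparr>"

definition klinear :: "'k ring \<Rightarrow> ('k, 'm) module \<Rightarrow> ('k, 'n) module \<Rightarrow> ('m \<Rightarrow> 'n) \<Rightarrow> bool" where
  "klinear K M N h \<longleftrightarrow> h \<in> carrier M \<rightarrow> carrier N \<and>
     (\<forall>x\<in>carrier M. \<forall>y\<in>carrier M. h (x \<oplus>\<^bsub>M\<^esub> y) = h x \<oplus>\<^bsub>N\<^esub> h y) \<and>
     (\<forall>a\<in>carrier K. \<forall>x\<in>carrier M. h (a \<odot>\<^bsub>M\<^esub> x) = a \<odot>\<^bsub>N\<^esub> h x)"

definition sgnd :: "('k, 'm) module \<Rightarrow> int \<Rightarrow> 'm \<Rightarrow> 'm" where  \<comment> \<open>\<open>(-1)\<^sup>n x\<close>\<close>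
  "sgnd M n x = (if even n then x else \<ominus>\<^bsub>M\<^esub> x)"

definition nonunital_dgcat :: "'k ring \<Rightarrow> ('o, 'm, 'k, 'z) dgcat_scheme \<Rightarrow> bool" where
  "nonunital_dgcat K A \<longleftrightarrow>
     (\<forall>f\<in>Arr A. Dom A f \<in> Obj A \<and> Cod A f \<in> Obj A) \<and>
     (\<forall>X\<in>Obj A. \<forall>Y\<in>Obj A. \<forall>n. module K (HomM A X Y n)) \<and>
     (\<forall>X\<in>Obj A. \<forall>Y\<in>Obj A. \<forall>n. klinear K (HomM A X Y n) (HomM A X Y (n + 1)) (dif A) \<and>
        (\<forall>f\<in>Hom A X Y n. dif A (dif A f) = zer A X Y (n + 2))) \<and>
     (\<forall>X\<in>Obj A. \<forall>Y\<in>Obj A. \<forall>Z\<in>Obj A. \<forall>m n.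
        (\<forall>f\<in>Hom A Y Z m. klinear K (HomM A X Y n) (HomM A X Z (m + n)) (\<lambda>g. cmp A f g)) \<and>
        (\<forall>g\<in>Hom A X Y n. klinear K (HomM A Y Z m) (HomM A X Z (m + n)) (\<lambda>f. cmp A f g)) \<and>
        (\<forall>f\<in>Hom A Y Z m. \<forall>g\<in>Hom A X Y n.
           dif A (cmp A f g) =
             cmp A (dif A f) g \<oplus>\<^bsub>HomM A X Z (m + n + 1)\<^esub>
             sgnd (HomM A X Z (m + n + 1)) m (cmp A f (dif A g)))) \<and>
     (\<forall>f\<in>Arr A. \<forall>g\<in>Arr A. \<forall>h\<in>Arr A. Dom A f = Cod A g \<and> Dom A g = Cod A h \<longrightarrow>
        cmp A (cmp A f g) h = cmp A f (cmp A g h))"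

record ('o, 'm, 'p, 'n) dgfun =
  fobj :: "'o \<Rightarrow> 'p"
  farr :: "'m \<Rightarrow> 'n"

text \<open>Both maps are required to be \<open>undefined\<close> outside their domain, so that functors which agree
  are equal.\<close>

definition nonunital_dgfun :: "'k ring \<Rightarrow> ('o, 'm, 'k, 'y) dgcat_scheme \<Rightarrow>
    ('p, 'n, 'k, 'z) dgcat_scheme \<Rightarrow> ('o, 'm, 'p, 'n) dgfun \<Rightarrow> bool" where
  "nonunital_dgfun K C D F \<longleftrightarrow>
     fobj F \<in> Obj C \<rightarrow>\<^sub>E Obj D \<and> farr F \<in> extensional (Arr C) \<and>
     (\<forall>X\<in>Obj C. \<forall>Y\<in>Obj C. \<forall>n.
        klinear K (HomM C X Y n) (HomM D (fobj F X) (fobj F Y) n) (farr F)) \<and>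
     (\<forall>f\<in>Arr C. farr F (dif C f) = dif D (farr F f)) \<and>
     (\<forall>f\<in>Arr C. \<forall>g\<in>Arr C. Dom C f = Cod C g \<longrightarrow>
        farr F (cmp C f g) = cmp D (farr F f) (farr F g))"

definition dgfun_id :: "('o, 'm, 'k, 'z) dgcat_scheme \<Rightarrow> ('o, 'm, 'o, 'm) dgfun" where
  "dgfun_id C = \<lparr>fobj = restrict (\<lambda>X. X) (Obj C), farr = restrict (\<lambda>f. f) (Arr C)\<rparr>"

definition dgfun_comp :: "('o, 'm, 'k, 'z) dgcat_scheme \<Rightarrow> ('p, 'n, 'q, 'l) dgfun \<Rightarrow>
    ('o, 'm, 'p, 'n) dgfun \<Rightarrow> ('o, 'm, 'q, 'l) dgfun" where
  "dgfun_comp C G F = \<lparr>fobj = compose (Obj C) (fobj G) (fobj F),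
     farr = compose (Arr C) (farr G) (farr F)\<rparr>"


section \<open>Strictly unital and weakly unital dg categories\<close>

record ('o, 'm, 'k) udgcat = "('o, 'm, 'k) dgcat" +
  idn :: "'o \<Rightarrow> 'm"

definition unital_dgcat :: "'k ring \<Rightarrow> ('o, 'm, 'k, 'z) udgcat_scheme \<Rightarrow> bool" where
  "unital_dgcat K A \<longleftrightarrow> nonunital_dgcat K A \<and>
     (\<forall>X\<in>Obj A. idn A X \<in> Hom A X X 0 \<and> dif A (idn A X) = zer A X X 1) \<and>
     (\<forall>f\<in>Arr A. cmp A (idn A (Cod A f)) f = f \<and> cmp A f (idn A (Dom A f)) = f)"

definition unital_dgfun :: "'k ring \<Rightarrow> ('o, 'm, 'k, 'y) udgcat_scheme \<Rightarrow>
    ('p, 'n, 'k, 'z) udgcat_scheme \<Rightarrow> ('o, 'm, 'p, 'n) dgfun \<Rightarrow> bool" where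
  "unital_dgfun K C D F \<longleftrightarrow> nonunital_dgfun K C D F \<and>
     (\<forall>X\<in>Obj C. farr F (idn C X) = idn D (fobj F X))"

text \<open>\<open>A \<oplus> \<Bbbk>\<^sub>A\<close>: the pair \<open>(f, c)\<close> stands for \<open>f + c \<cdot> 1\<^sub>X\<close>, with \<open>c = 0\<close> unless \<open>f\<close> is an
  endomorphism of degree 0.  A scalar 0 is never multiplied out in the composition, since
  \<open>scl A 0 g\<close> may then lie in the wrong hom-space.\<close>

definition add_units :: "'k ring \<Rightarrow> ('o, 'm, 'k, 'z) dgcat_scheme \<Rightarrow> ('o, 'm \<times> 'k, 'k) dgcat" where
  "add_units K A = \<lparr>
     Obj = Obj A,
     Arr = {(f, c). f \<in> Arr A \<and> c \<in> carrier K \<and> (c \<noteq> \<zero>\<^bsub>K\<^esub> \<longrightarrow> Dom A f = Cod A f \<and> Deg A f = 0)},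
     Dom = (\<lambda>(f, c). Dom A f),
     Cod = (\<lambda>(f, c). Cod A f),
     Deg = (\<lambda>(f, c). Deg A f),
     zer = (\<lambda>X Y n. (zer A X Y n, \<zero>\<^bsub>K\<^esub>)),
     pls = (\<lambda>(f, a) (g, b). (pls A f g, a \<oplus>\<^bsub>K\<^esub> b)),
     scl = (\<lambda>r (f, a). (scl A r f, r \<otimes>\<^bsub>K\<^esub> a)),
     dif = (\<lambda>(f, a). (dif A f, \<zero>\<^bsub>K\<^esub>)),
     cmp = (\<lambda>(f, a) (g, b).
       (let z = zer A (Dom A g) (Cod A f) (Deg A f + Deg A g) in
         (pls A (pls A (cmp A f g) (if a = \<zero>\<^bsub>K\<^esub> then z else scl A a g))
            (if b = \<zero>\<^bsub>K\<^esub> then z else scl A b f),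
          a \<otimes>\<^bsub>K\<^esub> b)))\<rparr>"

definition inc :: "'k ring \<Rightarrow> 'm \<Rightarrow> 'm \<times> 'k" where
  "inc K f = (f, \<zero>\<^bsub>K\<^esub>)"

definition unit_of :: "'k ring \<Rightarrow> ('o, 'm, 'k, 'z) dgcat_scheme \<Rightarrow> 'o \<Rightarrow> 'm \<times> 'k" where
  "unit_of K A X = (zer A X X 0, \<one>\<^bsub>K\<^esub>)"

definition composable :: "('o, 'm, 'k, 'z) dgcat_scheme \<Rightarrow> 'm list \<Rightarrow> bool" where
  "composable B fs \<longleftrightarrow> fs \<noteq> [] \<and> set fs \<subseteq> Arr B \<and>
     (\<forall>i. Suc i < length fs \<longrightarrow> Dom B (fs ! i) = Cod B (fs ! Suc i))"

definition deg_sum :: "('o, 'm, 'k, 'z) dgcat_scheme \<Rightarrow> 'm list \<Rightarrow> int" where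
  "deg_sum B fs = sum_list (map (Deg B) fs)"

text \<open>An \<open>A\<^sub>\<infinity>\<close> functor between dg categories: \<open>F [f\<^sub>1, \<dots>, f\<^sub>n]\<close> is
  \<open>F\<^sub>n(f\<^sub>1, \<dots>, f\<^sub>n)\<close>, for composable \<open>f\<^sub>1 \<circ> \<dots> \<circ> f\<^sub>n\<close>; it is multilinear of degree \<open>1 - n\<close>.  The
  structure equation is
  \<open>\<Sum> (-1)\<^bsup>r + s t\<^esup> F\<^sub>u (1\<^bsup>\<otimes>r\<^esup> \<otimes> m\<^sub>s \<otimes> 1\<^bsup>\<otimes>t\<^esup>) = m\<^sub>1 F\<^sub>n + \<Sum> (-1)\<^bsup>i - 1\<^esup> m\<^sub>2 (F\<^sub>i \<otimes> F\<^bsub>n - i\<^esub>)\<close>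
  (\<open>m\<^sub>1 = d\<close>, \<open>m\<^sub>2\<close> the composition, \<open>m\<^sub>s = 0\<close> for \<open>s \<ge> 3\<close>), the further signs coming from the
  Koszul rule \<open>(f \<otimes> g)(x \<otimes> y) = (-1)\<^bsup>|g||x|\<^esup> f x \<otimes> g y\<close>.\<close>

definition ainf_functor :: "'k ring \<Rightarrow> ('o, 'm, 'k, 'y) dgcat_scheme \<Rightarrow>
    ('p, 'n, 'k, 'z) dgcat_scheme \<Rightarrow> ('o \<Rightarrow> 'p) \<Rightarrow> ('m list \<Rightarrow> 'n) \<Rightarrow> bool" where
  "ainf_functor K B A F0 F \<longleftrightarrow>
     F0 \<in> Obj B \<rightarrow> Obj A \<and>
     (\<forall>fs. composable B fs \<longrightarrow>
        F fs \<in> Hom A (F0 (Dom B (last fs))) (F0 (Cod B (hd fs)))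
                 (deg_sum B fs + 1 - int (length fs))) \<and>
     (\<forall>gs x y hs. composable B (gs @ x # hs) \<and> composable B (gs @ y # hs) \<and>
        Dom B x = Dom B y \<and> Cod B x = Cod B y \<and> Deg B x = Deg B y \<longrightarrow>
        F (gs @ pls B x y # hs) = pls A (F (gs @ x # hs)) (F (gs @ y # hs))) \<and>
     (\<forall>gs x hs. \<forall>c\<in>carrier K. composable B (gs @ x # hs) \<longrightarrow>
        F (gs @ scl B c x # hs) = scl A c (F (gs @ x # hs))) \<and>
     (\<forall>fs. composable B fs \<longrightarrow>
        (let n = length fs;
             M = HomM A (F0 (Dom B (last fs))) (F0 (Cod B (hd fs))) (deg_sum B fs + 2 - int n)
         in
           sgnd M (int n - 1)
             (\<Oplus>\<^bsub>M\<^esub> i\<in>{..<n}. sgnd M (deg_sum B (take i fs)) (F (fs[i := dif B (fs ! i)])))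
           \<oplus>\<^bsub>M\<^esub>
             (\<Oplus>\<^bsub>M\<^esub> i\<in>{..<n - 1}. sgnd M (int i)
                (F (take i fs @ cmp B (fs ! i) (fs ! Suc i) # drop (i + 2) fs)))
           = dif A (F fs)
           \<oplus>\<^bsub>M\<^esub>
             (\<Oplus>\<^bsub>M\<^esub> i\<in>{1..<n}.
                sgnd M (int i - 1 + (1 - int (n - i)) * deg_sum B (take i fs))
                  (cmp A (F (take i fs)) (F (drop i fs))))))"

record ('o, 'm, 'k) wudgcat = "('o, 'm, 'k) udgcat" +
  wp :: "('m \<times> 'k) list \<Rightarrow> 'm"

definition weakly_unital_dgcat :: "'k ring \<Rightarrow> ('o, 'm, 'k, 'z) wudgcat_scheme \<Rightarrow> bool" where
  "weakly_unital_dgcat K A \<longleftrightarrow> nonunital_dgcat K A \<and>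
     (\<forall>X\<in>Obj A. idn A X \<in> Hom A X X 0 \<and> dif A (idn A X) = zer A X X 1 \<and>
        cmp A (idn A X) (idn A X) = idn A X) \<and>
     ainf_functor K (add_units K A) A (\<lambda>X. X) (wp A) \<and>
     (\<forall>f\<in>Arr A. wp A [inc K f] = f) \<and>
     (\<forall>fs. composable A fs \<and> length fs \<ge> 2 \<longrightarrow>
        wp A (map (inc K) fs) =
          zer A (Dom A (last fs)) (Cod A (hd fs)) (deg_sum A fs + 1 - int (length fs))) \<and>
     (\<forall>X\<in>Obj A. wp A [unit_of K A X] = idn A X) \<and>
     (\<forall>X\<in>Obj A. \<forall>n\<ge>2. wp A (replicate n (unit_of K A X)) = zer A X X (1 - int n))"

definition weakly_unital_dgfun :: "'k ring \<Rightarrow> ('o, 'm, 'k, 'y) wudgcat_scheme \<Rightarrow>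
    ('p, 'n, 'k, 'z) wudgcat_scheme \<Rightarrow> ('o, 'm, 'p, 'n) dgfun \<Rightarrow> bool" where
  "weakly_unital_dgfun K C D F \<longleftrightarrow> nonunital_dgfun K C D F \<and>
     (\<forall>fs. composable (add_units K C) fs \<longrightarrow>
        farr F (wp C fs) = wp D (map (\<lambda>(f, c). (farr F f, c)) fs))"

text \<open>The categories of small dg categories whose objects and morphisms are taken from the types
  \<open>'o\<close> and \<open>'m\<close>, which play the role of the universe.\<close>

definition Cat_dg :: "'k ring \<Rightarrow> (('o, 'm, 'k) udgcat, ('o, 'm, 'o, 'm) dgfun) cat" where
  "Cat_dg K = \<lparr>Ob = {A. unital_dgcat K A}, Ar = (\<lambda>A B. {F. unital_dgfun K A B F}),
     Idt = dgfun_id, Cm = (\<lambda>A B C G F. dgfun_comp A G F)\<rparr>"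

definition Cat_dgwu :: "'k ring \<Rightarrow> (('o, 'm, 'k) wudgcat, ('o, 'm, 'o, 'm) dgfun) cat" where
  "Cat_dgwu K = \<lparr>Ob = {A. weakly_unital_dgcat K A}, Ar = (\<lambda>A B. {F. weakly_unital_dgfun K A B F}),
     Idt = dgfun_id, Cm = (\<lambda>A B C G F. dgfun_comp A G F)\<rparr>"


section \<open>Cohomology, weak equivalences, fibrations\<close>

definition cocycles :: "('o, 'm, 'k, 'z) dgcat_scheme \<Rightarrow> 'o \<Rightarrow> 'o \<Rightarrow> int \<Rightarrow> 'm set" where
  "cocycles A X Y n = {f \<in> Hom A X Y n. dif A f = zer A X Y (n + 1)}"

definition coh_class :: "('o, 'm, 'k, 'z) dgcat_scheme \<Rightarrow> 'm \<Rightarrow> 'm set" where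
  "coh_class A f =
     (dif A ` Hom A (Dom A f) (Cod A f) (Deg A f - 1)) +>\<^bsub>HomM A (Dom A f) (Cod A f) (Deg A f)\<^esub> f"

definition cohomology :: "('o, 'm, 'k, 'z) dgcat_scheme \<Rightarrow> 'o \<Rightarrow> 'o \<Rightarrow> int \<Rightarrow> 'm set set" where
  "cohomology A X Y n = coh_class A ` cocycles A X Y n"

text \<open>The unions below are over equal sets: any choice of representatives gives the same class.\<close>

definition coh_map ::
  "('p, 'n, 'k, 'z) dgcat_scheme \<Rightarrow> ('o, 'm, 'p, 'n) dgfun \<Rightarrow> 'm set \<Rightarrow> 'n set" where
  "coh_map D F c = (\<Union>f\<in>c. coh_class D (farr F f))"

definition H0 :: "('o, 'm, 'k, 'z) udgcat_scheme \<Rightarrow> ('o, 'm set) cat" where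
  "H0 A = \<lparr>Ob = Obj A, Ar = (\<lambda>X Y. cohomology A X Y 0), Idt = (\<lambda>X. coh_class A (idn A X)),
     Cm = (\<lambda>X Y Z c e. \<Union>f\<in>c. \<Union>g\<in>e. coh_class A (cmp A f g))\<rparr>"

definition H0_map ::
  "('p, 'n, 'k, 'z) dgcat_scheme \<Rightarrow> ('o, 'm, 'p, 'n) dgfun \<Rightarrow> ('o, 'm set, 'p, 'n set) functr" where
  "H0_map D F = \<lparr>FOb = fobj F, FAr = (\<lambda>X Y. coh_map D F)\<rparr>"

definition dg_weq :: "('o, 'm, 'k, 'y) udgcat_scheme \<Rightarrow> ('p, 'n, 'k, 'z) udgcat_scheme \<Rightarrow>
    ('o, 'm, 'p, 'n) dgfun \<Rightarrow> bool" where
  "dg_weq C D F \<longleftrightarrow>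
     (\<forall>X\<in>Obj C. \<forall>Y\<in>Obj C. \<forall>n.
        bij_betw (coh_map D F) (cohomology C X Y n) (cohomology D (fobj F X) (fobj F Y) n)) \<and>
     is_equivalence (H0 C) (H0 D) (H0_map D F)"

definition dg_fib :: "('o, 'm, 'k, 'y) udgcat_scheme \<Rightarrow> ('p, 'n, 'k, 'z) udgcat_scheme \<Rightarrow>
    ('o, 'm, 'p, 'n) dgfun \<Rightarrow> bool" where
  "dg_fib C D F \<longleftrightarrow>
     (\<forall>X\<in>Obj C. \<forall>Y\<in>Obj C. \<forall>n. farr F ` Hom C X Y n = Hom D (fobj F X) (fobj F Y) n) \<and>
     (\<forall>X\<in>Obj C. \<forall>Z\<in>Obj D. \<forall>g\<in>cocycles D (fobj F X) Z 0.
        iso_in (H0 D) (fobj F X) Z (coh_class D g) \<longrightarrow>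
        (\<exists>Y\<in>Obj C. \<exists>f\<in>cocycles C X Y 0.
           iso_in (H0 C) X Y (coh_class C f) \<and> fobj F Y = Z \<and> farr F f = g))"

definition Model_dg :: "'k ring \<Rightarrow> (('o, 'm, 'k) udgcat, ('o, 'm, 'o, 'm) dgfun) mcat" where
  "Model_dg K = with_cofibrations (Cat_dg K) dg_weq dg_fib"

definition Model_dgwu :: "'k ring \<Rightarrow> (('o, 'm, 'k) wudgcat, ('o, 'm, 'o, 'm) dgfun) mcat" where
  "Model_dgwu K = with_cofibrations (Cat_dgwu K) dg_weq dg_fib"


section \<open>The functors L and R\<close>

definition dg_ideal :: "'k ring \<Rightarrow> ('o, 'm, 'k, 'z) dgcat_scheme \<Rightarrow> 'm set \<Rightarrow> bool" where
  "dg_ideal K A I \<longleftrightarrow> I \<subseteq> Arr A \<and>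
     (\<forall>X\<in>Obj A. \<forall>Y\<in>Obj A. \<forall>n. submodule (I \<inter> Hom A X Y n) K (HomM A X Y n)) \<and>
     (\<forall>f\<in>I. dif A f \<in> I) \<and>
     (\<forall>f\<in>Arr A. \<forall>g\<in>Arr A. Dom A f = Cod A g \<and> (f \<in> I \<or> g \<in> I) \<longrightarrow> cmp A f g \<in> I)"

definition wp_ideal :: "'k ring \<Rightarrow> ('o, 'm, 'k, 'z) wudgcat_scheme \<Rightarrow> 'm set" where
  "wp_ideal K C = \<Inter>{I. dg_ideal K C I \<and>
     (\<forall>fs. composable (add_units K C) fs \<and> length fs \<ge> 2 \<longrightarrow> wp C fs \<in> I)}"

text \<open>\<open>C / \<I>\<close>, where each class \<open>\<I> + f\<close> is named by one chosen element of it, so that the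
  quotient has its morphisms in the same type as \<open>C\<close>.\<close>

definition rep :: "'k ring \<Rightarrow> ('o, 'm, 'k, 'z) wudgcat_scheme \<Rightarrow> 'm \<Rightarrow> 'm" where
  "rep K C f = (SOME g. g \<in> (wp_ideal K C \<inter> Hom C (Dom C f) (Cod C f) (Deg C f))
                        +>\<^bsub>HomM C (Dom C f) (Cod C f) (Deg C f)\<^esub> f)"

definition L_obj :: "'k ring \<Rightarrow> ('o, 'm, 'k) wudgcat \<Rightarrow> ('o, 'm, 'k) udgcat" where
  "L_obj K C = \<lparr>
     Obj = Obj C, Arr = rep K C ` Arr C, Dom = Dom C, Cod = Cod C, Deg = Deg C,
     zer = (\<lambda>X Y n. rep K C (zer C X Y n)),
     pls = (\<lambda>f g. rep K C (pls C f g)),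
     scl = (\<lambda>c f. rep K C (scl C c f)),
     dif = (\<lambda>f. rep K C (dif C f)),
     cmp = (\<lambda>f g. rep K C (cmp C f g)),
     idn = (\<lambda>X. rep K C (idn C X))\<rparr>"

definition L_functor :: "'k ring \<Rightarrow> (('o, 'm, 'k) wudgcat, ('o, 'm, 'o, 'm) dgfun,
    ('o, 'm, 'k) udgcat, ('o, 'm, 'o, 'm) dgfun) functr" where
  "L_functor K = \<lparr>FOb = L_obj K,
     FAr = (\<lambda>C D F. \<lparr>fobj = fobj F,
        farr = restrict (\<lambda>f. rep K D (farr F f)) (Arr (L_obj K C))\<rparr>)\<rparr>"

definition p_dg :: "'k ring \<Rightarrow> ('o, 'm, 'k, 'z) udgcat_scheme \<Rightarrow> ('m \<times> 'k) list \<Rightarrow> 'm" where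
  "p_dg K A fs = (case fs of
       [(f, c)] \<Rightarrow> if c = \<zero>\<^bsub>K\<^esub> then f else pls A f (scl A c (idn A (Dom A f)))
     | _ \<Rightarrow> (let B = add_units K A in
         zer A (Dom B (last fs)) (Cod B (hd fs)) (deg_sum B fs + 1 - int (length fs))))"

definition R_functor :: "'k ring \<Rightarrow> (('o, 'm, 'k) udgcat, ('o, 'm, 'o, 'm) dgfun,
    ('o, 'm, 'k) wudgcat, ('o, 'm, 'o, 'm) dgfun) functr" where
  "R_functor K = \<lparr>FOb = (\<lambda>A. udgcat.extend A \<lparr>wp = p_dg K A\<rparr>), FAr = (\<lambda>A B F. F)\<rparr>"

end

theory Submission
  imports Defs
begin

text \<open>The ideal \<open>\<I>\<close> is what a weakly unital functor \<open>C \<rightarrow> R(A)\<close> must kill, since \<open>p\<^sub>n\<close> vanishes on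
  \<open>R(A)\<close> for \<open>n \<ge> 2\<close>; so such functors factor through \<open>C \<rightarrow> C/\<I>\<close>.  That the class of \<open>id\<^sub>X\<close> is a strict
  identity in \<open>C/\<I>\<close> is the \<open>A\<^sub>\<infinity>\<close> equation for two arguments, which modulo \<open>\<I>\<close> says that \<open>p\<^sub>1\<close> is
  multiplicative.  The functor \<open>R\<close> changes neither hom-complexes nor cohomology, so it preserves
  fibrations and weak equivalences; \<open>L\<close> preserves (trivial) cofibrations by transposing lifting
  problems and the retract argument.\<close>

section \<open>Lifting properties and Quillen pairs\<close>

text \<open>The quotient must have arrows of the same type as C, so a class in C/I is stored as a
  chosen representative: \<open>L_obj\<close> has the arrows \<open>rep K C f\<close>, and each of
  its operations is the operation of C followed by \<open>rep\<close>. Its axioms are therefore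
  transported along the surjection \<open>rep\<close>, and the functor induced on C/I is a mere
  restriction. Each graded piece of each hom-complex has its own zero, so the kernel of a functor is
  the preimage of the set of all zeros, and every additive law has to name its hom-space. A weakly
  unital functor is only asked to commute with the p_n; that the induced functor preserves
  identities comes from p_1(1_X) = id_X on both sides. On the model side, being right Quillen is a
  property of R alone, whereas a lifting property of L(f) against fibrations does not by itself say
  that L(f) is a weak equivalence: this is what factorization in the target and the stability of
  weak equivalences under retracts supply.\<close>

lemma categoryD:
  assumes "category \<C>"
  shows category_idt: "x \<in> Ob \<C> \<Longrightarrow> Idt \<C> x \<in> Ar \<C> x x"
    and category_idt_left: "\<lbrakk>x \<in> Ob \<C>; y \<in> Ob \<C>; f \<in> Ar \<C> x y\<rbrakk> \<Longrightarrow> Cm \<C> x y y (Idt \<C> y) f = f"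
    and category_idt_right: "\<lbrakk>x \<in> Ob \<C>; y \<in> Ob \<C>; f \<in> Ar \<C> x y\<rbrakk> \<Longrightarrow> Cm \<C> x x y f (Idt \<C> x) = f"
    and category_comp: "\<lbrakk>x \<in> Ob \<C>; y \<in> Ob \<C>; z \<in> Ob \<C>; f \<in> Ar \<C> x y; g \<in> Ar \<C> y z\<rbrakk>
      \<Longrightarrow> Cm \<C> x y z g f \<in> Ar \<C> x z"
  using assms unfolding category_def by blast+

lemma is_functorD:
  assumes "is_functor \<C> \<D> T"
  shows is_functor_ob: "x \<in> Ob \<C> \<Longrightarrow> FOb T x \<in> Ob \<D>"
    and is_functor_idt: "x \<in> Ob \<C> \<Longrightarrow> FAr T x x (Idt \<C> x) = Idt \<D> (FOb T x)"
    and is_functor_ar: "\<lbrakk>x \<in> Ob \<C>; y \<in> Ob \<C>; f \<in> Ar \<C> x y\<rbrakk> \<Longrightarrow> FAr T x y f \<in> Ar \<D> (FOb T x) (FOb T y)"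
  using assms unfolding is_functor_def by blast+

text \<open>The bijections \<open>\<phi>\<close> turn a square against p into a square against R(p).
  The lift found there is brought back by surjectivity of \<open>\<phi>\<close>, and injectivity
  turns the two transposed triangles into the wanted ones.\<close>

lemma adjunction_has_lift:
  assumes adj: "adjunction \<C> \<D> L R"
    and ob: "a \<in> Ob \<C>" "b \<in> Ob \<C>" "x \<in> Ob \<D>" "y \<in> Ob \<D>"
    and f: "f \<in> Ar \<C> a b" and p: "p \<in> Ar \<D> x y"
    and lift: "has_lift \<C> a b f (FOb R x) (FOb R y) (FAr R x y p)"
  shows "has_lift \<D> (FOb L a) (FOb L b) (FAr L a b f) x y p"
  unfolding has_lift_def
proof (intro ballI impI)
  fix u v
  assume u: "u \<in> Ar \<D> (FOb L a) x" and v: "v \<in> Ar \<D> (FOb L b) y"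
    and sq: "Cm \<D> (FOb L a) x y p u = Cm \<D> (FOb L a) (FOb L b) y v (FAr L a b f)"
  have C: "category \<C>" and D: "category \<D>" and L: "is_functor \<C> \<D> L" and R: "is_functor \<D> \<C> R"
    using adj unfolding adjunction_def by auto
  obtain \<phi> where
    bij: "\<And>c d. c \<in> Ob \<C> \<Longrightarrow> d \<in> Ob \<D> \<Longrightarrow> bij_betw (\<phi> c d) (Ar \<D> (FOb L c) d) (Ar \<C> c (FOb R d))"
    and nat: "\<And>c c' d d' h k u. \<lbrakk>c \<in> Ob \<C>; c' \<in> Ob \<C>; d \<in> Ob \<D>; d' \<in> Ob \<D>; h \<in> Ar \<C> c' c;
        k \<in> Ar \<D> d d'; u \<in> Ar \<D> (FOb L c) d\<rbrakk> \<Longrightarrow>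
        \<phi> c' d' (Cm \<D> (FOb L c') d d' k (Cm \<D> (FOb L c') (FOb L c) d u (FAr L c' c h))) =
        Cm \<C> c' (FOb R d) (FOb R d') (FAr R d d' k) (Cm \<C> c' c (FOb R d) (\<phi> c d u) h)"
    using adj unfolding adjunction_def by blast
  have \<phi>: "\<phi> c d w \<in> Ar \<C> c (FOb R d)"
    if "c \<in> Ob \<C>" "d \<in> Ob \<D>" "w \<in> Ar \<D> (FOb L c) d" for c d w
    using bij_betwE[OF bij[OF that(1,2)]] that(3) by blast
  note Lob = is_functor_ob[OF L] and Rob = is_functor_ob[OF R]
  note Lar = is_functor_ar[OF L]
  \<comment> \<open>Naturality in the first variable alone: k is the identity of d.\<close>
  have nat_left: "\<phi> a d (Cm \<D> (FOb L a) (FOb L b) d w (FAr L a b f)) = Cm \<C> a b (FOb R d) (\<phi> b d w) f"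
    if d: "d \<in> Ob \<D>" and w: "w \<in> Ar \<D> (FOb L b) d" for d w
  proof -
    have "Cm \<D> (FOb L a) (FOb L b) d w (FAr L a b f) \<in> Ar \<D> (FOb L a) d"
      using category_comp[OF D] Lob ob d w Lar f by blast
    moreover have "Cm \<C> a b (FOb R d) (\<phi> b d w) f \<in> Ar \<C> a (FOb R d)"
      using category_comp[OF C] ob f d w \<phi> Rob by blast
    ultimately show ?thesis
      using nat[OF ob(2,1) d d f category_idt[OF D d] w] d ob Lob Rob
      by (simp add: is_functor_idt[OF R] category_idt_left[OF C] category_idt_left[OF D])
  qed
  \<comment> \<open>Naturality in the second variable alone: h is the identity of c.\<close>
  have nat_right: "\<phi> c y (Cm \<D> (FOb L c) x y p w) = Cm \<C> c (FOb R x) (FOb R y) (FAr R x y p) (\<phi> c x w)"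
    if c: "c \<in> Ob \<C>" and w: "w \<in> Ar \<D> (FOb L c) x" for c w
    using nat[OF c c ob(3,4) category_idt[OF C c] p w] c ob Lob Rob \<phi>[OF c ob(3) w] w
    by (simp add: is_functor_idt[OF L] category_idt_right[OF C] category_idt_right[OF D])
  have sq': "Cm \<C> a (FOb R x) (FOb R y) (FAr R x y p) (\<phi> a x u) = Cm \<C> a b (FOb R y) (\<phi> b y v) f"
    using nat_left[OF ob(4) v] nat_right[OF ob(1) u] sq by simp
  obtain h' where h': "h' \<in> Ar \<C> b (FOb R x)"
    and h'f: "Cm \<C> a b (FOb R x) h' f = \<phi> a x u"
    and ph': "Cm \<C> b (FOb R x) (FOb R y) (FAr R x y p) h' = \<phi> b y v"
    using lift[unfolded has_lift_def, rule_format, OF \<phi>[OF ob(1,3) u] \<phi>[OF ob(2,4) v] sq'] by blast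
  obtain h where h: "h \<in> Ar \<D> (FOb L b) x" and \<phi>h: "\<phi> b x h = h'"
    using bij_betw_imp_surj_on[OF bij[OF ob(2,3)]] h' by (metis imageE)
  have "Cm \<D> (FOb L a) (FOb L b) x h (FAr L a b f) \<in> Ar \<D> (FOb L a) x"
    using category_comp[OF D] Lob ob h Lar f by blast
  moreover have "\<phi> a x (Cm \<D> (FOb L a) (FOb L b) x h (FAr L a b f)) = \<phi> a x u"
    using nat_left[OF ob(3) h] \<phi>h h'f by simp
  ultimately have 1: "Cm \<D> (FOb L a) (FOb L b) x h (FAr L a b f) = u"
    using inj_onD[OF bij_betw_imp_inj_on[OF bij[OF ob(1,3)]]] u by blast
  have "Cm \<D> (FOb L b) x y p h \<in> Ar \<D> (FOb L b) y"
    using category_comp[OF D] Lob ob h p by blast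
  moreover have "\<phi> b y (Cm \<D> (FOb L b) x y p h) = \<phi> b y v"
    using nat_right[OF ob(2) h] \<phi>h ph' by simp
  ultimately have 2: "Cm \<D> (FOb L b) x y p h = v"
    using inj_onD[OF bij_betw_imp_inj_on[OF bij[OF ob(2,4)]]] v by blast
  show "\<exists>h\<in>Ar \<D> (FOb L b) x. Cm \<D> (FOb L a) (FOb L b) x h (FAr L a b f) = u \<and>
      Cm \<D> (FOb L b) x y p h = v"
    using h 1 2 by blast
qed

text \<open>The retract argument: the lift exhibits \<open>p \<circ> i\<close> as a retract of \<open>i\<close>.\<close>

lemma retract_closed_lift:
  assumes C: "category \<C>" and ret: "retract_closed \<C> P"
    and ob: "a \<in> Ob \<C>" "b \<in> Ob \<C>" "z \<in> Ob \<C>"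
    and i: "i \<in> Ar \<C> a z" and p: "p \<in> Ar \<C> z b"
    and Pi: "P a z i" and lift: "has_lift \<C> a b (Cm \<C> a z b p i) z b p"
  shows "P a b (Cm \<C> a z b p i)"
proof -
  let ?f = "Cm \<C> a z b p i"
  have f: "?f \<in> Ar \<C> a b" using category_comp[OF C] ob i p by blast
  note idt = category_idt[OF C] and idl = category_idt_left[OF C] and idr = category_idt_right[OF C]
  \<comment> \<open>The square has i on top and the identity of b at the bottom, so h is a section
    of p.\<close>
  obtain h where h: "h \<in> Ar \<C> b z" "Cm \<C> a b z h ?f = i" "Cm \<C> b z b p h = Idt \<C> b"
    using lift i idt[OF ob(2)] idl[OF ob(1,2) f] unfolding has_lift_def by fastforce
  show ?thesis
    \<comment> \<open>The retract diagram has identities of a on the source side and h followed by p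
      on the target side.\<close>
    using ret[unfolded retract_closed_def, rule_format, OF ob(1,2,1,3) f i idt[OF ob(1)]
        idt[OF ob(1)] h(1) p] idl[OF ob(1,1) idt[OF ob(1)]] idr[OF ob(1,3) i] idr[OF ob(1,2) f] h Pi
    by simp
qed

lemma model_structureD:
  assumes "model_structure M"
  shows model_structure_category: "category M"
    and model_structure_retract_weq: "retract_closed M (weq M)"
    and model_structure_retract_cof: "retract_closed M (cof M)"
    and model_structure_lift: "\<lbrakk>a \<in> Ob M; b \<in> Ob M; x \<in> Ob M; y \<in> Ob M; i \<in> Ar M a b; p \<in> Ar M x y;
      cof M a b i; fib M x y p; weq M a b i \<or> weq M x y p\<rbrakk> \<Longrightarrow> has_lift M a b i x y p"
    and model_structure_factor_trivial_cof: "\<lbrakk>x \<in> Ob M; y \<in> Ob M; f \<in> Ar M x y\<rbrakk> \<Longrightarrow>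
      \<exists>z\<in>Ob M. \<exists>i\<in>Ar M x z. \<exists>p\<in>Ar M z y.
        f = Cm M x z y p i \<and> cof M x z i \<and> weq M x z i \<and> fib M z y p"
    and model_structure_factor_trivial_fib: "\<lbrakk>x \<in> Ob M; y \<in> Ob M; f \<in> Ar M x y\<rbrakk> \<Longrightarrow>
      \<exists>z\<in>Ob M. \<exists>i\<in>Ar M x z. \<exists>p\<in>Ar M z y.
        f = Cm M x z y p i \<and> cof M x z i \<and> fib M z y p \<and> weq M z y p"
proof -
  note * = assms[unfolded model_structure_def]
  show "category M" "retract_closed M (weq M)" "retract_closed M (cof M)" using * by simp_all
  have lift: "\<forall>a\<in>Ob M. \<forall>b\<in>Ob M. \<forall>x\<in>Ob M. \<forall>y\<in>Ob M. \<forall>i\<in>Ar M a b. \<forall>p\<in>Ar M x y.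
        cof M a b i \<and> fib M x y p \<and> (weq M a b i \<or> weq M x y p) \<longrightarrow> has_lift M a b i x y p"
    using * by (elim conjE)
  then show "\<lbrakk>a \<in> Ob M; b \<in> Ob M; x \<in> Ob M; y \<in> Ob M; i \<in> Ar M a b; p \<in> Ar M x y;
      cof M a b i; fib M x y p; weq M a b i \<or> weq M x y p\<rbrakk> \<Longrightarrow> has_lift M a b i x y p"
    by blast
  have fac: "\<forall>x\<in>Ob M. \<forall>y\<in>Ob M. \<forall>f\<in>Ar M x y.
        (\<exists>z\<in>Ob M. \<exists>i\<in>Ar M x z. \<exists>p\<in>Ar M z y.
           f = Cm M x z y p i \<and> cof M x z i \<and> weq M x z i \<and> fib M z y p) \<and>
        (\<exists>z\<in>Ob M. \<exists>i\<in>Ar M x z. \<exists>p\<in>Ar M z y.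
           f = Cm M x z y p i \<and> cof M x z i \<and> fib M z y p \<and> weq M z y p)"
    using * by (elim conjE)
  { assume "x \<in> Ob M" "y \<in> Ob M" "f \<in> Ar M x y"
    note fac[rule_format, OF this]
    then show "\<exists>z\<in>Ob M. \<exists>i\<in>Ar M x z. \<exists>p\<in>Ar M z y.
        f = Cm M x z y p i \<and> cof M x z i \<and> weq M x z i \<and> fib M z y p" ..
  }
  { assume "x \<in> Ob M" "y \<in> Ob M" "f \<in> Ar M x y"
    note fac[rule_format, OF this]
    then show "\<exists>z\<in>Ob M. \<exists>i\<in>Ar M x z. \<exists>p\<in>Ar M z y.
        f = Cm M x z y p i \<and> cof M x z i \<and> fib M z y p \<and> weq M z y p" ..
  }
qed

text \<open>L(f) lifts against p whenever f lifts against R(p). Factoring L(f) in N as i followed by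
  such a p makes L(f) a retract of i, and i has the property to be shown.\<close>

lemma left_quillen_if_right_quillen:
  assumes adj: "adjunction M N L R" and rq: "right_quillen N M R"
    and M: "model_structure M" and N: "model_structure N"
  shows "left_quillen M N L"
  unfolding left_quillen_def
proof (intro ballI)
  fix a b f
  assume ob: "a \<in> Ob M" "b \<in> Ob M" and f: "f \<in> Ar M a b"
  have L: "is_functor M N L" and R: "is_functor N M R"
    using adj unfolding adjunction_def by auto
  let ?a = "FOb L a" and ?b = "FOb L b" and ?f = "FAr L a b f"
  have ob': "?a \<in> Ob N" "?b \<in> Ob N" and f': "?f \<in> Ar N ?a ?b"
    using is_functor_ob[OF L] is_functor_ar[OF L] ob f by auto
  \<comment> \<open>R(p) is a fibration, and a trivial one when p is, so the model structure of M
    solves the transposed problem in both cases.\<close>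
  have lift: "has_lift N ?a ?b ?f z ?b p"
    if z: "z \<in> Ob N" and p: "p \<in> Ar N z ?b" and cof: "cof M a b f" and fib: "fib N z ?b p"
      and w: "weq M a b f \<or> weq N z ?b p" for z p
  proof (rule adjunction_has_lift[OF adj ob z ob'(2) f p])
    show "has_lift M a b f (FOb R z) (FOb R ?b) (FAr R z ?b p)"
      using model_structure_lift[OF M ob is_functor_ob[OF R z] is_functor_ob[OF R ob'(2)] f
          is_functor_ar[OF R z ob'(2) p] cof] rq z ob' p fib w
      unfolding right_quillen_def by blast
  qed
  have cof: "cof N ?a ?b ?f" if c: "cof M a b f"
  proof -
    \<comment> \<open>Here p must be the weak equivalence, because f is only assumed to be a
      cofibration.\<close>
    obtain z i p where *: "z \<in> Ob N" "i \<in> Ar N ?a z" "p \<in> Ar N z ?b"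
      "?f = Cm N ?a z ?b p i" "cof N ?a z i" "fib N z ?b p" "weq N z ?b p"
      using model_structure_factor_trivial_fib[OF N ob' f'] by blast
    show ?thesis
      using retract_closed_lift[of N "cof N", OF model_structure_category[OF N]
          model_structure_retract_cof[OF N] ob' *(1-3,5)] lift[OF *(1,3) c *(6)] *(4,7)
      by simp
  qed
  have weq: "weq N ?a ?b ?f" if c: "cof M a b f" and w: "weq M a b f"
  proof -
    \<comment> \<open>Now f itself is trivial and lifts against any fibration, so the weak
      equivalence can be placed on i, from which it passes to L(f).\<close>
    obtain z i p where *: "z \<in> Ob N" "i \<in> Ar N ?a z" "p \<in> Ar N z ?b"
      "?f = Cm N ?a z ?b p i" "cof N ?a z i" "weq N ?a z i" "fib N z ?b p"
      using model_structure_factor_trivial_cof[OF N ob' f'] by blast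
    show ?thesis
      using retract_closed_lift[of N "weq N", OF model_structure_category[OF N]
          model_structure_retract_weq[OF N] ob' *(1-3,6)] lift[OF *(1,3) c *(7)] *(4) w
      by simp
  qed
  show "(cof M a b f \<longrightarrow> cof N ?a ?b ?f) \<and>
        (cof M a b f \<and> weq M a b f \<longrightarrow> cof N ?a ?b ?f \<and> weq N ?a ?b ?f)"
    using cof weq by blast
qed

section \<open>Non-unital dg categories\<close>

lemma HomM_simps [simp]:
  "carrier (HomM A X Y n) = Hom A X Y n"
  "\<zero>\<^bsub>HomM A X Y n\<^esub> = zer A X Y n"
  "x \<oplus>\<^bsub>HomM A X Y n\<^esub> y = pls A x y"
  "c \<odot>\<^bsub>HomM A X Y n\<^esub> x = scl A c x"
  by (simp_all add: HomM_def)

lemma HomD: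
  assumes "f \<in> Hom A X Y n"
  shows "f \<in> Arr A" "Dom A f = X" "Cod A f = Y" "Deg A f = n"
  using assms by (auto simp: Hom_def)

lemma Hom_if_Arr: "f \<in> Arr A \<Longrightarrow> f \<in> Hom A (Dom A f) (Cod A f) (Deg A f)"
  by (simp add: Hom_def)

lemma klinearD:
  assumes "klinear K M N h"
  shows klinear_closed: "x \<in> carrier M \<Longrightarrow> h x \<in> carrier N"
    and klinear_add: "x \<in> carrier M \<Longrightarrow> y \<in> carrier M \<Longrightarrow> h (x \<oplus>\<^bsub>M\<^esub> y) = h x \<oplus>\<^bsub>N\<^esub> h y"
    and klinear_smult: "a \<in> carrier K \<Longrightarrow> x \<in> carrier M \<Longrightarrow> h (a \<odot>\<^bsub>M\<^esub> x) = a \<odot>\<^bsub>N\<^esub> h x"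
  using assms unfolding klinear_def by auto

text \<open>\<open>klinear\<close> speaks of sums and scalar multiples; read as a homomorphism of
  additive groups, h also respects zero and negatives.\<close>

lemma klinear_zero_minus:
  assumes "module K M" "module K N" and h: "klinear K M N h"
  shows klinear_zero: "h \<zero>\<^bsub>M\<^esub> = \<zero>\<^bsub>N\<^esub>"
    and klinear_minus: "x \<in> carrier M \<Longrightarrow> h (\<ominus>\<^bsub>M\<^esub> x) = \<ominus>\<^bsub>N\<^esub> h x"
proof -
  interpret M: module K M by fact
  interpret N: module K N by fact
  have "h \<in> hom (add_monoid M) (add_monoid N)"
    using klinearD[OF h] by (auto simp: hom_def)
  then have "group_hom (add_monoid M) (add_monoid N) h"
    by (intro group_hom.intro group_hom_axioms.intro M.add.is_group N.add.is_group)
  then interpret abelian_group_hom M N h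
    by (intro abelian_group_hom.intro abelian_group_hom_axioms.intro M.abelian_group_axioms
        N.abelian_group_axioms)
  show "h \<zero>\<^bsub>M\<^esub> = \<zero>\<^bsub>N\<^esub>" by (rule hom_zero)
  show "x \<in> carrier M \<Longrightarrow> h (\<ominus>\<^bsub>M\<^esub> x) = \<ominus>\<^bsub>N\<^esub> h x" by (rule hom_a_inv)
qed

lemma klinear_sgnd:
  assumes "module K M" "module K N" "klinear K M N h" "x \<in> carrier M"
  shows "h (sgnd M n x) = sgnd N n (h x)"
  using assms by (simp add: sgnd_def klinear_minus)

text \<open>Every element of M' is some q x, where h' is given by h, so linearity of h' is read off
  from that of h, q and r. In its use q and r are projections to a quotient, and h is the
  differential or composition with a fixed arrow.\<close>

lemma klinear_quotient:
  assumes "module K M" and h: "klinear K M N h"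
    and q: "klinear K M M' q" and r: "klinear K N N' r"
    and surj: "carrier M' = q ` carrier M"
    and h': "\<And>x. x \<in> carrier M \<Longrightarrow> r (h x) = h' (q x)"
  shows "klinear K M' N' h'"
proof -
  interpret module K M by fact
  have "h' (q x \<oplus>\<^bsub>M'\<^esub> q y) = h' (q x) \<oplus>\<^bsub>N'\<^esub> h' (q y)" if "x \<in> carrier M" "y \<in> carrier M" for x y
  proof -
    have "h' (q x \<oplus>\<^bsub>M'\<^esub> q y) = r (h (x \<oplus>\<^bsub>M\<^esub> y))"
      using that by (simp add: klinear_add[OF q, symmetric] h')
    also have "\<dots> = h' (q x) \<oplus>\<^bsub>N'\<^esub> h' (q y)"
      using that by (simp add: klinear_add[OF h] klinear_add[OF r] klinear_closed[OF h] h')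
    finally show ?thesis .
  qed
  moreover have "h' (c \<odot>\<^bsub>M'\<^esub> q x) = c \<odot>\<^bsub>N'\<^esub> h' (q x)" if "c \<in> carrier K" "x \<in> carrier M" for c x
  proof -
    have "h' (c \<odot>\<^bsub>M'\<^esub> q x) = r (h (c \<odot>\<^bsub>M\<^esub> x))"
      using that by (simp add: klinear_smult[OF q, symmetric] h')
    also have "\<dots> = c \<odot>\<^bsub>N'\<^esub> h' (q x)"
      using that by (simp add: klinear_smult[OF h] klinear_smult[OF r] klinear_closed[OF h] h')
    finally show ?thesis .
  qed
  ultimately show ?thesis
    unfolding klinear_def surj
    using klinear_closed[OF r klinear_closed[OF h]] by (auto simp flip: h')
qed

locale nonunital_dg =
  fixes K :: "'k ring" and A :: "('o, 'm, 'k, 'z) dgcat_scheme"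
  assumes nonunital: "nonunital_dgcat K A"
begin

lemma Dom_Obj: "f \<in> Arr A \<Longrightarrow> Dom A f \<in> Obj A"
  and Cod_Obj: "f \<in> Arr A \<Longrightarrow> Cod A f \<in> Obj A"
  using nonunital unfolding nonunital_dgcat_def by blast+

lemma Hom_Obj:
  assumes "f \<in> Hom A X Y n"
  shows "X \<in> Obj A" "Y \<in> Obj A"
  using Dom_Obj Cod_Obj HomD[OF assms] by auto

lemma module_HomM: "X \<in> Obj A \<Longrightarrow> Y \<in> Obj A \<Longrightarrow> module K (HomM A X Y n)"
  using nonunital unfolding nonunital_dgcat_def by blast

lemma klinear_dif:
  "X \<in> Obj A \<Longrightarrow> Y \<in> Obj A \<Longrightarrow> klinear K (HomM A X Y n) (HomM A X Y (n + 1)) (dif A)"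
  using nonunital unfolding nonunital_dgcat_def by blast

lemma klinear_cmp_right:
  "X \<in> Obj A \<Longrightarrow> f \<in> Hom A Y Z m \<Longrightarrow> klinear K (HomM A X Y n) (HomM A X Z (m + n)) (\<lambda>g. cmp A f g)"
  using nonunital Hom_Obj[of f Y Z m] unfolding nonunital_dgcat_def by blast

lemma klinear_cmp_left:
  "Z \<in> Obj A \<Longrightarrow> g \<in> Hom A X Y n \<Longrightarrow> klinear K (HomM A Y Z m) (HomM A X Z (m + n)) (\<lambda>f. cmp A f g)"
  using nonunital Hom_Obj[of g X Y n] unfolding nonunital_dgcat_def by blast

lemma zer_closed: "X \<in> Obj A \<Longrightarrow> Y \<in> Obj A \<Longrightarrow> zer A X Y n \<in> Hom A X Y n"
  using abelian_monoid.zero_closed[of "HomM A X Y n"] module_HomM[of X Y n]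
  by (simp add: module_def abelian_group_def)

lemma zer_HomD:
  assumes "X \<in> Obj A" "Y \<in> Obj A"
  shows "zer A X Y n \<in> Arr A" "Dom A (zer A X Y n) = X" "Cod A (zer A X Y n) = Y" "Deg A (zer A X Y n) = n"
  using HomD[OF zer_closed[OF assms]] by auto

lemma
  assumes "f \<in> Hom A X Y n"
  shows dif_closed: "dif A f \<in> Hom A X Y (n + 1)"
    and dif_dif: "dif A (dif A f) = zer A X Y (n + 2)"
  using klinear_closed[OF klinear_dif[OF Hom_Obj[OF assms], of n]] nonunital Hom_Obj[OF assms] assms
  by (simp_all add: nonunital_dgcat_def)

lemma cmp_closed: "f \<in> Hom A Y Z m \<Longrightarrow> g \<in> Hom A X Y n \<Longrightarrow> cmp A f g \<in> Hom A X Z (m + n)"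
  using klinear_closed[OF klinear_cmp_right[of X f Y Z m n]] Hom_Obj by auto

lemma dif_cmp:
  assumes "f \<in> Hom A Y Z m" "g \<in> Hom A X Y n"
  shows "dif A (cmp A f g) = pls A (cmp A (dif A f) g) (sgnd (HomM A X Z (m + n + 1)) m (cmp A f (dif A g)))"
proof -
  have "X \<in> Obj A" "Y \<in> Obj A" "Z \<in> Obj A" using Hom_Obj assms by blast+
  then show ?thesis using nonunital assms unfolding nonunital_dgcat_def HomM_simps by blast
qed

lemma cmp_assoc:
  "\<lbrakk>f \<in> Arr A; g \<in> Arr A; h \<in> Arr A; Dom A f = Cod A g; Dom A g = Cod A h\<rbrakk> \<Longrightarrow>
    cmp A (cmp A f g) h = cmp A f (cmp A g h)"
  using nonunital unfolding nonunital_dgcat_def by blast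

lemma
  assumes f: "f \<in> Hom A X Y n" and g: "g \<in> Hom A X Y n"
  shows pls_closed: "pls A f g \<in> Hom A X Y n"
    and pls_comm: "pls A f g = pls A g f"
    and dif_pls: "dif A (pls A f g) = pls A (dif A f) (dif A g)"
proof -
  interpret module K "HomM A X Y n" using module_HomM Hom_Obj[OF f] by blast
  show "pls A f g \<in> Hom A X Y n" "pls A f g = pls A g f"
    using M.add.m_closed[of f g] M.a_comm[of f g] f g by simp_all
  show "dif A (pls A f g) = pls A (dif A f) (dif A g)"
    using klinear_add[OF klinear_dif[OF Hom_Obj[OF f], of n]] f g by simp
qed

lemma pls_assoc:
  assumes "f \<in> Hom A X Y n" "g \<in> Hom A X Y n" "h \<in> Hom A X Y n"
  shows "pls A (pls A f g) h = pls A f (pls A g h)"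
proof -
  interpret module K "HomM A X Y n" using module_HomM Hom_Obj[OF assms(1)] by blast
  show ?thesis using M.a_assoc[of f g h] assms by simp
qed

text \<open>Used to collect the ideal parts of two representatives, and the multiples of an identity
  in a sum of two arrows with adjoined units.\<close>

lemma pls_pls_swap:
  assumes f: "f \<in> Hom A X Y n" "g \<in> Hom A X Y n" and h: "h \<in> Hom A X Y n" "k \<in> Hom A X Y n"
  shows "pls A (pls A f g) (pls A h k) = pls A (pls A f h) (pls A g k)"
proof -
  interpret module K "HomM A X Y n" using module_HomM Hom_Obj[OF f(1)] by blast
  show ?thesis using M.a_assoc M.a_lcomm M.a_closed f h by simp
qed

lemma
  assumes f: "f \<in> Hom A X Y n"
  shows pls_zer_left: "pls A (zer A X Y n) f = f"
    and pls_zer_right: "pls A f (zer A X Y n) = f"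
    and scl_one: "scl A \<one>\<^bsub>K\<^esub> f = f"
    and scl_zero: "scl A \<zero>\<^bsub>K\<^esub> f = zer A X Y n"
proof -
  interpret module K "HomM A X Y n" using module_HomM Hom_Obj[OF f] by blast
  show "pls A (zer A X Y n) f = f" "pls A f (zer A X Y n) = f" "scl A \<one>\<^bsub>K\<^esub> f = f"
    "scl A \<zero>\<^bsub>K\<^esub> f = zer A X Y n"
    using f M.l_zero[of f] M.r_zero[of f] smult_one[of f] smult_l_null[of f] by simp_all
qed

lemma
  assumes c: "c \<in> carrier K" and f: "f \<in> Hom A X Y n"
  shows scl_closed: "scl A c f \<in> Hom A X Y n"
    and dif_scl: "dif A (scl A c f) = scl A c (dif A f)"
proof -
  interpret module K "HomM A X Y n" using module_HomM Hom_Obj[OF f] by blast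
  show "scl A c f \<in> Hom A X Y n" using smult_closed[of c f] c f by simp
  show "dif A (scl A c f) = scl A c (dif A f)"
    using klinear_smult[OF klinear_dif[OF Hom_Obj[OF f], of n]] c f by simp
qed

lemma scl_zer:
  assumes "c \<in> carrier K" "X \<in> Obj A" "Y \<in> Obj A"
  shows "scl A c (zer A X Y n) = zer A X Y n"
proof -
  interpret module K "HomM A X Y n" using module_HomM assms by blast
  show ?thesis using smult_r_null[of c] assms by simp
qed

lemma
  assumes c: "c \<in> carrier K" and f: "f \<in> Hom A X Y n"
  shows scl_pls: "g \<in> Hom A X Y n \<Longrightarrow> scl A c (pls A f g) = pls A (scl A c f) (scl A c g)"
    and scl_add: "d \<in> carrier K \<Longrightarrow> scl A (c \<oplus>\<^bsub>K\<^esub> d) f = pls A (scl A c f) (scl A d f)"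
    and scl_mult: "d \<in> carrier K \<Longrightarrow> scl A (c \<otimes>\<^bsub>K\<^esub> d) f = scl A c (scl A d f)"
proof -
  interpret module K "HomM A X Y n" using module_HomM Hom_Obj[OF f] by blast
  show "g \<in> Hom A X Y n \<Longrightarrow> scl A c (pls A f g) = pls A (scl A c f) (scl A c g)"
    using smult_r_distr[of c f g] c f by simp
  show "d \<in> carrier K \<Longrightarrow> scl A (c \<oplus>\<^bsub>K\<^esub> d) f = pls A (scl A c f) (scl A d f)"
    using smult_l_distr[of c d f] c f by simp
  show "d \<in> carrier K \<Longrightarrow> scl A (c \<otimes>\<^bsub>K\<^esub> d) f = scl A c (scl A d f)"
    using smult_assoc1[of c d f] c f by simp
qed

lemma dif_zer: "X \<in> Obj A \<Longrightarrow> Y \<in> Obj A \<Longrightarrow> dif A (zer A X Y n) = zer A X Y (n + 1)"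
  using klinear_zero[OF module_HomM[of X Y n] module_HomM[of X Y "n + 1"] klinear_dif[of X Y n]] by simp

lemma
  assumes f: "f \<in> Hom A Y Z m"
  shows cmp_pls_right: "g \<in> Hom A X Y n \<Longrightarrow> h \<in> Hom A X Y n \<Longrightarrow>
      cmp A f (pls A g h) = pls A (cmp A f g) (cmp A f h)"
    and cmp_scl_right: "c \<in> carrier K \<Longrightarrow> g \<in> Hom A X Y n \<Longrightarrow> cmp A f (scl A c g) = scl A c (cmp A f g)"
    and cmp_zer_right: "X \<in> Obj A \<Longrightarrow> cmp A f (zer A X Y n) = zer A X Z (m + n)"
proof -
  have *: "X \<in> Obj A \<Longrightarrow> klinear K (HomM A X Y n) (HomM A X Z (m + n)) (\<lambda>g. cmp A f g)"
    by (rule klinear_cmp_right[OF _ f])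
  show "g \<in> Hom A X Y n \<Longrightarrow> h \<in> Hom A X Y n \<Longrightarrow> cmp A f (pls A g h) = pls A (cmp A f g) (cmp A f h)"
    using klinear_add[OF *, of g h] Hom_Obj[of g X Y n] by simp
  show "c \<in> carrier K \<Longrightarrow> g \<in> Hom A X Y n \<Longrightarrow> cmp A f (scl A c g) = scl A c (cmp A f g)"
    using klinear_smult[OF *, of c g] Hom_Obj[of g X Y n] by simp
  show "X \<in> Obj A \<Longrightarrow> cmp A f (zer A X Y n) = zer A X Z (m + n)"
    using klinear_zero[OF module_HomM module_HomM *] Hom_Obj[OF f] by simp
qed

lemma
  assumes g: "g \<in> Hom A X Y n"
  shows cmp_pls_left: "f \<in> Hom A Y Z m \<Longrightarrow> h \<in> Hom A Y Z m \<Longrightarrow>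
      cmp A (pls A f h) g = pls A (cmp A f g) (cmp A h g)"
    and cmp_scl_left: "c \<in> carrier K \<Longrightarrow> f \<in> Hom A Y Z m \<Longrightarrow> cmp A (scl A c f) g = scl A c (cmp A f g)"
    and cmp_zer_left: "Z \<in> Obj A \<Longrightarrow> cmp A (zer A Y Z m) g = zer A X Z (m + n)"
proof -
  have *: "Z \<in> Obj A \<Longrightarrow> klinear K (HomM A Y Z m) (HomM A X Z (m + n)) (\<lambda>f. cmp A f g)"
    by (rule klinear_cmp_left[OF _ g])
  show "f \<in> Hom A Y Z m \<Longrightarrow> h \<in> Hom A Y Z m \<Longrightarrow> cmp A (pls A f h) g = pls A (cmp A f g) (cmp A h g)"
    using klinear_add[OF *, of f h] Hom_Obj[of f Y Z m] by simp
  show "c \<in> carrier K \<Longrightarrow> f \<in> Hom A Y Z m \<Longrightarrow> cmp A (scl A c f) g = scl A c (cmp A f g)"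
    using klinear_smult[OF *, of c f] Hom_Obj[of f Y Z m] by simp
  show "Z \<in> Obj A \<Longrightarrow> cmp A (zer A Y Z m) g = zer A X Z (m + n)"
    using klinear_zero[OF module_HomM module_HomM *] Hom_Obj[OF g] by simp
qed

end

text \<open>Every arrow of Q is some q f and q commutes with all operations, so each axiom for Q is
  the q-image of the same axiom for C. No cosets are mentioned, which suits a quotient whose classes
  are chosen representatives.\<close>

lemma nonunital_dgcat_surj:
  assumes C: "nonunital_dgcat K C"
    and Obj: "Obj Q = Obj C"
    and surj: "\<And>X Y n. X \<in> Obj C \<Longrightarrow> Y \<in> Obj C \<Longrightarrow> Hom Q X Y n = q ` Hom C X Y n"
    and Arr: "Arr Q = q ` Arr C"
    and ends: "\<And>f. f \<in> Arr C \<Longrightarrow> Dom Q (q f) = Dom C f" "\<And>f. f \<in> Arr C \<Longrightarrow> Cod Q (q f) = Cod C f"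
    and zer: "\<And>X Y n. X \<in> Obj C \<Longrightarrow> Y \<in> Obj C \<Longrightarrow> q (zer C X Y n) = zer Q X Y n"
    and pls: "\<And>X Y n f g. f \<in> Hom C X Y n \<Longrightarrow> g \<in> Hom C X Y n \<Longrightarrow> q (pls C f g) = pls Q (q f) (q g)"
    and scl: "\<And>X Y n c f. c \<in> carrier K \<Longrightarrow> f \<in> Hom C X Y n \<Longrightarrow> q (scl C c f) = scl Q c (q f)"
    and dif: "\<And>f. f \<in> Arr C \<Longrightarrow> q (dif C f) = dif Q (q f)"
    and cmp: "\<And>f g. f \<in> Arr C \<Longrightarrow> g \<in> Arr C \<Longrightarrow> Dom C f = Cod C g \<Longrightarrow> q (cmp C f g) = cmp Q (q f) (q g)"
  shows "nonunital_dgcat K Q"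
proof -
  interpret nonunital_dg K C using C by unfold_locales
  have HArr: "f \<in> Hom C X Y n \<Longrightarrow> f \<in> Arr C" for f X Y n by (rule HomD(1))
  have cmp': "q (cmp C f g) = cmp Q (q f) (q g)" if "f \<in> Hom C Y Z m" "g \<in> Hom C X Y n" for f g X Y Z m n
    using cmp HomD[OF that(1)] HomD[OF that(2)] by simp
  have mod: "module K (HomM Q X Y n)" if ob: "X \<in> Obj C" "Y \<in> Obj C" for X Y n
  proof -
    interpret M: module K "HomM C X Y n" using module_HomM ob by blast
    note s = surj[OF ob, of n] zer[OF ob, of n, symmetric]
    show ?thesis
    proof (rule moduleI)
      show "cring K" by (rule M.is_cring)
      show "abelian_group (HomM Q X Y n)"
      proof (rule abelian_groupI; simp add: s del: image_iff)
        show "q (zer C X Y n) \<in> q ` Hom C X Y n" using zer_closed[OF ob] by blast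
        fix x assume x: "x \<in> q ` Hom C X Y n"
        then obtain f where f: "f \<in> Hom C X Y n" "x = q f" by blast
        show "pls Q (q (zer C X Y n)) x = x"
          using pls[OF zer_closed[OF ob] f(1)] pls_zer_left[OF f(1)] f(2) by simp
        \<comment> \<open>An additive inverse of q f is the image of an inverse of f.\<close>
        obtain f' where "f' \<in> Hom C X Y n" "pls C f' f = zer C X Y n"
          using M.M.l_neg[of f] M.M.a_inv_closed[of f] f(1) by auto
        then show "\<exists>y\<in>Hom C X Y n. pls Q (q y) x = q (zer C X Y n)"
          using pls[of f' X Y n f] f by metis
        fix y assume "y \<in> q ` Hom C X Y n"
        then obtain g where g: "g \<in> Hom C X Y n" "y = q g" by blast
        show "pls Q x y \<in> q ` Hom C X Y n" "pls Q x y = pls Q y x"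
          using pls[OF f(1) g(1)] pls[OF g(1) f(1)] pls_closed[OF f(1) g(1)] pls_comm[OF f(1) g(1)] f g
          by (metis imageI)+
        fix z assume "z \<in> q ` Hom C X Y n"
        then obtain h where h: "h \<in> Hom C X Y n" "z = q h" by blast
        show "pls Q (pls Q x y) z = pls Q x (pls Q y z)"
          unfolding f(2) g(2) h(2)
          using pls_assoc[OF f(1) g(1) h(1)] pls[OF f(1) g(1)] pls[OF g(1) h(1)]
            pls[OF pls_closed[OF f(1) g(1)] h(1)] pls[OF f(1) pls_closed[OF g(1) h(1)]] by metis
      qed
    qed (auto simp: s scl[where X=X and Y=Y and n=n, symmetric]
        pls[where X=X and Y=Y and n=n, symmetric] scl_closed pls_closed scl_pls scl_add scl_mult scl_one)
  qed
  have qlin: "klinear K (HomM C X Y n) (HomM Q X Y n) q" if ob: "X \<in> Obj C" "Y \<in> Obj C" for X Y n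
    unfolding klinear_def using surj[OF ob, of n] pls[of _ X Y n] scl[of _ _ X Y n] by auto
  show ?thesis
    unfolding nonunital_dgcat_def Obj
  proof (intro conjI ballI allI impI)
    show "\<And>f. f \<in> Arr Q \<Longrightarrow> Dom Q f \<in> Obj C" "\<And>f. f \<in> Arr Q \<Longrightarrow> Cod Q f \<in> Obj C"
      using Dom_Obj Cod_Obj Arr ends by auto
    show "\<And>X Y n. X \<in> Obj C \<Longrightarrow> Y \<in> Obj C \<Longrightarrow> module K (HomM Q X Y n)" by (rule mod)
    show "klinear K (HomM Q X Y n) (HomM Q X Y (n + 1)) (dif Q)" if "X \<in> Obj C" "Y \<in> Obj C" for X Y n
      using that dif[OF HArr]
      by (intro klinear_quotient[OF module_HomM klinear_dif qlin qlin]) (simp_all add: surj)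
    show "dif Q (dif Q f) = zer Q X Y (n + 2)" if "X \<in> Obj C" "Y \<in> Obj C" "f \<in> Hom Q X Y n" for X Y n f
      using that by (auto simp: surj HArr dif[symmetric] HomD(1)[OF dif_closed] dif_dif zer)
    fix X Y Z m n assume ob: "X \<in> Obj C" "Y \<in> Obj C" "Z \<in> Obj C"
    show "klinear K (HomM Q X Y n) (HomM Q X Z (m + n)) (\<lambda>g. cmp Q f g)" if f: "f \<in> Hom Q Y Z m" for f
    proof -
      obtain f' where f': "f' \<in> Hom C Y Z m" "f = q f'" using f unfolding surj[OF ob(2,3)] by blast
      show ?thesis
        unfolding f'(2)
        by (rule klinear_quotient[OF module_HomM[of X Y n] klinear_cmp_right[OF ob(1) f'(1)] qlin[of X Y n] qlin[of X Z "m + n"]])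
          (simp_all add: surj ob cmp'[OF f'(1), where X=X and n=n])
    qed
    show "klinear K (HomM Q Y Z m) (HomM Q X Z (m + n)) (\<lambda>f. cmp Q f g)" if g: "g \<in> Hom Q X Y n" for g
    proof -
      obtain g' where g': "g' \<in> Hom C X Y n" "g = q g'" using g unfolding surj[OF ob(1,2)] by blast
      show ?thesis
        unfolding g'(2)
        by (rule klinear_quotient[OF module_HomM[of Y Z m] klinear_cmp_left[OF ob(3) g'(1)] qlin[of Y Z m] qlin[of X Z "m + n"]])
          (simp_all add: surj ob cmp'[OF _ g'(1), where Z=Z and m=m])
    qed
    fix f g assume "f \<in> Hom Q Y Z m" "g \<in> Hom Q X Y n"
    then obtain f' g' where f': "f' \<in> Hom C Y Z m" "f = q f'" and g': "g' \<in> Hom C X Y n" "g = q g'"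
      unfolding surj[OF ob(1,2)] surj[OF ob(2,3)] by blast
    have 1: "cmp C (dif C f') g' \<in> Hom C X Z (m + n + 1)" "cmp C f' (dif C g') \<in> Hom C X Z (m + n + 1)"
      using cmp_closed[OF dif_closed[OF f'(1)] g'(1)] cmp_closed[OF f'(1) dif_closed[OF g'(1)]]
      by (simp_all add: algebra_simps)
    interpret M: module K "HomM C X Z (m + n + 1)" using module_HomM ob by blast
    have 2: "sgnd (HomM C X Z (m + n + 1)) m (cmp C f' (dif C g')) \<in> Hom C X Z (m + n + 1)"
      using 1 M.M.a_inv_closed by (simp add: sgnd_def)
    have "dif Q (cmp Q f g) = q (dif C (cmp C f' g'))"
      using f' g' cmp' dif[OF HomD(1)[OF cmp_closed[OF f'(1) g'(1)]]] by simp
    also have "\<dots> = pls Q (q (cmp C (dif C f') g')) (q (sgnd (HomM C X Z (m + n + 1)) m (cmp C f' (dif C g'))))"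
      unfolding dif_cmp[OF f'(1) g'(1)] by (rule pls[OF 1(1) 2])
    \<comment> \<open>The sign is a negation in the respective module, so it passes through q by
      linearity.\<close>
    also have "\<dots> = pls Q (cmp Q (dif Q f) g) (sgnd (HomM Q X Z (m + n + 1)) m (cmp Q f (dif Q g)))"
      using klinear_sgnd[OF module_HomM[OF ob(1,3)] mod[OF ob(1,3)] qlin[OF ob(1,3)], of "cmp C f' (dif C g')"] 1
        cmp'[OF dif_closed[OF f'(1)] g'(1)] cmp'[OF f'(1) dif_closed[OF g'(1)]] f' g' dif HArr by simp
    finally show "dif Q (cmp Q f g) = cmp Q (dif Q f) g \<oplus>\<^bsub>HomM Q X Z (m + n + 1)\<^esub>
        sgnd (HomM Q X Z (m + n + 1)) m (cmp Q f (dif Q g))" by simp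
  next
    fix f g h assume "f \<in> Arr Q" "g \<in> Arr Q" "h \<in> Arr Q"
      and e: "Dom Q f = Cod Q g \<and> Dom Q g = Cod Q h"
    then obtain f' g' h' where *: "f' \<in> Arr C" "g' \<in> Arr C" "h' \<in> Arr C" "f = q f'" "g = q g'" "h = q h'"
      using Arr by blast
    have e': "Dom C f' = Cod C g'" "Dom C g' = Cod C h'" using e * ends by auto
    have 1: "cmp C f' g' \<in> Arr C" "Dom C (cmp C f' g') = Dom C g'"
      using cmp_closed[OF Hom_if_Arr[OF *(1), unfolded e'(1)] Hom_if_Arr[OF *(2)]] by (auto dest: HomD)
    have 2: "cmp C g' h' \<in> Arr C" "Cod C (cmp C g' h') = Cod C g'"
      using cmp_closed[OF Hom_if_Arr[OF *(2), unfolded e'(2)] Hom_if_Arr[OF *(3)]] by (auto dest: HomD)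
    show "cmp Q (cmp Q f g) h = cmp Q f (cmp Q g h)"
      using * e' 1 2 cmp_assoc[OF *(1-3) e'] by (simp flip: cmp)
  qed
qed

section \<open>Dg functors\<close>

locale nonunital_dg_functor = C: nonunital_dg K C + D: nonunital_dg K D
  for K :: "'k ring" and C :: "('o, 'm, 'k, 'y) dgcat_scheme" and D :: "('p, 'n, 'k, 'z) dgcat_scheme" +
  fixes F :: "('o, 'm, 'p, 'n) dgfun"
  assumes dgfun: "nonunital_dgfun K C D F"
begin

lemma fobj_closed: "X \<in> Obj C \<Longrightarrow> fobj F X \<in> Obj D"
  using dgfun unfolding nonunital_dgfun_def by blast

lemma farr_klinear:
  "X \<in> Obj C \<Longrightarrow> Y \<in> Obj C \<Longrightarrow> klinear K (HomM C X Y n) (HomM D (fobj F X) (fobj F Y) n) (farr F)"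
  using dgfun unfolding nonunital_dgfun_def by blast

lemma farr_dif: "f \<in> Arr C \<Longrightarrow> farr F (dif C f) = dif D (farr F f)"
  using dgfun unfolding nonunital_dgfun_def by blast

lemma farr_cmp: "f \<in> Arr C \<Longrightarrow> g \<in> Arr C \<Longrightarrow> Dom C f = Cod C g \<Longrightarrow>
    farr F (cmp C f g) = cmp D (farr F f) (farr F g)"
  using dgfun unfolding nonunital_dgfun_def by blast

lemma farr_Hom: "f \<in> Hom C X Y n \<Longrightarrow> farr F f \<in> Hom D (fobj F X) (fobj F Y) n"
  using klinear_closed[OF farr_klinear[of X Y n], of f] C.Hom_Obj by auto

lemma farr_Arr:
  assumes "f \<in> Arr C"
  shows "farr F f \<in> Arr D" "Dom D (farr F f) = fobj F (Dom C f)" "Cod D (farr F f) = fobj F (Cod C f)"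
    "Deg D (farr F f) = Deg C f"
  using HomD[OF farr_Hom[OF Hom_if_Arr[OF assms]]] by auto

lemma farr_pls: "f \<in> Hom C X Y n \<Longrightarrow> g \<in> Hom C X Y n \<Longrightarrow> farr F (pls C f g) = pls D (farr F f) (farr F g)"
  using klinear_add[OF farr_klinear[of X Y n], of f g] C.Hom_Obj by auto

lemma farr_scl: "c \<in> carrier K \<Longrightarrow> f \<in> Hom C X Y n \<Longrightarrow> farr F (scl C c f) = scl D c (farr F f)"
  using klinear_smult[OF farr_klinear[of X Y n], of c f] C.Hom_Obj by auto

lemma farr_zer: "X \<in> Obj C \<Longrightarrow> Y \<in> Obj C \<Longrightarrow> farr F (zer C X Y n) = zer D (fobj F X) (fobj F Y) n"
  using klinear_zero[OF C.module_HomM D.module_HomM farr_klinear] fobj_closed by simp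

end

lemma nonunital_dgfunI:
  assumes "fobj F \<in> Obj C \<rightarrow>\<^sub>E Obj D" "farr F \<in> extensional (Arr C)"
    and "\<And>X Y n f. f \<in> Hom C X Y n \<Longrightarrow> farr F f \<in> Hom D (fobj F X) (fobj F Y) n"
    and "\<And>X Y n f g. f \<in> Hom C X Y n \<Longrightarrow> g \<in> Hom C X Y n \<Longrightarrow>
      farr F (pls C f g) = pls D (farr F f) (farr F g)"
    and "\<And>X Y n c f. c \<in> carrier K \<Longrightarrow> f \<in> Hom C X Y n \<Longrightarrow> farr F (scl C c f) = scl D c (farr F f)"
    and "\<And>f. f \<in> Arr C \<Longrightarrow> farr F (dif C f) = dif D (farr F f)"
    and "\<And>f g. f \<in> Arr C \<Longrightarrow> g \<in> Arr C \<Longrightarrow> Dom C f = Cod C g \<Longrightarrow>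
      farr F (cmp C f g) = cmp D (farr F f) (farr F g)"
  shows "nonunital_dgfun K C D F"
  using assms unfolding nonunital_dgfun_def klinear_def by auto

lemma dgfun_eqI:
  fixes F G :: "('o, 'm, 'p, 'n) dgfun"
  assumes F: "fobj F \<in> extensional S" "farr F \<in> extensional T"
    and G: "fobj G \<in> extensional S" "farr G \<in> extensional T"
    and "\<And>X. X \<in> S \<Longrightarrow> fobj F X = fobj G X" "\<And>f. f \<in> T \<Longrightarrow> farr F f = farr G f"
  shows "F = G"
proof -
  have "fobj F = fobj G" "farr F = farr G"
    using assms by (blast intro: extensionalityI)+
  then show ?thesis by simp
qed

lemma nonunital_dgfun_ext:
  assumes "nonunital_dgfun K C D F"
  shows "fobj F \<in> extensional (Obj C)" "farr F \<in> extensional (Arr C)"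
  using assms unfolding nonunital_dgfun_def by (auto simp: PiE_def)

lemma dgfun_id_simps [simp]:
  "X \<in> Obj C \<Longrightarrow> fobj (dgfun_id C) X = X" "f \<in> Arr C \<Longrightarrow> farr (dgfun_id C) f = f"
  "fobj (dgfun_id C) \<in> extensional (Obj C)" "farr (dgfun_id C) \<in> extensional (Arr C)"
  by (simp_all add: dgfun_id_def)

lemma dgfun_comp_simps [simp]:
  "X \<in> Obj C \<Longrightarrow> fobj (dgfun_comp C G F) X = fobj G (fobj F X)"
  "f \<in> Arr C \<Longrightarrow> farr (dgfun_comp C G F) f = farr G (farr F f)"
  "fobj (dgfun_comp C G F) \<in> extensional (Obj C)" "farr (dgfun_comp C G F) \<in> extensional (Arr C)"
  by (simp_all add: dgfun_comp_def compose_eq)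

lemma nonunital_dgfun_id:
  assumes "nonunital_dgcat K C"
  shows "nonunital_dgfun K C C (dgfun_id C)"
proof -
  interpret nonunital_dg K C using assms by unfold_locales
  show ?thesis
  proof (rule nonunital_dgfunI)
    show "fobj (dgfun_id C) \<in> Obj C \<rightarrow>\<^sub>E Obj C" by (auto simp: dgfun_id_def)
    show "farr (dgfun_id C) f \<in> Hom C (fobj (dgfun_id C) X) (fobj (dgfun_id C) Y) n"
      if "f \<in> Hom C X Y n" for X Y n f
      using that Hom_Obj[OF that] HomD[OF that] by simp
    show "farr (dgfun_id C) (dif C f) = dif C (farr (dgfun_id C) f)" if "f \<in> Arr C" for f
      using HomD[OF dif_closed[OF Hom_if_Arr[OF that]]] that by simp
    show "farr (dgfun_id C) (cmp C f g) = cmp C (farr (dgfun_id C) f) (farr (dgfun_id C) g)"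
      if "f \<in> Arr C" "g \<in> Arr C" "Dom C f = Cod C g" for f g
      using HomD[OF cmp_closed[OF Hom_if_Arr[OF that(1), unfolded that(3)] Hom_if_Arr[OF that(2)]]] that by simp
    show "farr (dgfun_id C) (pls C f g) = pls C (farr (dgfun_id C) f) (farr (dgfun_id C) g)"
      if "f \<in> Hom C X Y n" "g \<in> Hom C X Y n" for X Y n f g
      using HomD(1)[OF pls_closed[OF that]] HomD(1)[OF that(1)] HomD(1)[OF that(2)] by simp
    show "farr (dgfun_id C) (scl C c f) = scl C c (farr (dgfun_id C) f)"
      if "c \<in> carrier K" "f \<in> Hom C X Y n" for X Y n c f
      using HomD(1)[OF scl_closed[OF that]] HomD(1)[OF that(2)] by simp
  qed simp
qed

lemma nonunital_dgfun_comp: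
  assumes "nonunital_dgcat K C" "nonunital_dgcat K D" "nonunital_dgcat K E"
    and "nonunital_dgfun K C D F" "nonunital_dgfun K D E G"
  shows "nonunital_dgfun K C E (dgfun_comp C G F)"
proof -
  interpret F: nonunital_dg_functor K C D F using assms by unfold_locales
  interpret G: nonunital_dg_functor K D E G using assms by unfold_locales
  note C = F.C.dif_closed F.C.cmp_closed F.C.pls_closed F.C.scl_closed
  show ?thesis
  proof (rule nonunital_dgfunI)
    show "fobj (dgfun_comp C G F) \<in> Obj C \<rightarrow>\<^sub>E Obj E"
      using F.fobj_closed G.fobj_closed by (auto simp: PiE_def)
    show "farr (dgfun_comp C G F) f \<in> Hom E (fobj (dgfun_comp C G F) X) (fobj (dgfun_comp C G F) Y) n"
      if "f \<in> Hom C X Y n" for X Y n f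
      using G.farr_Hom[OF F.farr_Hom[OF that]] F.C.Hom_Obj[OF that] HomD[OF that] by simp
    show "farr (dgfun_comp C G F) (pls C f g) = pls E (farr (dgfun_comp C G F) f) (farr (dgfun_comp C G F) g)"
      if "f \<in> Hom C X Y n" "g \<in> Hom C X Y n" for X Y n f g
      using G.farr_pls[OF F.farr_Hom[OF that(1)] F.farr_Hom[OF that(2)]] F.farr_pls[OF that]
        HomD(1)[OF F.C.pls_closed[OF that]] HomD(1)[OF that(1)] HomD(1)[OF that(2)] by simp
    show "farr (dgfun_comp C G F) (scl C c f) = scl E c (farr (dgfun_comp C G F) f)"
      if "c \<in> carrier K" "f \<in> Hom C X Y n" for X Y n c f
      using G.farr_scl[OF that(1) F.farr_Hom[OF that(2)]] F.farr_scl[OF that]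
        HomD(1)[OF F.C.scl_closed[OF that]] HomD(1)[OF that(2)] by simp
    show "farr (dgfun_comp C G F) (dif C f) = dif E (farr (dgfun_comp C G F) f)" if "f \<in> Arr C" for f
      using HomD[OF F.C.dif_closed[OF Hom_if_Arr[OF that]]] F.farr_Arr[OF that] that
      by (simp add: F.farr_dif G.farr_dif)
    show "farr (dgfun_comp C G F) (cmp C f g) = cmp E (farr (dgfun_comp C G F) f) (farr (dgfun_comp C G F) g)"
      if "f \<in> Arr C" "g \<in> Arr C" "Dom C f = Cod C g" for f g
      using HomD[OF F.C.cmp_closed[OF Hom_if_Arr[OF that(1), unfolded that(3)] Hom_if_Arr[OF that(2)]]] that
        F.farr_Arr[OF that(1)] F.farr_Arr[OF that(2)]
      by (simp add: F.farr_cmp G.farr_cmp)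
  qed simp
qed

section \<open>Adjoining units, and composable strings of arrows\<close>

lemma add_units_simps [simp]:
  "Obj (add_units K A) = Obj A"
  "x \<in> Arr (add_units K A) \<longleftrightarrow> fst x \<in> Arr A \<and> snd x \<in> carrier K \<and>
    (snd x \<noteq> \<zero>\<^bsub>K\<^esub> \<longrightarrow> Dom A (fst x) = Cod A (fst x) \<and> Deg A (fst x) = 0)"
  "Dom (add_units K A) x = Dom A (fst x)"
  "Cod (add_units K A) x = Cod A (fst x)"
  "Deg (add_units K A) x = Deg A (fst x)"
  "zer (add_units K A) X Y n = (zer A X Y n, \<zero>\<^bsub>K\<^esub>)"
  "pls (add_units K A) x y = (pls A (fst x) (fst y), snd x \<oplus>\<^bsub>K\<^esub> snd y)"
  "scl (add_units K A) c x = (scl A c (fst x), c \<otimes>\<^bsub>K\<^esub> snd x)"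
  "dif (add_units K A) x = (dif A (fst x), \<zero>\<^bsub>K\<^esub>)"
  by (auto simp: add_units_def case_prod_beta)

lemma composable_Nil [simp]: "\<not> composable B []"
  by (simp add: composable_def)

text \<open>The recursive form of the index condition, by which \<open>composable\<close> is
  evaluated on explicit strings of one or two arrows.\<close>

lemma composable_Cons:
  "composable B (x # xs) \<longleftrightarrow> x \<in> Arr B \<and> (xs = [] \<or> Dom B x = Cod B (hd xs) \<and> composable B xs)"
proof (cases xs)
  case (Cons y ys)
  have all_nat: "(\<forall>i. P i) \<longleftrightarrow> P 0 \<and> (\<forall>i. P (Suc i))" for P :: "nat \<Rightarrow> bool"
    by (metis not0_implies_Suc)
  have "(\<forall>i. Suc i < length (x # xs) \<longrightarrow> Dom B ((x # xs) ! i) = Cod B ((x # xs) ! Suc i)) \<longleftrightarrow>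
     Dom B x = Cod B y \<and> (\<forall>i. Suc i < length xs \<longrightarrow> Dom B (xs ! i) = Cod B (xs ! Suc i))"
    unfolding all_nat[of "\<lambda>i. Suc i < length (x # xs) \<longrightarrow> _ i"] by (simp add: Cons)
  then show ?thesis unfolding composable_def using Cons by auto
qed (auto simp: composable_def)

lemma composable_map:
  assumes "composable B fs"
    and "\<And>x. x \<in> Arr B \<Longrightarrow> g x \<in> Arr B' \<and> Dom B' (g x) = \<phi> (Dom B x) \<and> Cod B' (g x) = \<phi> (Cod B x)"
  shows "composable B' (map g fs)"
  using assms unfolding composable_def by (auto simp: subset_iff)

lemma composable_ends:
  assumes "composable B fs"
  shows "hd fs \<in> Arr B" "last fs \<in> Arr B"
  using assms unfolding composable_def by auto

abbreviation unit_map :: "('o, 'm, 'p, 'n) dgfun \<Rightarrow> 'm \<times> 'k \<Rightarrow> 'n \<times> 'k" where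
  "unit_map F \<equiv> (\<lambda>(f, c). (farr F f, c))"

lemma (in nonunital_dg_functor) composable_unit_map:
  assumes "composable (add_units K C) fs"
  shows "composable (add_units K D) (map (unit_map F) fs)"
  using assms
  by (rule composable_map[where \<phi> = "fobj F"]) (use farr_Arr in \<open>auto simp: case_prod_beta\<close>)

section \<open>Ideals\<close>

lemma dg_ideal_subset: "dg_ideal K A I \<Longrightarrow> f \<in> I \<Longrightarrow> f \<in> Arr A"
  by (auto simp: dg_ideal_def)

lemma dg_ideal_dif: "dg_ideal K A I \<Longrightarrow> f \<in> I \<Longrightarrow> dif A f \<in> I"
  by (auto simp: dg_ideal_def)

lemma dg_ideal_cmp:
  "\<lbrakk>dg_ideal K A I; f \<in> Arr A; g \<in> Arr A; Dom A f = Cod A g; f \<in> I \<or> g \<in> I\<rbrakk> \<Longrightarrow> cmp A f g \<in> I"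
  by (simp add: dg_ideal_def)

context nonunital_dg
begin

text \<open>Negatives in each graded piece come from the scalar -1, so the listed closure properties
  already give the submodules that \<open>dg_ideal\<close> asks for.\<close>

lemma dg_idealI:
  assumes sub: "I \<subseteq> Arr A"
    and zer: "\<And>X Y n. X \<in> Obj A \<Longrightarrow> Y \<in> Obj A \<Longrightarrow> zer A X Y n \<in> I"
    and pls: "\<And>X Y n f g. \<lbrakk>f \<in> I; g \<in> I; f \<in> Hom A X Y n; g \<in> Hom A X Y n\<rbrakk> \<Longrightarrow> pls A f g \<in> I"
    and scl: "\<And>X Y n c f. \<lbrakk>c \<in> carrier K; f \<in> I; f \<in> Hom A X Y n\<rbrakk> \<Longrightarrow> scl A c f \<in> I"
    and dif: "\<And>f. f \<in> I \<Longrightarrow> dif A f \<in> I"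
    and cmp: "\<And>f g. \<lbrakk>f \<in> Arr A; g \<in> Arr A; Dom A f = Cod A g; f \<in> I \<or> g \<in> I\<rbrakk> \<Longrightarrow> cmp A f g \<in> I"
  shows "dg_ideal K A I"
  unfolding dg_ideal_def
proof (intro conjI ballI allI impI)
  fix X Y n assume ob: "X \<in> Obj A" "Y \<in> Obj A"
  interpret module K "HomM A X Y n" using module_HomM ob by blast
  show "submodule (I \<inter> Hom A X Y n) K (HomM A X Y n)"
  proof (rule submoduleI; simp add: zer ob zer_closed)
    fix f assume f: "f \<in> I \<and> f \<in> Hom A X Y n"
    have "\<ominus>\<^bsub>HomM A X Y n\<^esub> f = scl A (\<ominus>\<^bsub>K\<^esub> \<one>\<^bsub>K\<^esub>) f"
      using smult_l_minus[of "\<one>\<^bsub>K\<^esub>" f] smult_one[of f] f by simp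
    then show "\<ominus>\<^bsub>HomM A X Y n\<^esub> f \<in> I \<and> \<ominus>\<^bsub>HomM A X Y n\<^esub> f \<in> Hom A X Y n"
      using f scl[of "\<ominus>\<^bsub>K\<^esub> \<one>\<^bsub>K\<^esub>" f X Y n] scl_closed[of "\<ominus>\<^bsub>K\<^esub> \<one>\<^bsub>K\<^esub>" f X Y n] by simp
  next
    fix f g assume "f \<in> I \<and> f \<in> Hom A X Y n" "g \<in> I \<and> g \<in> Hom A X Y n"
    then show "pls A f g \<in> I \<and> pls A f g \<in> Hom A X Y n" using pls[of f g X Y n] pls_closed[of f X Y n g] by simp
  next
    fix c f assume "c \<in> carrier K" "f \<in> I \<and> f \<in> Hom A X Y n"
    then show "scl A c f \<in> I \<and> scl A c f \<in> Hom A X Y n" using scl[of c f X Y n] scl_closed[of c f X Y n] by simp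
  qed
qed (use sub dif cmp in simp_all)

lemma dg_ideal_submodule:
  assumes "dg_ideal K A I" "X \<in> Obj A" "Y \<in> Obj A"
  shows "submodule (I \<inter> Hom A X Y n) K (HomM A X Y n)"
  using assms unfolding dg_ideal_def by blast

lemma
  assumes I: "dg_ideal K A I"
  shows dg_ideal_zer: "X \<in> Obj A \<Longrightarrow> Y \<in> Obj A \<Longrightarrow> zer A X Y n \<in> I"
    and dg_ideal_pls: "\<lbrakk>f \<in> I; g \<in> I; f \<in> Hom A X Y n; g \<in> Hom A X Y n\<rbrakk> \<Longrightarrow> pls A f g \<in> I"
    and dg_ideal_scl: "\<lbrakk>c \<in> carrier K; f \<in> I; f \<in> Hom A X Y n\<rbrakk> \<Longrightarrow> scl A c f \<in> I"
    and dg_ideal_sgnd: "\<lbrakk>f \<in> I; f \<in> Hom A X Y n\<rbrakk> \<Longrightarrow> sgnd (HomM A X Y n) m f \<in> I \<inter> Hom A X Y n"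
proof -
  note sub = dg_ideal_submodule[OF I]
  show "zer A X Y n \<in> I" if "X \<in> Obj A" "Y \<in> Obj A"
    using subgroup.one_closed[OF submodule.axioms(1)[OF sub[OF that, of n]]] by simp
  show "pls A f g \<in> I" if "f \<in> I" "g \<in> I" "f \<in> Hom A X Y n" "g \<in> Hom A X Y n"
    using module.submoduleE(5)[OF module_HomM sub[OF Hom_Obj[OF that(3)], of n], of f g]
      Hom_Obj[OF that(3)] that by simp
  show "scl A c f \<in> I" if "c \<in> carrier K" "f \<in> I" "f \<in> Hom A X Y n"
    using module.submoduleE(4)[OF module_HomM sub[OF Hom_Obj[OF that(3)], of n], of c f]
      Hom_Obj[OF that(3)] that by simp
  show "sgnd (HomM A X Y n) m f \<in> I \<inter> Hom A X Y n" if "f \<in> I" "f \<in> Hom A X Y n"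
    using module.submoduleE(3)[OF module_HomM sub[OF Hom_Obj[OF that(2)], of n], of f]
      Hom_Obj[OF that(2)] that by (simp add: sgnd_def)
qed

text \<open>Makes the family of ideals whose intersection is \<open>wp_ideal\<close>
  nonempty.\<close>

lemma dg_ideal_Arr: "dg_ideal K A (Arr A)"
proof (rule dg_idealI)
  show "pls A f g \<in> Arr A" if "f \<in> Hom A X Y n" "g \<in> Hom A X Y n" for X Y n f g
    by (rule HomD(1)[OF pls_closed[OF that]])
  show "scl A c f \<in> Arr A" if "c \<in> carrier K" "f \<in> Hom A X Y n" for X Y n c f
    by (rule HomD(1)[OF scl_closed[OF that]])
  show "dif A f \<in> Arr A" if "f \<in> Arr A" for f
    by (rule HomD(1)[OF dif_closed[OF Hom_if_Arr[OF that]]])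
  show "cmp A f g \<in> Arr A" if "f \<in> Arr A" "g \<in> Arr A" "Dom A f = Cod A g" for f g
    by (rule HomD(1)[OF cmp_closed[OF Hom_if_Arr[OF that(1), unfolded that(3)] Hom_if_Arr[OF that(2)]]])
qed (simp_all add: zer_HomD(1))

text \<open>Nonemptiness keeps the intersection inside \<open>Arr A\<close>; the intersection of no
  sets would be the whole type.\<close>

lemma dg_ideal_Inter:
  assumes ne: "\<I> \<noteq> {}" and id: "\<And>I. I \<in> \<I> \<Longrightarrow> dg_ideal K A I"
  shows "dg_ideal K A (\<Inter>\<I>)"
proof (rule dg_idealI)
  obtain I where "I \<in> \<I>" using ne by auto
  then show "\<Inter>\<I> \<subseteq> Arr A" using dg_ideal_subset[OF id] by auto
  show "\<And>X Y n. X \<in> Obj A \<Longrightarrow> Y \<in> Obj A \<Longrightarrow> zer A X Y n \<in> \<Inter>\<I>"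
    by (simp add: dg_ideal_zer[OF id])
  show "\<And>X Y n f g. \<lbrakk>f \<in> \<Inter>\<I>; g \<in> \<Inter>\<I>; f \<in> Hom A X Y n; g \<in> Hom A X Y n\<rbrakk> \<Longrightarrow> pls A f g \<in> \<Inter>\<I>"
    by (rule InterI, rule dg_ideal_pls[OF id]) simp_all
  show "\<And>X Y n c f. \<lbrakk>c \<in> carrier K; f \<in> \<Inter>\<I>; f \<in> Hom A X Y n\<rbrakk> \<Longrightarrow> scl A c f \<in> \<Inter>\<I>"
    by (rule InterI, rule dg_ideal_scl[OF id]) simp_all
  show "\<And>f. f \<in> \<Inter>\<I> \<Longrightarrow> dif A f \<in> \<Inter>\<I>"
    by (simp add: dg_ideal_dif[OF id])
  show "\<And>f g. \<lbrakk>f \<in> Arr A; g \<in> Arr A; Dom A f = Cod A g; f \<in> \<Inter>\<I> \<or> g \<in> \<Inter>\<I>\<rbrakk> \<Longrightarrow> cmp A f g \<in> \<Inter>\<I>"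
    by (rule InterI, rule dg_ideal_cmp[OF id]) auto
qed

text \<open>The zero ideal: as hom-spaces are disjoint, it consists of one zero for each pair of
  objects and each degree.\<close>

lemma dg_ideal_zero: "dg_ideal K A {f \<in> Arr A. f = zer A (Dom A f) (Cod A f) (Deg A f)}"
  (is "dg_ideal K A ?Z")
proof -
  have Z: "f \<in> ?Z \<longleftrightarrow> f = zer A X Y n" if "f \<in> Hom A X Y n" for f X Y n
    using HomD[OF that] by auto
  have z: "zer A X Y n \<in> ?Z" if "X \<in> Obj A" "Y \<in> Obj A" for X Y n
    using zer_HomD[OF that] by simp
  show ?thesis
  proof (rule dg_idealI)
    show "zer A X Y n \<in> ?Z" if "X \<in> Obj A" "Y \<in> Obj A" for X Y n
      using z that .
    show "pls A f g \<in> ?Z" if "f \<in> ?Z" "g \<in> ?Z" and f: "f \<in> Hom A X Y n" and g: "g \<in> Hom A X Y n" for X Y n f g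
    proof -
      have "f = zer A X Y n" "g = zer A X Y n" using that(1,2) unfolding Z[OF f] Z[OF g] .
      then show ?thesis using z[OF Hom_Obj[OF f], of n] pls_zer_left[OF g] by metis
    qed
    show "scl A c f \<in> ?Z" if c: "c \<in> carrier K" and "f \<in> ?Z" and f: "f \<in> Hom A X Y n" for X Y n c f
    proof -
      have "f = zer A X Y n" using that(2) unfolding Z[OF f] .
      then show ?thesis using z[OF Hom_Obj[OF f], of n] scl_zer[OF c Hom_Obj[OF f], of n] by metis
    qed
    show "dif A f \<in> ?Z" if "f \<in> ?Z" for f
    proof -
      have f: "f = zer A (Dom A f) (Cod A f) (Deg A f)" and ob: "Dom A f \<in> Obj A" "Cod A f \<in> Obj A"
        using that Dom_Obj Cod_Obj by auto
      have "dif A f = zer A (Dom A f) (Cod A f) (Deg A f + 1)"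
        using dif_zer[OF ob, of "Deg A f"] f by simp
      then show ?thesis using z[OF ob] by simp
    qed
    show "cmp A f g \<in> ?Z"
      if fg: "f \<in> Arr A" "g \<in> Arr A" and e: "Dom A f = Cod A g" and "f \<in> ?Z \<or> g \<in> ?Z" for f g
    proof -
      have ob: "Dom A g \<in> Obj A" "Cod A f \<in> Obj A" using Dom_Obj Cod_Obj fg by auto
      have "cmp A f g = zer A (Dom A g) (Cod A f) (Deg A f + Deg A g)"
        using that(4)
      proof
        assume "f \<in> ?Z"
        then have "f = zer A (Cod A g) (Cod A f) (Deg A f)" using e by simp
        then show ?thesis using cmp_zer_left[OF Hom_if_Arr[OF fg(2)] ob(2), of "Deg A f"] by simp
      next
        assume "g \<in> ?Z"
        then have "g = zer A (Dom A g) (Dom A f) (Deg A g)" using e by simp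
        then show ?thesis using cmp_zer_right[OF Hom_if_Arr[OF fg(1)] ob(1), of "Deg A g"] by simp
      qed
      then show ?thesis using z[OF ob] by simp
    qed
  qed auto
qed

end

text \<open>With J the zero ideal this is the kernel of F, the ideal with which
  \<open>wp_ideal\<close> will be compared.\<close>

lemma (in nonunital_dg_functor) dg_ideal_preimage:
  assumes J: "dg_ideal K D J"
  shows "dg_ideal K C {f \<in> Arr C. farr F f \<in> J}"
proof (rule C.dg_idealI)
  show "zer C X Y n \<in> {f \<in> Arr C. farr F f \<in> J}" if "X \<in> Obj C" "Y \<in> Obj C" for X Y n
    using that by (simp add: C.zer_HomD farr_zer D.dg_ideal_zer[OF J] fobj_closed)
  show "pls C f g \<in> {f \<in> Arr C. farr F f \<in> J}"
    if "f \<in> {f \<in> Arr C. farr F f \<in> J}" "g \<in> {f \<in> Arr C. farr F f \<in> J}"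
      and f: "f \<in> Hom C X Y n" and g: "g \<in> Hom C X Y n" for X Y n f g
    using that(1,2) HomD(1)[OF C.pls_closed[OF f g]] farr_pls[OF f g]
      D.dg_ideal_pls[OF J _ _ farr_Hom[OF f] farr_Hom[OF g]] by simp
  show "scl C c f \<in> {f \<in> Arr C. farr F f \<in> J}"
    if c: "c \<in> carrier K" and "f \<in> {f \<in> Arr C. farr F f \<in> J}" and f: "f \<in> Hom C X Y n" for X Y n c f
    using that(2) HomD(1)[OF C.scl_closed[OF c f]] farr_scl[OF c f]
      D.dg_ideal_scl[OF J c _ farr_Hom[OF f]] by simp
  show "dif C f \<in> {f \<in> Arr C. farr F f \<in> J}" if "f \<in> {f \<in> Arr C. farr F f \<in> J}" for f
    using that HomD(1)[OF C.dif_closed[OF Hom_if_Arr]] by (simp add: farr_dif dg_ideal_dif[OF J])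
  show "cmp C f g \<in> {f \<in> Arr C. farr F f \<in> J}"
    if f: "f \<in> Arr C" and g: "g \<in> Arr C" and e: "Dom C f = Cod C g"
      and "f \<in> {f \<in> Arr C. farr F f \<in> J} \<or> g \<in> {f \<in> Arr C. farr F f \<in> J}" for f g
    using that(4) HomD(1)[OF C.cmp_closed[OF Hom_if_Arr[OF f, unfolded e] Hom_if_Arr[OF g]]]
      farr_cmp[OF f g e] farr_Arr[OF f] farr_Arr[OF g] e dg_ideal_cmp[OF J, of "farr F f" "farr F g"] by auto
qed auto

section \<open>The quotient by the ideal of higher components\<close>

lemma ainf_functorD:
  assumes "ainf_functor K B A F0 F"
  shows ainf_functor_closed: "composable B fs \<Longrightarrow>
      F fs \<in> Hom A (F0 (Dom B (last fs))) (F0 (Cod B (hd fs))) (deg_sum B fs + 1 - int (length fs))"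
    and ainf_functor_pls: "\<lbrakk>composable B (gs @ x # hs); composable B (gs @ y # hs);
      Dom B x = Dom B y; Cod B x = Cod B y; Deg B x = Deg B y\<rbrakk> \<Longrightarrow>
      F (gs @ pls B x y # hs) = pls A (F (gs @ x # hs)) (F (gs @ y # hs))"
    and ainf_functor_scl: "\<lbrakk>c \<in> carrier K; composable B (gs @ x # hs)\<rbrakk> \<Longrightarrow>
      F (gs @ scl B c x # hs) = scl A c (F (gs @ x # hs))"
    and ainf_functor_eq: "composable B fs \<Longrightarrow>
        (let n = length fs;
             M = HomM A (F0 (Dom B (last fs))) (F0 (Cod B (hd fs))) (deg_sum B fs + 2 - int n)
         in
           sgnd M (int n - 1)
             (\<Oplus>\<^bsub>M\<^esub> i\<in>{..<n}. sgnd M (deg_sum B (take i fs)) (F (fs[i := dif B (fs ! i)])))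
           \<oplus>\<^bsub>M\<^esub>
             (\<Oplus>\<^bsub>M\<^esub> i\<in>{..<n - 1}. sgnd M (int i)
                (F (take i fs @ cmp B (fs ! i) (fs ! Suc i) # drop (i + 2) fs)))
           = dif A (F fs)
           \<oplus>\<^bsub>M\<^esub>
             (\<Oplus>\<^bsub>M\<^esub> i\<in>{1..<n}.
                sgnd M (int i - 1 + (1 - int (n - i)) * deg_sum B (take i fs))
                  (cmp A (F (take i fs)) (F (drop i fs)))))"
  subgoal
    using assms[unfolded ainf_functor_def, THEN conjunct2, THEN conjunct1, rule_format] .
  subgoal
    using assms[unfolded ainf_functor_def, THEN conjunct2, THEN conjunct2, THEN conjunct1, rule_format] by simp
  subgoal
    using assms[unfolded ainf_functor_def, THEN conjunct2, THEN conjunct2, THEN conjunct2, THEN conjunct1, rule_format] .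
  subgoal
    using assms[unfolded ainf_functor_def, THEN conjunct2, THEN conjunct2, THEN conjunct2, THEN conjunct2, rule_format] .
  done

text \<open>These are the index sets that occur in the A_infinity equation for strings of one or two
  arrows.\<close>

lemma (in abelian_monoid) finsum_initial:
  "f 0 \<in> carrier G \<Longrightarrow> (\<Oplus>i\<in>{..<Suc 0}. f i) = f 0"
  "f 0 \<in> carrier G \<Longrightarrow> f 1 \<in> carrier G \<Longrightarrow> (\<Oplus>i\<in>{..<2}. f i) = f 0 \<oplus> f 1"
  "f 1 \<in> carrier G \<Longrightarrow> (\<Oplus>i\<in>{1..<2}. f i) = f 1"
proof -
  have "{..<2::nat} = {0, 1}" "{..<Suc 0} = {0}" "{1..<2::nat} = {1}" by auto
  then show "f 0 \<in> carrier G \<Longrightarrow> (\<Oplus>i\<in>{..<Suc 0}. f i) = f 0"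
    "f 0 \<in> carrier G \<Longrightarrow> f 1 \<in> carrier G \<Longrightarrow> (\<Oplus>i\<in>{..<2}. f i) = f 0 \<oplus> f 1"
    "f 1 \<in> carrier G \<Longrightarrow> (\<Oplus>i\<in>{1..<2}. f i) = f 1"
    by (simp_all only: finsum_insert finsum_empty finite.intros) (simp_all add: finsum_insert)
qed

lemma cmp_add_units:
  "cmp (add_units K A) x y =
    (let z = zer A (Dom A (fst y)) (Cod A (fst x)) (Deg A (fst x) + Deg A (fst y)) in
      (pls A (pls A (cmp A (fst x) (fst y)) (if snd x = \<zero>\<^bsub>K\<^esub> then z else scl A (snd x) (fst y)))
        (if snd y = \<zero>\<^bsub>K\<^esub> then z else scl A (snd y) (fst x)), snd x \<otimes>\<^bsub>K\<^esub> snd y))"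
  by (simp add: add_units_def case_prod_beta)

text \<open>A nonzero scalar makes its arrow an endomorphism of degree 0, so the multiple of the
  other arrow that enters the composite lies in the hom-space of the composite.\<close>

lemma (in nonunital_dg) cmp_add_units_closed:
  assumes "composable (add_units K A) [x, y]"
  shows "cmp (add_units K A) x y \<in> Arr (add_units K A)"
    "fst (cmp (add_units K A) x y) \<in> Hom A (Dom A (fst y)) (Cod A (fst x)) (Deg A (fst x) + Deg A (fst y))"
proof -
  let ?n = "Deg A (fst x) + Deg A (fst y)"
  have x: "x \<in> Arr (add_units K A)" and y: "y \<in> Arr (add_units K A)" and xy: "Dom A (fst x) = Cod A (fst y)"
    using assms by (simp_all add: composable_Cons del: add_units_simps(2))
  have f: "fst x \<in> Hom A (Cod A (fst y)) (Cod A (fst x)) (Deg A (fst x))"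
    and g: "fst y \<in> Hom A (Dom A (fst y)) (Cod A (fst y)) (Deg A (fst y))"
    using Hom_if_Arr[of "fst x" A] Hom_if_Arr[of "fst y" A] x y xy by simp_all
  interpret module K "HomM A (Dom A (fst y)) (Cod A (fst x)) ?n"
    using module_HomM Hom_Obj f g by blast
  have c: "snd x \<in> carrier K" "snd y \<in> carrier K" using x y by simp_all
  have "snd x \<noteq> \<zero>\<^bsub>K\<^esub> \<Longrightarrow> scl A (snd x) (fst y) \<in> Hom A (Dom A (fst y)) (Cod A (fst x)) ?n"
    using scl_closed[OF c(1) g] x xy by simp
  moreover have "snd y \<noteq> \<zero>\<^bsub>K\<^esub> \<Longrightarrow> scl A (snd y) (fst x) \<in> Hom A (Dom A (fst y)) (Cod A (fst x)) ?n"
    using scl_closed[OF c(2) f] y xy by simp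
  ultimately show 1: "fst (cmp (add_units K A) x y) \<in> Hom A (Dom A (fst y)) (Cod A (fst x)) ?n"
    using cmp_closed[OF f g] zer_closed Hom_Obj f g
    by (auto simp: cmp_add_units Let_def intro!: pls_closed)
  \<comment> \<open>The composite carries a nonzero scalar only when both arrows are endomorphisms
    of degree 0, and then so is the composite.\<close>
  have "snd x \<otimes>\<^bsub>K\<^esub> snd y \<noteq> \<zero>\<^bsub>K\<^esub> \<Longrightarrow> snd x \<noteq> \<zero>\<^bsub>K\<^esub> \<and> snd y \<noteq> \<zero>\<^bsub>K\<^esub>"
    using c by auto
  then show "cmp (add_units K A) x y \<in> Arr (add_units K A)"
    using HomD[OF 1] x y xy c by (auto simp: cmp_add_units Let_def)
qed

lemma L_obj_simps [simp]:
  "Obj (L_obj K C) = Obj C" "Arr (L_obj K C) = rep K C ` Arr C" "Dom (L_obj K C) = Dom C"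
  "Cod (L_obj K C) = Cod C" "Deg (L_obj K C) = Deg C"
  "zer (L_obj K C) X Y n = rep K C (zer C X Y n)" "pls (L_obj K C) f g = rep K C (pls C f g)"
  "scl (L_obj K C) c f = rep K C (scl C c f)" "dif (L_obj K C) f = rep K C (dif C f)"
  "cmp (L_obj K C) f g = rep K C (cmp C f g)" "idn (L_obj K C) X = rep K C (idn C X)"
  by (simp_all add: L_obj_def)

locale weakly_unital_dg =
  fixes K :: "'k ring" and C :: "('o, 'm, 'k) wudgcat"
  assumes field: "field K" and weakly_unital: "weakly_unital_dgcat K C"
begin

sublocale K: field K by (rule field)

sublocale nonunital_dg K C
  using weakly_unital by unfold_locales (simp add: weakly_unital_dgcat_def)

lemma
  assumes "X \<in> Obj C"
  shows idn_closed: "idn C X \<in> Hom C X X 0" and dif_idn: "dif C (idn C X) = zer C X X 1"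
  using weakly_unital assms unfolding weakly_unital_dgcat_def by blast+

lemma ainf: "ainf_functor K (add_units K C) C (\<lambda>X. X) (wp C)"
  using weakly_unital unfolding weakly_unital_dgcat_def by (elim conjE)

lemma wp_inc: "f \<in> Arr C \<Longrightarrow> wp C [(f, \<zero>\<^bsub>K\<^esub>)] = f"
  using weakly_unital unfolding weakly_unital_dgcat_def inc_def by blast

lemma wp_unit: "X \<in> Obj C \<Longrightarrow> wp C [(zer C X X 0, \<one>\<^bsub>K\<^esub>)] = idn C X"
  using weakly_unital unfolding weakly_unital_dgcat_def unit_of_def by blast

lemma wp_closed:
  "composable (add_units K C) fs \<Longrightarrow> wp C fs \<in> Hom C (Dom C (fst (last fs))) (Cod C (fst (hd fs)))
    (deg_sum (add_units K C) fs + 1 - int (length fs))"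
  using ainf_functor_closed[OF ainf, of fs] by simp

text \<open>(f, c) is the sum of (f, 0) and c times the unit (0, 1), and p_1 is linear with p_1(f) =
  f and p_1(1_X) = id_X.\<close>

lemma wp_single:
  assumes f: "f \<in> Hom C X X 0" and c: "c \<in> carrier K"
  shows "wp C [(f, c)] = pls C f (scl C c (idn C X))"
proof -
  have X: "X \<in> Obj C" using Hom_Obj f by blast
  note f' = HomD[OF f] and z = zer_HomD[OF X X, of 0]
  have "wp C ([] @ scl (add_units K C) c (zer C X X 0, \<one>\<^bsub>K\<^esub>) # []) = scl C c (wp C ([] @ (zer C X X 0, \<one>\<^bsub>K\<^esub>) # []))"
    by (rule ainf_functor_scl[OF ainf c]) (simp add: composable_Cons z)
  then have 1: "wp C [(zer C X X 0, c)] = scl C c (idn C X)"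
    using wp_unit[OF X] c scl_zer[OF c X X] by simp
  have "wp C ([] @ pls (add_units K C) (f, \<zero>\<^bsub>K\<^esub>) (zer C X X 0, c) # []) =
      pls C (wp C ([] @ (f, \<zero>\<^bsub>K\<^esub>) # [])) (wp C ([] @ (zer C X X 0, c) # []))"
    by (rule ainf_functor_pls[OF ainf]) (simp_all add: composable_Cons z c f')
  then show ?thesis using 1 wp_inc f' c pls_zer_right[OF f] by simp
qed

section \<open>The ideal of higher components and the chosen representatives of its cosets\<close>

abbreviation "I \<equiv> wp_ideal K C"

lemma dg_ideal_wp_ideal: "dg_ideal K C I"
  unfolding wp_ideal_def
proof (rule dg_ideal_Inter)
  have "Arr C \<in> {I. dg_ideal K C I \<and>
      (\<forall>fs. composable (add_units K C) fs \<and> 2 \<le> length fs \<longrightarrow> wp C fs \<in> I)}"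
    using dg_ideal_Arr HomD(1)[OF wp_closed] by blast
  then show "{I. dg_ideal K C I \<and>
      (\<forall>fs. composable (add_units K C) fs \<and> 2 \<le> length fs \<longrightarrow> wp C fs \<in> I)} \<noteq> {}" by blast
qed simp

lemma wp_in_ideal: "composable (add_units K C) fs \<Longrightarrow> 2 \<le> length fs \<Longrightarrow> wp C fs \<in> I"
  unfolding wp_ideal_def by blast

lemma wp_ideal_least:
  assumes "dg_ideal K C J"
    and "\<And>fs. composable (add_units K C) fs \<Longrightarrow> 2 \<le> length fs \<Longrightarrow> wp C fs \<in> J"
  shows "I \<subseteq> J"
  unfolding wp_ideal_def using assms by blast

text \<open>\<open>rep\<close> chooses from the coset of f, so its value is f plus an element of the
  ideal. Together with \<open>rep_pls_ideal\<close> this is all that is used about the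
  choice.\<close>

lemma rep_decomp:
  assumes f: "f \<in> Hom C X Y n"
  obtains h where "h \<in> I" "h \<in> Hom C X Y n" "rep K C f = pls C h f"
proof -
  have e: "Dom C f = X" "Cod C f = Y" "Deg C f = n" using HomD[OF f] by auto
  have *: "(I \<inter> Hom C X Y n) +>\<^bsub>HomM C X Y n\<^esub> f = (\<lambda>h. pls C h f) ` (I \<inter> Hom C X Y n)"
    unfolding a_r_coset_def' by auto
  \<comment> \<open>The coset contains 0 + f, hence is nonempty, and \<open>SOME\<close> really
    chooses from it.\<close>
  have "pls C (zer C X Y n) f \<in> (\<lambda>h. pls C h f) ` (I \<inter> Hom C X Y n)"
    using dg_ideal_zer[OF dg_ideal_wp_ideal] zer_closed Hom_Obj[OF f] by blast
  then have "rep K C f \<in> (\<lambda>h. pls C h f) ` (I \<inter> Hom C X Y n)"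
    unfolding rep_def e * by (rule someI)
  then show ?thesis using that by blast
qed

text \<open>h + f and f have the same coset, ends and degree, and \<open>rep\<close> is a function
  of these: congruent arrows get literally the same representative.\<close>

lemma rep_pls_ideal:
  assumes h: "h \<in> I" "h \<in> Hom C X Y n" and f: "f \<in> Hom C X Y n"
  shows "rep K C (pls C h f) = rep K C f"
proof -
  interpret module K "HomM C X Y n" using module_HomM Hom_Obj[OF f] by blast
  let ?H = "I \<inter> Hom C X Y n"
  have sub: "subgroup ?H (add_monoid (HomM C X Y n))"
    using dg_ideal_submodule[OF dg_ideal_wp_ideal Hom_Obj[OF f]] submodule.axioms(1) by blast
  have "?H +>\<^bsub>HomM C X Y n\<^esub> (pls C h f) = ?H +>\<^bsub>HomM C X Y n\<^esub> f"
    using M.a_coset_add_assoc[of ?H h f] M.a_coset_join2[OF _ sub, of h] h f by simp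
  then show ?thesis
    using HomD[OF f] HomD[OF pls_closed[OF h(2) f]] unfolding rep_def by simp
qed

lemma rep_closed: "f \<in> Hom C X Y n \<Longrightarrow> rep K C f \<in> Hom C X Y n"
  using rep_decomp[of f X Y n] pls_closed[of _ X Y n f] by metis

lemma rep_HomD:
  assumes "f \<in> Arr C"
  shows "rep K C f \<in> Arr C" "Dom C (rep K C f) = Dom C f" "Cod C (rep K C f) = Cod C f"
    "Deg C (rep K C f) = Deg C f"
  using HomD[OF rep_closed[OF Hom_if_Arr[OF assms]]] by auto

lemma rep_rep: "f \<in> Arr C \<Longrightarrow> rep K C (rep K C f) = rep K C f"
  using rep_decomp[OF Hom_if_Arr] rep_pls_ideal[OF _ _ Hom_if_Arr] by metis

lemma rep_ideal:
  assumes "h \<in> I" "h \<in> Hom C X Y n"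
  shows "rep K C h = rep K C (zer C X Y n)"
  using rep_pls_ideal[OF assms zer_closed[OF Hom_Obj[OF assms(2)]]] pls_zer_right[OF assms(2)] by simp

text \<open>With its analogues for scalars, differential and composition this makes
  \<open>rep\<close> a homomorphism from C to \<open>L_obj K C\<close>, whose operations are those
  of C on representatives followed by \<open>rep\<close>.\<close>

lemma rep_pls:
  assumes f: "f \<in> Hom C X Y n" and g: "g \<in> Hom C X Y n"
  shows "rep K C (pls C (rep K C f) (rep K C g)) = rep K C (pls C f g)"
proof -
  obtain h where h: "h \<in> I" "h \<in> Hom C X Y n" "rep K C f = pls C h f" by (rule rep_decomp[OF f])
  obtain k where k: "k \<in> I" "k \<in> Hom C X Y n" "rep K C g = pls C k g" by (rule rep_decomp[OF g])
  show ?thesis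
    unfolding h(3) k(3) pls_pls_swap[OF h(2) f k(2) g]
    by (rule rep_pls_ideal[OF dg_ideal_pls[OF dg_ideal_wp_ideal h(1) k(1) h(2) k(2)]
          pls_closed[OF h(2) k(2)] pls_closed[OF f g]])
qed

lemma rep_scl:
  assumes c: "c \<in> carrier K" and f: "f \<in> Hom C X Y n"
  shows "rep K C (scl C c (rep K C f)) = rep K C (scl C c f)"
proof -
  obtain h where h: "h \<in> I" "h \<in> Hom C X Y n" "rep K C f = pls C h f" by (rule rep_decomp[OF f])
  show ?thesis
    unfolding h(3) scl_pls[OF c h(2) f]
    by (rule rep_pls_ideal[OF dg_ideal_scl[OF dg_ideal_wp_ideal c h(1,2)]
          scl_closed[OF c h(2)] scl_closed[OF c f]])
qed

lemma rep_dif: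
  assumes "f \<in> Arr C"
  shows "rep K C (dif C (rep K C f)) = rep K C (dif C f)"
proof -
  note f = Hom_if_Arr[OF assms]
  obtain h where h: "h \<in> I" "h \<in> Hom C (Dom C f) (Cod C f) (Deg C f)" "rep K C f = pls C h f"
    by (rule rep_decomp[OF f])
  show ?thesis
    unfolding h(3) dif_pls[OF h(2) f]
    by (rule rep_pls_ideal[OF dg_ideal_dif[OF dg_ideal_wp_ideal h(1)] dif_closed[OF h(2)] dif_closed[OF f]])
qed

text \<open>With the representatives written as h + f and k + g, the two-sided ideal absorbs h (k +
  g) and after that f k.\<close>

lemma rep_cmp:
  assumes "f \<in> Arr C" "g \<in> Arr C" "Dom C f = Cod C g"
  shows "rep K C (cmp C (rep K C f) (rep K C g)) = rep K C (cmp C f g)"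
proof -
  note g = Hom_if_Arr[OF assms(2)] and f = Hom_if_Arr[OF assms(1), unfolded assms(3)]
  obtain h where h: "h \<in> I" "h \<in> Hom C (Cod C g) (Cod C f) (Deg C f)" "rep K C f = pls C h f"
    by (rule rep_decomp[OF f])
  obtain k where k: "k \<in> I" "k \<in> Hom C (Dom C g) (Cod C g) (Deg C g)" "rep K C g = pls C k g"
    by (rule rep_decomp[OF g])
  note ideal = dg_ideal_cmp[OF dg_ideal_wp_ideal]
  have r: "pls C k g \<in> Hom C (Dom C g) (Cod C g) (Deg C g)" by (rule pls_closed[OF k(2) g])
  have "rep K C (cmp C (rep K C f) (rep K C g)) = rep K C (cmp C f (pls C k g))"
    unfolding h(3) k(3) cmp_pls_left[OF r h(2) f]
    using HomD[OF r] HomD[OF h(2)] h(1)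
    by (intro rep_pls_ideal[OF ideal cmp_closed[OF h(2) r] cmp_closed[OF f r]]) auto
  also have "\<dots> = rep K C (cmp C f g)"
    unfolding cmp_pls_right[OF f k(2) g]
    using HomD[OF k(2)] k(1) assms
    by (intro rep_pls_ideal[OF ideal cmp_closed[OF f k(2)] cmp_closed[OF f g]]) auto
  finally show ?thesis .
qed

text \<open>For two arguments the equation reads -(p_2(dx, y) \<plusminus> p_2(x, dy)) + p_1(x y) =
  d p_2(x, y) + p_1(x) p_1(y). The terms with p_2 lie in the ideal, which contains the values of p_2
  and is closed under d.\<close>

lemma rep_wp_cmp:
  assumes "composable (add_units K C) [x, y]"
  shows "rep K C (wp C [cmp (add_units K C) x y]) = rep K C (cmp C (wp C [x]) (wp C [y]))"
proof -
  let ?B = "add_units K C"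
  let ?X = "Dom C (fst y)" and ?Y = "Cod C (fst x)" and ?n = "Deg C (fst x) + Deg C (fst y)"
  define M where "M = HomM C ?X ?Y ?n"
  have x: "x \<in> Arr ?B" and y: "y \<in> Arr ?B" and xy: "Dom C (fst x) = Cod C (fst y)"
    using assms by (simp_all add: composable_Cons del: add_units_simps(2))
  have cx: "composable ?B [x]" and cy: "composable ?B [y]"
    using assms unfolding composable_Cons by blast+
  have fst_x: "fst x \<in> Hom C (Cod C (fst y)) ?Y (Deg C (fst x))"
    and fst_y: "fst y \<in> Hom C ?X (Cod C (fst y)) (Deg C (fst y))"
    using Hom_if_Arr[of "fst x" C] Hom_if_Arr[of "fst y" C] x y xy by simp_all
  have ob: "?X \<in> Obj C" "?Y \<in> Obj C" using Hom_Obj fst_x fst_y by blast+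
  interpret M: module K M unfolding M_def by (rule module_HomM[OF ob])
  have carr: "carrier M = Hom C ?X ?Y ?n" by (simp add: M_def)
  have dx: "composable ?B [dif ?B x, y]" and dy: "composable ?B [x, dif ?B y]"
    using x y xy HomD[OF dif_closed[OF fst_x]] HomD[OF dif_closed[OF fst_y]] by (simp_all add: composable_Cons)
  \<comment> \<open>The p_2 terms of the left side; the outer sign is that of n - 1 = 1.\<close>
  define S where "S = sgnd M 1 (sgnd M 0 (wp C [dif ?B x, y]) \<oplus>\<^bsub>M\<^esub> sgnd M (Deg C (fst x)) (wp C [x, dif ?B y]))"
  have wd: "wp C [dif ?B x, y] \<in> Hom C ?X ?Y ?n" "wp C [x, dif ?B y] \<in> Hom C ?X ?Y ?n"
    using wp_closed[OF dx] wp_closed[OF dy] HomD[OF dif_closed[OF fst_x]] HomD[OF dif_closed[OF fst_y]]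
    by (simp_all add: deg_sum_def)
  note sg = dg_ideal_sgnd[OF dg_ideal_wp_ideal, of _ ?X ?Y ?n, folded M_def]
  have wi: "sgnd M 0 (wp C [dif ?B x, y]) \<in> I \<inter> Hom C ?X ?Y ?n"
    "sgnd M (Deg C (fst x)) (wp C [x, dif ?B y]) \<in> I \<inter> Hom C ?X ?Y ?n"
    using sg[OF wp_in_ideal[OF dx] wd(1)] sg[OF wp_in_ideal[OF dy] wd(2)] by simp_all
  have S: "S \<in> I \<inter> Hom C ?X ?Y ?n"
    unfolding S_def using wi
    by (intro sg) (auto simp: M_def intro: dg_ideal_pls[OF dg_ideal_wp_ideal] pls_closed)
  have Q: "cmp C (wp C [x]) (wp C [y]) \<in> Hom C ?X ?Y ?n"
    using wp_closed[OF cx] wp_closed[OF cy] xy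
    by (intro cmp_closed[where Y = "Cod C (fst y)"]) (simp_all add: deg_sum_def)
  have P: "wp C [cmp ?B x y] \<in> Hom C ?X ?Y ?n"
    using wp_closed[of "[cmp ?B x y]"] cmp_add_units_closed[OF assms] HomD[OF cmp_add_units_closed(2)[OF assms]]
    by (simp add: composable_Cons deg_sum_def)
  have D: "dif C (wp C [x, y]) \<in> I" "dif C (wp C [x, y]) \<in> Hom C ?X ?Y ?n"
    using dg_ideal_dif[OF dg_ideal_wp_ideal wp_in_ideal[OF assms]] dif_closed[OF wp_closed[OF assms]]
    by (simp_all add: deg_sum_def)
  have "S \<oplus>\<^bsub>M\<^esub> wp C [cmp ?B x y] = dif C (wp C [x, y]) \<oplus>\<^bsub>M\<^esub> cmp C (wp C [x]) (wp C [y])"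
  proof -
    \<comment> \<open>These rewrites bring the index sets into the shape of
      \<open>finsum_initial\<close>: the second sum has only i = 0, the third only i = 1.\<close>
    have len: "length [x, y] = 2" "int 2 - 1 = 1" "(2::nat) - 1 = Suc 0" by simp_all
    have M: "HomM C (Dom ?B (last [x, y])) (Cod ?B (hd [x, y])) (deg_sum ?B [x, y] + 2 - int 2) = M"
      by (simp add: M_def deg_sum_def)
    have s1: "(\<Oplus>\<^bsub>M\<^esub>i\<in>{..<2}. sgnd M (deg_sum ?B (take i [x, y])) (wp C ([x, y][i := dif ?B ([x, y] ! i)]))) =
        sgnd M 0 (wp C [dif ?B x, y]) \<oplus>\<^bsub>M\<^esub> sgnd M (Deg C (fst x)) (wp C [x, dif ?B y])"
      using wi by (subst M.M.finsum_initial(2)) (simp_all add: carr deg_sum_def)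
    have s2: "(\<Oplus>\<^bsub>M\<^esub>i\<in>{..<Suc 0}. sgnd M (int i) (wp C (take i [x, y] @
        cmp ?B ([x, y] ! i) ([x, y] ! Suc i) # drop (i + 2) [x, y]))) = wp C [cmp ?B x y]"
      using P by (subst M.M.finsum_initial(1)) (simp_all add: carr sgnd_def)
    \<comment> \<open>At i = 1 the exponent is 0 plus (1 - 1) times a degree, so the product carries
      no sign.\<close>
    have s3: "(\<Oplus>\<^bsub>M\<^esub>i\<in>{1..<2}. sgnd M (int i - 1 + (1 - int (2 - i)) * deg_sum ?B (take i [x, y]))
        (cmp C (wp C (take i [x, y])) (wp C (drop i [x, y])))) = cmp C (wp C [x]) (wp C [y])"
      using Q by (subst M.M.finsum_initial(3)) (simp_all add: carr sgnd_def)
    show ?thesis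
      using ainf_functor_eq[OF ainf assms, unfolded Let_def len M s1 s2 s3] unfolding S_def .
  qed
  then show ?thesis
    using rep_pls_ideal[OF _ _ P, of S] rep_pls_ideal[OF D Q] S by (simp add: M_def)
qed

section \<open>The quotient as a strictly unital dg category\<close>

lemma Hom_L_obj: "Hom (L_obj K C) X Y n = rep K C ` Hom C X Y n"
proof
  show "Hom (L_obj K C) X Y n \<subseteq> rep K C ` Hom C X Y n"
    by (auto simp: Hom_def rep_HomD)
  show "rep K C ` Hom C X Y n \<subseteq> Hom (L_obj K C) X Y n"
    using HomD[OF rep_closed] HomD(1) by (fastforce simp: Hom_def)
qed

lemma nonunital_dgcat_L_obj: "nonunital_dgcat K (L_obj K C)"
proof (rule nonunital_dgcat_surj[OF nonunital, where q = "rep K C"])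
  show "rep K C (pls C f g) = pls (L_obj K C) (rep K C f) (rep K C g)"
    if "f \<in> Hom C X Y n" "g \<in> Hom C X Y n" for X Y n f g
    using rep_pls[OF that] by simp
  show "rep K C (scl C c f) = scl (L_obj K C) c (rep K C f)"
    if "c \<in> carrier K" "f \<in> Hom C X Y n" for X Y n c f
    using rep_scl[OF that] by simp
qed (simp_all add: Hom_L_obj rep_HomD rep_dif rep_cmp)

text \<open>After adjoining units, the composite of f with a strict unit is f itself.
  \<open>rep_wp_cmp\<close> carries this through p_1, which sends the unit to id and f to f.\<close>

lemma rep_idn_cmp:
  assumes f: "f \<in> Arr C"
  shows "rep K C (cmp C (idn C (Cod C f)) f) = rep K C f"
    and "rep K C (cmp C f (idn C (Dom C f))) = rep K C f"
proof -
  have ob: "Dom C f \<in> Obj C" "Cod C f \<in> Obj C" using Dom_Obj Cod_Obj f by auto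
  note H = Hom_if_Arr[OF f] and z = zer_HomD[OF ob(1) ob(1)] zer_HomD[OF ob(2) ob(2)]
  have "composable (add_units K C) [(zer C (Cod C f) (Cod C f) 0, \<one>\<^bsub>K\<^esub>), (f, \<zero>\<^bsub>K\<^esub>)]"
    "composable (add_units K C) [(f, \<zero>\<^bsub>K\<^esub>), (zer C (Dom C f) (Dom C f) 0, \<one>\<^bsub>K\<^esub>)]"
    using f z by (simp_all add: composable_Cons)
  note * = this[THEN rep_wp_cmp]
  \<comment> \<open>The arrow part of a unit is zero, so of the three summands of the composite only
    1 f survives.\<close>
  have "cmp (add_units K C) (zer C (Cod C f) (Cod C f) 0, \<one>\<^bsub>K\<^esub>) (f, \<zero>\<^bsub>K\<^esub>) = (f, \<zero>\<^bsub>K\<^esub>)"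
    "cmp (add_units K C) (f, \<zero>\<^bsub>K\<^esub>) (zer C (Dom C f) (Dom C f) 0, \<one>\<^bsub>K\<^esub>) = (f, \<zero>\<^bsub>K\<^esub>)"
    using z cmp_zer_left[OF H ob(2), of 0] cmp_zer_right[OF H ob(1), of 0]
    by (simp_all add: cmp_add_units Let_def scl_one[OF H] pls_zer_left[OF H] pls_zer_right[OF H]
        pls_zer_left[OF zer_closed[OF ob]])
  then show "rep K C (cmp C (idn C (Cod C f)) f) = rep K C f"
    "rep K C (cmp C f (idn C (Dom C f))) = rep K C f"
    using * wp_inc[OF f] wp_unit[OF ob(1)] wp_unit[OF ob(2)] by simp_all
qed

lemma unital_dgcat_L_obj: "unital_dgcat K (L_obj K C)"
  unfolding unital_dgcat_def
proof (intro conjI ballI)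
  show "nonunital_dgcat K (L_obj K C)" by (rule nonunital_dgcat_L_obj)
  fix X assume "X \<in> Obj (L_obj K C)"
  then have X: "X \<in> Obj C" by simp
  show "idn (L_obj K C) X \<in> Hom (L_obj K C) X X 0"
    using idn_closed[OF X] by (simp add: Hom_L_obj)
  show "dif (L_obj K C) (idn (L_obj K C) X) = zer (L_obj K C) X X 1"
    using HomD(1)[OF idn_closed[OF X]] dif_idn[OF X] by (simp add: rep_dif)
next
  fix f assume "f \<in> Arr (L_obj K C)"
  then obtain g where g: "g \<in> Arr C" "f = rep K C g" by auto
  have ob: "Dom C g \<in> Obj C" "Cod C g \<in> Obj C" using Dom_Obj Cod_Obj g by auto
  note i = HomD[OF idn_closed[OF ob(1)]] HomD[OF idn_closed[OF ob(2)]]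
  show "cmp (L_obj K C) (idn (L_obj K C) (Cod (L_obj K C) f)) f = f"
    using i g rep_idn_cmp(1)[OF g(1)] by (simp add: rep_HomD rep_cmp)
  show "cmp (L_obj K C) f (idn (L_obj K C) (Dom (L_obj K C) f)) = f"
    using i g rep_idn_cmp(2)[OF g(1)] by (simp add: rep_HomD rep_cmp)
qed

end

text \<open>The unit of the adjunction at C; here it is only a functor of non-unital dg categories
  into \<open>L_obj K C\<close>.\<close>

definition quot_fun :: "'k ring \<Rightarrow> ('o, 'm, 'k) wudgcat \<Rightarrow> ('o, 'm, 'o, 'm) dgfun" where
  "quot_fun K C = \<lparr>fobj = restrict (\<lambda>X. X) (Obj C), farr = restrict (rep K C) (Arr C)\<rparr>"

text \<open>Arrows of the quotient are themselves arrows of C, so the induced functor is F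
  restricted to representatives. It is a dg functor once F kills the ideal.\<close>

definition descend :: "'k ring \<Rightarrow> ('o, 'm, 'k) wudgcat \<Rightarrow> ('o, 'm, 'p, 'n) dgfun \<Rightarrow> ('o, 'm, 'p, 'n) dgfun" where
  "descend K C F = \<lparr>fobj = fobj F, farr = restrict (farr F) (Arr (L_obj K C))\<rparr>"

lemma quot_fun_simps [simp]:
  "X \<in> Obj C \<Longrightarrow> fobj (quot_fun K C) X = X" "f \<in> Arr C \<Longrightarrow> farr (quot_fun K C) f = rep K C f"
  by (simp_all add: quot_fun_def)

lemma descend_simps [simp]:
  "fobj (descend K C F) = fobj F" "f \<in> Arr C \<Longrightarrow> farr (descend K C F) (rep K C f) = farr F (rep K C f)"
  "farr (descend K C F) \<in> extensional (Arr (L_obj K C))"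
  by (simp_all add: descend_def)

context weakly_unital_dg
begin

lemma nonunital_dgfun_quot_fun: "nonunital_dgfun K C (L_obj K C) (quot_fun K C)"
proof (rule nonunital_dgfunI)
  show "fobj (quot_fun K C) \<in> Obj C \<rightarrow>\<^sub>E Obj (L_obj K C)" "farr (quot_fun K C) \<in> extensional (Arr C)"
    by (auto simp: quot_fun_def)
  show "farr (quot_fun K C) f \<in> Hom (L_obj K C) (fobj (quot_fun K C) X) (fobj (quot_fun K C) Y) n"
    if f: "f \<in> Hom C X Y n" for X Y n f
    using f HomD(1)[OF f] Hom_Obj[OF f] by (simp add: Hom_L_obj)
  show "farr (quot_fun K C) (pls C f g) = pls (L_obj K C) (farr (quot_fun K C) f) (farr (quot_fun K C) g)"
    if "f \<in> Hom C X Y n" "g \<in> Hom C X Y n" for X Y n f g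
    using HomD(1)[OF pls_closed[OF that]] HomD(1)[OF that(1)] HomD(1)[OF that(2)] rep_pls[OF that] by simp
  show "farr (quot_fun K C) (scl C c f) = scl (L_obj K C) c (farr (quot_fun K C) f)"
    if "c \<in> carrier K" "f \<in> Hom C X Y n" for X Y n c f
    using HomD(1)[OF scl_closed[OF that]] HomD(1)[OF that(2)] rep_scl[OF that] by simp
  show "farr (quot_fun K C) (dif C f) = dif (L_obj K C) (farr (quot_fun K C) f)" if "f \<in> Arr C" for f
    using HomD(1)[OF dif_closed[OF Hom_if_Arr[OF that]]] rep_dif[OF that] that by simp
  show "farr (quot_fun K C) (cmp C f g) = cmp (L_obj K C) (farr (quot_fun K C) f) (farr (quot_fun K C) g)"
    if "f \<in> Arr C" "g \<in> Arr C" "Dom C f = Cod C g" for f g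
    using HomD(1)[OF cmp_closed[OF Hom_if_Arr[OF that(1), unfolded that(3)] Hom_if_Arr[OF that(2)]]]
      rep_cmp[OF that] that by simp
qed

text \<open>The kernel of F is an ideal containing all generators, hence contains
  \<open>wp_ideal\<close>; as \<open>rep K C f\<close> is f plus an element of that ideal, F does
  not see the choice. The last hypothesis says that F sends each generator to the zero of the
  hom-space it lands in.\<close>

lemma
  assumes D: "nonunital_dgcat K D" and F: "nonunital_dgfun K C D F"
    and zero: "\<And>fs. composable (add_units K C) fs \<Longrightarrow> 2 \<le> length fs \<Longrightarrow>
      farr F (wp C fs) = zer D (Dom D (farr F (wp C fs))) (Cod D (farr F (wp C fs))) (Deg D (farr F (wp C fs)))"
  shows farr_rep: "f \<in> Arr C \<Longrightarrow> farr F (rep K C f) = farr F f"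
    and nonunital_dgfun_descend: "nonunital_dgfun K (L_obj K C) D (descend K C F)"
proof -
  interpret F: nonunital_dg_functor K C D F using D F by unfold_locales
  let ?Z = "{f \<in> Arr D. f = zer D (Dom D f) (Cod D f) (Deg D f)}"
  have "I \<subseteq> {f \<in> Arr C. farr F f \<in> ?Z}"
    using zero HomD(1)[OF wp_closed] F.farr_Arr(1)
    by (intro wp_ideal_least F.dg_ideal_preimage F.D.dg_ideal_zero) simp
  then have I: "farr F h = zer D (fobj F X) (fobj F Y) n" if "h \<in> I" "h \<in> Hom C X Y n" for h X Y n
    using that(1) HomD[OF F.farr_Hom[OF that(2)]] by auto
  have rep: "farr F (rep K C f) = farr F f" if f: "f \<in> Hom C X Y n" for f X Y n
  proof -
    obtain h where h: "h \<in> I" "h \<in> Hom C X Y n" "rep K C f = pls C h f" by (rule rep_decomp[OF f])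
    show ?thesis
      unfolding h(3) F.farr_pls[OF h(2) f] I[OF h(1,2)] by (rule F.D.pls_zer_left[OF F.farr_Hom[OF f]])
  qed
  then show rep': "farr F (rep K C f) = farr F f" if "f \<in> Arr C" for f
    using Hom_if_Arr[OF that] by blast
  have G: "farr (descend K C F) (rep K C f) = farr F f" if "f \<in> Arr C" for f
    using that rep' by simp
  note in_Arr = HomD(1)[OF pls_closed] HomD(1)[OF scl_closed] HomD(1)[OF dif_closed]
  show "nonunital_dgfun K (L_obj K C) D (descend K C F)"
  proof (rule nonunital_dgfunI)
    show "fobj (descend K C F) \<in> Obj (L_obj K C) \<rightarrow>\<^sub>E Obj D"
      using F by (simp add: nonunital_dgfun_def)
    show "farr (descend K C F) f \<in> Hom D (fobj (descend K C F) X) (fobj (descend K C F) Y) n"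
      if "f \<in> Hom (L_obj K C) X Y n" for X Y n f
      using that G HomD(1) F.farr_Hom unfolding Hom_L_obj by fastforce
    fix X Y n f assume "f \<in> Hom (L_obj K C) X Y n"
    then obtain f' where f': "f' \<in> Hom C X Y n" "f = rep K C f'" unfolding Hom_L_obj by blast
    show "farr (descend K C F) (scl (L_obj K C) c f) = scl D c (farr (descend K C F) f)"
      if c: "c \<in> carrier K" for c
      using f' HomD(1)[OF f'(1)] in_Arr(2)[OF c f'(1)] rep_scl[OF c f'(1)] F.farr_scl[OF c f'(1)]
      by (simp add: G del: descend_simps)
    fix g assume "g \<in> Hom (L_obj K C) X Y n"
    then obtain g' where g': "g' \<in> Hom C X Y n" "g = rep K C g'" unfolding Hom_L_obj by blast
    show "farr (descend K C F) (pls (L_obj K C) f g) = pls D (farr (descend K C F) f) (farr (descend K C F) g)"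
      using f' g' HomD(1)[OF f'(1)] HomD(1)[OF g'(1)] in_Arr(1)[OF f'(1) g'(1)] rep_pls[OF f'(1) g'(1)]
        F.farr_pls[OF f'(1) g'(1)]
      by (simp add: G del: descend_simps)
  next
    fix f assume "f \<in> Arr (L_obj K C)"
    then obtain f' where f': "f' \<in> Arr C" "f = rep K C f'" by auto
    show "farr (descend K C F) (dif (L_obj K C) f) = dif D (farr (descend K C F) f)"
      using f' in_Arr(3)[OF Hom_if_Arr[OF f'(1)]] rep_dif[OF f'(1)] F.farr_dif[OF f'(1)]
      by (simp add: G del: descend_simps)
    fix g assume "g \<in> Arr (L_obj K C)" and e: "Dom (L_obj K C) f = Cod (L_obj K C) g"
    then obtain g' where g': "g' \<in> Arr C" "g = rep K C g'" by auto
    have e': "Dom C f' = Cod C g'" using e f' g' by (simp add: rep_HomD)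
    show "farr (descend K C F) (cmp (L_obj K C) f g) = cmp D (farr (descend K C F) f) (farr (descend K C F) g)"
      using f' g' HomD(1)[OF cmp_closed[OF Hom_if_Arr[OF f'(1), unfolded e'] Hom_if_Arr[OF g'(1)]]]
        rep_cmp[OF f'(1) g'(1) e'] F.farr_cmp[OF f'(1) g'(1) e']
      by (simp add: G del: descend_simps)
  qed (rule descend_simps(3))
qed

end

section \<open>The weakly unital structure of a strictly unital dg category\<close>

lemma composable_append:
  assumes "xs \<noteq> []" "ys \<noteq> []"
  shows "composable B (xs @ ys) \<longleftrightarrow> composable B xs \<and> composable B ys \<and> Dom B (last xs) = Cod B (hd ys)"
  using assms
proof (induction xs)
  case (Cons x xs)
  then show ?case by (cases "xs = []") (auto simp: composable_Cons)
qed simp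

lemma deg_sum_simps [simp]:
  "deg_sum B [] = 0" "deg_sum B (x # xs) = Deg B x + deg_sum B xs"
  "deg_sum B (xs @ ys) = deg_sum B xs + deg_sum B ys"
  by (simp_all add: deg_sum_def)

lemma sgnd_even: "even n \<Longrightarrow> sgnd M n x = x"
  by (simp add: sgnd_def)

lemma sgnd_zero:
  assumes "module K M"
  shows "sgnd M n \<zero>\<^bsub>M\<^esub> = \<zero>\<^bsub>M\<^esub>"
proof -
  interpret module K M by fact
  show ?thesis by (simp add: sgnd_def)
qed

locale unital_dg =
  fixes K :: "'k ring" and A :: "('o, 'm, 'k) udgcat"
  assumes field: "field K" and unital: "unital_dgcat K A"
begin

sublocale K: field K by (rule field)

sublocale nonunital_dg K A
  using unital by unfold_locales (simp add: unital_dgcat_def)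

abbreviation "A1 \<equiv> add_units K A"

lemma
  assumes "X \<in> Obj A"
  shows idn_closed: "idn A X \<in> Hom A X X 0" and dif_idn: "dif A (idn A X) = zer A X X 1"
  using unital assms unfolding unital_dgcat_def by blast+

lemma cmp_idn_left: "f \<in> Hom A X Y n \<Longrightarrow> cmp A (idn A Y) f = f"
  and cmp_idn_right: "f \<in> Hom A X Y n \<Longrightarrow> cmp A f (idn A X) = f"
  using unital unfolding unital_dgcat_def Hom_def by auto

lemma p_dg_long:
  "2 \<le> length fs \<Longrightarrow>
    p_dg K A fs = zer A (Dom A (fst (last fs))) (Cod A (fst (hd fs))) (deg_sum A1 fs + 1 - int (length fs))"
  \<comment> \<open>These cases split lists into length 0, length 1 and length at least 2.\<close>
  by (cases fs rule: remdups_adj.cases) (auto simp: p_dg_def Let_def)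

lemma p_dg_zero_scalar: "p_dg K A [(f, \<zero>\<^bsub>K\<^esub>)] = f"
  by (simp add: p_dg_def)

text \<open>\<open>p_dg\<close> singles out c = 0, since f may then be any arrow and a multiple of
  an identity could not be added to it. On endomorphisms of degree 0 one formula covers both
  branches.\<close>

lemma p_dg_single:
  assumes f: "f \<in> Hom A X X 0"
  shows "p_dg K A [(f, c)] = pls A f (scl A c (idn A X))"
proof (cases "c = \<zero>\<^bsub>K\<^esub>")
  case True
  have "X \<in> Obj A" using Hom_Obj f by blast
  then show ?thesis using True f by (simp add: p_dg_def scl_zero[OF idn_closed] pls_zer_right)
qed (use HomD[OF f] in \<open>simp add: p_dg_def\<close>)

lemma arr_cases:
  assumes "x \<in> Arr A1" "Dom A (fst x) = X" "Cod A (fst x) = Y" "Deg A (fst x) = n"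
  obtains f where "x = (f, \<zero>\<^bsub>K\<^esub>)" "f \<in> Hom A X Y n"
  | f c where "x = (f, c)" "c \<in> carrier K" "c \<noteq> \<zero>\<^bsub>K\<^esub>" "X = Y" "n = 0" "f \<in> Hom A X X 0"
  using assms by (cases x) (force simp: Hom_def)

lemma p_dg_single_closed:
  assumes "x \<in> Arr A1"
  shows "p_dg K A [x] \<in> Hom A (Dom A (fst x)) (Cod A (fst x)) (Deg A (fst x))"
  using assms refl refl refl
proof (cases rule: arr_cases)
  case (2 f c)
  have "Dom A (fst x) \<in> Obj A" using Hom_Obj 2 by blast
  then show ?thesis
    using 2 p_dg_single[OF 2(6)] pls_closed[OF 2(6) scl_closed[OF 2(2) idn_closed]] by simp
qed (simp add: p_dg_zero_scalar)

lemma p_dg_closed: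
  assumes "composable A1 fs"
  shows "p_dg K A fs \<in> Hom A (Dom A (fst (last fs))) (Cod A (fst (hd fs)))
    (deg_sum A1 fs + 1 - int (length fs))"
proof (cases "2 \<le> length fs")
  case True
  then show ?thesis
    using composable_ends[OF assms] zer_closed[OF Dom_Obj Cod_Obj] by (simp add: p_dg_long)
next
  case False
  then obtain x where "fs = [x]" using assms by (cases fs; cases "tl fs") auto
  then show ?thesis using p_dg_single_closed[of x] assms by (simp add: composable_Cons)
qed

lemma p_dg_single_pls:
  assumes x: "x \<in> Arr A1" and y: "y \<in> Arr A1"
    and e: "Dom A (fst x) = Dom A (fst y)" "Cod A (fst x) = Cod A (fst y)" "Deg A (fst x) = Deg A (fst y)"
  shows "p_dg K A [pls A1 x y] = pls A (p_dg K A [x]) (p_dg K A [y])"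
proof (cases "snd x = \<zero>\<^bsub>K\<^esub> \<and> snd y = \<zero>\<^bsub>K\<^esub>")
  case True
  then show ?thesis using p_dg_zero_scalar by (cases x; cases y) simp
next
  case False
  let ?X = "Dom A (fst x)"
  \<comment> \<open>x and y lie in one hom-space, so a nonzero scalar on either makes both of them
    endomorphisms of degree 0.\<close>
  have f: "fst x \<in> Hom A ?X ?X 0" and g: "fst y \<in> Hom A ?X ?X 0"
    using x y e False by (auto simp: Hom_def)
  have c: "snd x \<in> carrier K" "snd y \<in> carrier K" using x y by auto
  note i = idn_closed[OF Hom_Obj(1)[OF f]]
  have "p_dg K A [pls A1 x y] = pls A (pls A (fst x) (fst y)) (scl A (snd x \<oplus>\<^bsub>K\<^esub> snd y) (idn A ?X))"
    using p_dg_single[OF pls_closed[OF f g]] by simp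
  also have "\<dots> = pls A (pls A (fst x) (scl A (snd x) (idn A ?X))) (pls A (fst y) (scl A (snd y) (idn A ?X)))"
    unfolding scl_add[OF c(1) i c(2)]
    by (rule pls_pls_swap[OF f g scl_closed[OF c(1) i] scl_closed[OF c(2) i]])
  finally show ?thesis using p_dg_single[OF f, of "snd x"] p_dg_single[OF g, of "snd y"] by simp
qed

lemma p_dg_single_scl:
  assumes r: "r \<in> carrier K" and x: "x \<in> Arr A1"
  shows "p_dg K A [scl A1 r x] = scl A r (p_dg K A [x])"
  using x refl refl refl
proof (cases rule: arr_cases)
  case (1 f)
  then show ?thesis using r by (simp add: p_dg_zero_scalar)
next
  case (2 f c)
  note i = idn_closed[OF Hom_Obj(1)[OF 2(6)]]
  show ?thesis
    using p_dg_single[OF scl_closed[OF r 2(6)]] p_dg_single[OF 2(6)] 2(1)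
      scl_mult[OF r i 2(2)] scl_pls[OF r 2(6) scl_closed[OF 2(2) i]] by simp
qed

text \<open>The multiple of the identity dies because d(id) = 0. This is the A_infinity equation for
  one argument.\<close>

lemma dif_p_dg_single:
  assumes x: "x \<in> Arr A1"
  shows "dif A (p_dg K A [x]) = dif A (fst x)"
  using x refl refl refl
proof (cases rule: arr_cases)
  case (1 f)
  then show ?thesis by (simp add: p_dg_zero_scalar)
next
  case (2 f c)
  note ob = Hom_Obj(1)[OF 2(6)] note i = idn_closed[OF ob]
  show ?thesis
    using p_dg_single[OF 2(6), of c] dif_pls[OF 2(6) scl_closed[OF 2(2) i]] dif_scl[OF 2(2) i] dif_idn[OF ob]
      scl_zer[OF 2(2) ob ob, of 1] pls_zer_right[OF dif_closed[OF 2(6)]] 2(1) by simp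
qed

text \<open>(f + a)(g + b) = f g + a g + b f + a b. As p_2 vanishes, this is the A_infinity equation
  for two arguments. The four cases follow the composition of \<open>add_units\<close>, in which a
  zero scalar contributes the zero of the target hom-space.\<close>

lemma p_dg_single_cmp:
  assumes "composable A1 [x, y]"
  shows "p_dg K A [cmp A1 x y] = cmp A (p_dg K A [x]) (p_dg K A [y])"
proof -
  obtain f a where xe: "x = (f, a)" by (cases x)
  obtain g b where ye: "y = (g, b)" by (cases y)
  let ?X = "Dom A g" and ?Y = "Cod A g" and ?Z = "Cod A f" and ?m = "Deg A f" and ?n = "Deg A g"
  have x: "(f, a) \<in> Arr A1" and y: "(g, b) \<in> Arr A1" and xy: "Dom A f = ?Y"
    using assms xe ye by (simp_all add: composable_Cons del: add_units_simps(2))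
  have f: "f \<in> Hom A ?Y ?Z ?m" and g: "g \<in> Hom A ?X ?Y ?n"
    using x y xy by (simp_all add: Hom_def)
  have a: "a \<in> carrier K" "a \<noteq> \<zero>\<^bsub>K\<^esub> \<Longrightarrow> ?Y = ?Z \<and> ?m = 0"
    and b: "b \<in> carrier K" "b \<noteq> \<zero>\<^bsub>K\<^esub> \<Longrightarrow> ?X = ?Y \<and> ?n = 0"
    using x y xy by simp_all
  note fg = cmp_closed[OF f g] note ob = Hom_Obj[OF f] Hom_Obj[OF g]
  consider "a = \<zero>\<^bsub>K\<^esub>" "b = \<zero>\<^bsub>K\<^esub>" | "a = \<zero>\<^bsub>K\<^esub>" "b \<noteq> \<zero>\<^bsub>K\<^esub>" | "a \<noteq> \<zero>\<^bsub>K\<^esub>" "b = \<zero>\<^bsub>K\<^esub>" | "a \<noteq> \<zero>\<^bsub>K\<^esub>" "b \<noteq> \<zero>\<^bsub>K\<^esub>"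
    by blast
  then show ?thesis
  proof cases
    case 1
    then show ?thesis
      by (simp add: xe ye cmp_add_units Let_def pls_zer_right[OF fg] p_dg_zero_scalar)
  next
    case 2
    then have e: "?X = ?Y" "?n = 0" using b by auto
    have g0: "g \<in> Hom A ?Y ?Y 0" and fg0: "cmp A f g \<in> Hom A ?Y ?Z ?m" using g fg e by simp_all
    note i = idn_closed[OF ob(1)]
    have "cmp A f (pls A g (scl A b (idn A ?Y))) = pls A (cmp A f g) (scl A b f)"
      using cmp_pls_right[OF f g0 scl_closed[OF b(1) i]] cmp_scl_right[OF f b(1) i] cmp_idn_right[OF f] by simp
    then show ?thesis
      using 2 b(1) by (simp add: xe ye cmp_add_units Let_def e pls_zer_right[OF fg0] p_dg_zero_scalar p_dg_single[OF g0])
  next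
    case 3
    then have e: "?Y = ?Z" "?m = 0" using a by auto
    have f0: "f \<in> Hom A ?Y ?Y 0" and fg0: "cmp A f g \<in> Hom A ?X ?Y ?n" using f fg e by simp_all
    note i = idn_closed[OF ob(1)]
    have "cmp A (pls A f (scl A a (idn A ?Y))) g = pls A (cmp A f g) (scl A a g)"
      using cmp_pls_left[OF g f0 scl_closed[OF a(1) i]] cmp_scl_left[OF g a(1) i] cmp_idn_left[OF g] by simp
    then show ?thesis
      using 3 a(1) pls_zer_right[OF pls_closed[OF fg0 scl_closed[OF a(1) g]]]
      by (simp add: xe ye cmp_add_units Let_def e(2) e(1)[symmetric] p_dg_zero_scalar p_dg_single[OF f0])
  next
    case 4
    then have e: "?X = ?Y" "?n = 0" "?Y = ?Z" "?m = 0" using a b by auto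
    have f0: "f \<in> Hom A ?Y ?Y 0" and g0: "g \<in> Hom A ?Y ?Y 0" and fg0: "cmp A f g \<in> Hom A ?Y ?Y 0"
      using f g fg e by simp_all
    note i = idn_closed[OF ob(1)]
    note ag = scl_closed[OF a(1) g0] and bf = scl_closed[OF b(1) f0]
    have ab: "a \<otimes>\<^bsub>K\<^esub> b \<in> carrier K" using a b by simp
    note abi = scl_closed[OF ab i] and gi = pls_closed[OF g0 scl_closed[OF b(1) i]]
    have "cmp A (pls A f (scl A a (idn A ?Y))) (pls A g (scl A b (idn A ?Y))) =
        pls A (pls A (cmp A f g) (scl A b f)) (pls A (scl A a g) (scl A (a \<otimes>\<^bsub>K\<^esub> b) (idn A ?Y)))"
      using cmp_pls_left[OF gi f0 scl_closed[OF a(1) i]] cmp_scl_left[OF gi a(1) i] cmp_idn_left[OF gi]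
        cmp_pls_right[OF f0 g0 scl_closed[OF b(1) i]] cmp_scl_right[OF f0 b(1) i] cmp_idn_right[OF f0]
        scl_pls[OF a(1) g0 scl_closed[OF b(1) i]] scl_mult[OF a(1) i b(1)] by simp
    \<comment> \<open>Reordered to match \<open>cmp_add_units\<close>, where a g comes before b
      f.\<close>
    also have "\<dots> = pls A (pls A (pls A (cmp A f g) (scl A a g)) (scl A b f)) (scl A (a \<otimes>\<^bsub>K\<^esub> b) (idn A ?Y))"
      using pls_pls_swap[OF fg0 bf ag abi] pls_assoc[OF pls_closed[OF fg0 ag] bf abi] by simp
    finally show ?thesis
      using 4 p_dg_single[OF pls_closed[OF pls_closed[OF fg0 ag] bf]]
      by (simp add: xe ye cmp_add_units Let_def p_dg_single[OF f0] p_dg_single[OF g0])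
  qed
qed

text \<open>The differential raises the degree sum by one and keeps the length, hence 2 in place of
  the 1 of \<open>p_dg_long\<close>.\<close>

lemma p_dg_dif_long:
  assumes fs: "composable A1 fs" and i: "i < length fs" and n: "2 \<le> length fs"
  shows "p_dg K A (fs[i := dif A1 (fs ! i)]) =
    zer A (Dom A (fst (last fs))) (Cod A (fst (hd fs))) (deg_sum A1 fs + 2 - int (length fs))"
proof -
  define gs x hs where d: "gs = take i fs" "x = fs ! i" "hs = drop (Suc i) fs"
  have e: "fs = gs @ x # hs" unfolding d by (rule id_take_nth_drop[OF i])
  have "fst x \<in> Arr A" using fs e by (auto simp: composable_def)
  note dx = HomD[OF dif_closed[OF Hom_if_Arr[OF this]]]
  have "fs[i := dif A1 (fs ! i)] = gs @ dif A1 x # hs"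
    unfolding d by (rule upd_conv_take_nth_drop[OF i])
  moreover have "p_dg K A (gs @ dif A1 x # hs) = zer A (Dom A (fst (last fs))) (Cod A (fst (hd fs)))
      (deg_sum A1 fs + 2 - int (length fs))"
    using n dx by (subst p_dg_long) (cases gs; simp add: e algebra_simps)+
  ultimately show ?thesis by simp
qed

text \<open>Merging two arrows keeps the degree sum and shortens the string by one, which again
  shifts the degree by one. From length 3 on, the merged string has length at least 2, where
  \<open>p_dg\<close> vanishes.\<close>

lemma p_dg_cmp_long:
  assumes fs: "composable A1 fs" and i: "Suc i < length fs" and n: "3 \<le> length fs"
  shows "p_dg K A (take i fs @ cmp A1 (fs ! i) (fs ! Suc i) # drop (i + 2) fs) =
    zer A (Dom A (fst (last fs))) (Cod A (fst (hd fs))) (deg_sum A1 fs + 2 - int (length fs))"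
proof -
  define gs x y hs where d: "gs = take i fs" "x = fs ! i" "y = fs ! Suc i" "hs = drop (i + 2) fs"
  have e: "fs = gs @ x # y # hs"
    unfolding d using id_take_nth_drop[of i fs] Cons_nth_drop_Suc[OF i] i by simp
  have "composable A1 (x # y # hs)"
    using fs unfolding e by (cases "gs = []") (simp_all add: composable_append)
  then have xy: "composable A1 [x, y]"
    unfolding composable_Cons by auto
  note c = HomD[OF cmp_add_units_closed(2)[OF xy]]
  show ?thesis
    unfolding d[symmetric] using n c by (subst p_dg_long) (cases gs; simp add: e algebra_simps)+
qed

lemma cmp_p_dg_long:
  assumes fs: "composable A1 fs" and i: "0 < i" "i < length fs" and n: "3 \<le> length fs"
  shows "cmp A (p_dg K A (take i fs)) (p_dg K A (drop i fs)) =
    zer A (Dom A (fst (last fs))) (Cod A (fst (hd fs))) (deg_sum A1 fs + 2 - int (length fs))"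
proof -
  define gs hs where d: "gs = take i fs" "hs = drop i fs"
  have ne: "gs \<noteq> []" "hs \<noteq> []" and e: "fs = gs @ hs" using i unfolding d by auto
  have gs: "composable A1 gs" and hs: "composable A1 hs"
    and m: "Dom A (fst (last gs)) = Cod A (fst (hd hs))"
    using fs unfolding e composable_append[OF ne] by simp_all
  note pg = p_dg_closed[OF gs, unfolded m] and ph = p_dg_closed[OF hs]
  \<comment> \<open>Cutting a string of length at least 3 leaves a part of length at least 2, on
    which \<open>p_dg\<close> is zero; composing with zero gives zero.\<close>
  have "2 \<le> length gs \<or> 2 \<le> length hs" using n unfolding e by auto
  then have "cmp A (p_dg K A gs) (p_dg K A hs) = zer A (Dom A (fst (last hs))) (Cod A (fst (hd gs)))
    ((deg_sum A1 gs + 1 - int (length gs)) + (deg_sum A1 hs + 1 - int (length hs)))"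
  proof
    assume "2 \<le> length gs"
    then show ?thesis using cmp_zer_left[OF ph Hom_Obj(2)[OF pg]] m by (simp add: p_dg_long[of gs])
  next
    assume "2 \<le> length hs"
    then show ?thesis using cmp_zer_right[OF pg Hom_Obj(1)[OF ph]] by (simp add: p_dg_long[of hs])
  qed
  then show ?thesis
    unfolding d[symmetric] using ne by (simp add: e algebra_simps)
qed

text \<open>For one argument the equation says that p_1 commutes with the differential, for two that
  p_1 is multiplicative; from three arguments on every term is zero.\<close>

lemma ainf_functor_p_dg: "ainf_functor K A1 A (\<lambda>X. X) (p_dg K A)"
  unfolding ainf_functor_def
proof (intro conjI allI impI ballI; (elim conjE)?)
  show "(\<lambda>X. X) \<in> Obj A1 \<rightarrow> Obj A" by simp
  show "p_dg K A fs \<in> Hom A (Dom A1 (last fs)) (Cod A1 (hd fs)) (deg_sum A1 fs + 1 - int (length fs))"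
    if "composable A1 fs" for fs
    using p_dg_closed[OF that] by simp
next
  fix gs x y hs
  assume c: "composable A1 (gs @ x # hs)" "composable A1 (gs @ y # hs)"
    and e: "Dom A1 x = Dom A1 y" "Cod A1 x = Cod A1 y" "Deg A1 x = Deg A1 y"
  have x: "x \<in> Arr A1" and y: "y \<in> Arr A1" using c by (auto simp: composable_def)
  have f: "fst x \<in> Hom A (Dom A (fst x)) (Cod A (fst x)) (Deg A (fst x))"
    and g: "fst y \<in> Hom A (Dom A (fst x)) (Cod A (fst x)) (Deg A (fst x))"
    using x y e by (simp_all add: Hom_def)
  show "p_dg K A (gs @ pls A1 x y # hs) = pls A (p_dg K A (gs @ x # hs)) (p_dg K A (gs @ y # hs))"
  proof (cases "gs = [] \<and> hs = []")
    case True
    then show ?thesis using p_dg_single_pls[OF x y] e by simp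
  next
    case False
    then have n: "2 \<le> length (gs @ z # hs)" for z by (cases gs; cases hs) auto
    \<comment> \<open>On long strings the value depends only on the outer ends, the length and the
      degree sum, so all three values are the same zero.\<close>
    have 1: "p_dg K A (gs @ y # hs) = p_dg K A (gs @ x # hs)"
      unfolding p_dg_long[OF n] using e by (cases gs) auto
    have 2: "p_dg K A (gs @ pls A1 x y # hs) = p_dg K A (gs @ x # hs)"
      unfolding p_dg_long[OF n] using HomD[OF pls_closed[OF f g]] by (cases gs) auto
    show ?thesis
      unfolding 1 2 using pls_zer_left[OF p_dg_closed[OF c(1)]] by (simp only: p_dg_long[OF n])
  qed
next
  fix gs x hs r
  assume r: "r \<in> carrier K" and c: "composable A1 (gs @ x # hs)"
  have x: "x \<in> Arr A1" using c by (auto simp: composable_def)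
  have f: "fst x \<in> Hom A (Dom A (fst x)) (Cod A (fst x)) (Deg A (fst x))"
    using x by (simp add: Hom_def)
  show "p_dg K A (gs @ scl A1 r x # hs) = scl A r (p_dg K A (gs @ x # hs))"
  proof (cases "gs = [] \<and> hs = []")
    case True
    then show ?thesis using p_dg_single_scl[OF r x] by simp
  next
    case False
    then have n: "2 \<le> length (gs @ z # hs)" for z by (cases gs; cases hs) auto
    have 2: "p_dg K A (gs @ scl A1 r x # hs) = p_dg K A (gs @ x # hs)"
      unfolding p_dg_long[OF n] using HomD[OF scl_closed[OF r f]] by (cases gs) auto
    show ?thesis
      unfolding 2 using scl_zer[OF r Hom_Obj[OF p_dg_closed[OF c]]] by (simp only: p_dg_long[OF n])
  qed
next
  fix fs assume fs: "composable A1 fs"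
  let ?X = "Dom A (fst (last fs))" and ?Y = "Cod A (fst (hd fs))" and ?n = "length fs"
  let ?d = "deg_sum A1 fs + 2 - int ?n"
  have ob: "?X \<in> Obj A" "?Y \<in> Obj A" using Hom_Obj p_dg_closed[OF fs] by blast+
  define M where "M = HomM A ?X ?Y ?d"
  interpret M: module K M unfolding M_def by (rule module_HomM[OF ob])
  note MK = M.module_axioms
  have z: "zer A ?X ?Y ?d = \<zero>\<^bsub>M\<^esub>" by (simp add: M_def)
  have M: "HomM A (Dom A1 (last fs)) (Cod A1 (hd fs)) ?d = M" by (simp add: M_def)
  let ?S1 = "\<lambda>i. sgnd M (deg_sum A1 (take i fs)) (p_dg K A (fs[i := dif A1 (fs ! i)]))"
  let ?S2 = "\<lambda>i. sgnd M (int i) (p_dg K A (take i fs @ cmp A1 (fs ! i) (fs ! Suc i) # drop (i + 2) fs))"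
  let ?S3 = "\<lambda>i. sgnd M (int i - 1 + (1 - int (?n - i)) * deg_sum A1 (take i fs))
      (cmp A (p_dg K A (take i fs)) (p_dg K A (drop i fs)))"
  have S1: "(\<Oplus>\<^bsub>M\<^esub>i\<in>{..<?n}. ?S1 i) = \<zero>\<^bsub>M\<^esub>" if "2 \<le> ?n"
    using p_dg_dif_long[OF fs _ that] sgnd_zero[OF MK] by (intro M.M.add.finprod_one_eqI) (simp add: z)
  have dz: "dif A (p_dg K A fs) = \<zero>\<^bsub>M\<^esub>" if "2 \<le> ?n"
    using dif_zer[OF ob] that by (simp add: p_dg_long z[symmetric] algebra_simps)
  consider "?n = 1" | "?n = 2" | "3 \<le> ?n" using fs by (cases fs; cases "tl fs"; cases "tl (tl fs)") auto
  then have "sgnd M (int ?n - 1) (\<Oplus>\<^bsub>M\<^esub>i\<in>{..<?n}. ?S1 i) \<oplus>\<^bsub>M\<^esub> (\<Oplus>\<^bsub>M\<^esub>i\<in>{..<?n - 1}. ?S2 i) =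
      dif A (p_dg K A fs) \<oplus>\<^bsub>M\<^esub> (\<Oplus>\<^bsub>M\<^esub>i\<in>{1..<?n}. ?S3 i)"
  proof cases
    case 1
    then obtain x where x: "fs = [x]" by (cases fs) auto
    have xA: "x \<in> Arr A1" using fs x by (simp add: composable_Cons)
    then have "fst x \<in> Arr A" by simp
    note dx = dif_closed[OF Hom_if_Arr[OF this]]
    have "dif A (fst x) \<in> carrier M" using dx by (simp add: M_def x algebra_simps)
    then show ?thesis
      using dif_p_dg_single[OF xA] by (simp add: x M.M.finsum_initial(1) sgnd_even p_dg_zero_scalar)
  next
    case 2
    then obtain x y where x: "fs = [x, y]" by (cases fs; cases "tl fs") auto
    have p: "cmp A (p_dg K A [x]) (p_dg K A [y]) \<in> carrier M"
    proof -
      have "composable A1 [x]" "composable A1 [y]" "Dom A (fst x) = Cod A (fst y)"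
        using fs[unfolded x] unfolding composable_Cons by (simp_all del: add_units_simps(2))
      then show ?thesis
        using cmp_closed[of "p_dg K A [x]" "Cod A (fst y)" "Cod A (fst x)" "Deg A (fst x)" "p_dg K A [y]" "Dom A (fst y)" "Deg A (fst y)"]
          p_dg_closed[of "[x]"] p_dg_closed[of "[y]"] by (simp add: M_def x)
    qed
    have len: "(2::nat) - 1 = Suc 0" by simp
    have s2: "(\<Oplus>\<^bsub>M\<^esub>i\<in>{..<Suc 0}. ?S2 i) = cmp A (p_dg K A [x]) (p_dg K A [y])"
      using p p_dg_single_cmp[OF fs[unfolded x]] by (subst M.M.finsum_initial(1)) (simp_all add: x sgnd_even)
    have s3: "(\<Oplus>\<^bsub>M\<^esub>i\<in>{1..<2}. ?S3 i) = cmp A (p_dg K A [x]) (p_dg K A [y])"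
      using p by (subst M.M.finsum_initial(3)) (simp_all add: x sgnd_even)
    have "(\<Oplus>\<^bsub>M\<^esub>i\<in>{..<?n - 1}. ?S2 i) = (\<Oplus>\<^bsub>M\<^esub>i\<in>{1..<?n}. ?S3 i)"
      unfolding s2[symmetric] using s2 s3 2 by (simp only: len)
    then show ?thesis using S1 dz 2 sgnd_zero[OF MK] by simp
  next
    case 3
    have "(\<Oplus>\<^bsub>M\<^esub>i\<in>{..<?n - 1}. ?S2 i) = \<zero>\<^bsub>M\<^esub>"
      using p_dg_cmp_long[OF fs _ 3] sgnd_zero[OF MK] by (intro M.M.add.finprod_one_eqI) (simp add: z)
    moreover have "(\<Oplus>\<^bsub>M\<^esub>i\<in>{1..<?n}. ?S3 i) = \<zero>\<^bsub>M\<^esub>"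
      using cmp_p_dg_long[OF fs _ _ 3] sgnd_zero[OF MK] by (intro M.M.add.finprod_one_eqI) (simp add: z)
    ultimately show ?thesis using S1 dz 3 sgnd_zero[OF MK] by simp
  qed
  then show "let n = ?n; M = HomM A (Dom A1 (last fs)) (Cod A1 (hd fs)) (deg_sum A1 fs + 2 - int n) in
      sgnd M (int n - 1) (\<Oplus>\<^bsub>M\<^esub>i\<in>{..<n}. sgnd M (deg_sum A1 (take i fs)) (p_dg K A (fs[i := dif A1 (fs ! i)])))
      \<oplus>\<^bsub>M\<^esub> (\<Oplus>\<^bsub>M\<^esub>i\<in>{..<n - 1}. sgnd M (int i)
        (p_dg K A (take i fs @ cmp A1 (fs ! i) (fs ! Suc i) # drop (i + 2) fs)))
      = dif A (p_dg K A fs) \<oplus>\<^bsub>M\<^esub> (\<Oplus>\<^bsub>M\<^esub>i\<in>{1..<n}.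
        sgnd M (int i - 1 + (1 - int (n - i)) * deg_sum A1 (take i fs))
          (cmp A (p_dg K A (take i fs)) (p_dg K A (drop i fs))))"
    unfolding Let_def M .
qed

end

section \<open>The functor R\<close>

lemma extend_simps [simp]:
  "Obj (udgcat.extend A m) = Obj A" "Arr (udgcat.extend A m) = Arr A" "Dom (udgcat.extend A m) = Dom A"
  "Cod (udgcat.extend A m) = Cod A" "Deg (udgcat.extend A m) = Deg A" "zer (udgcat.extend A m) = zer A"
  "pls (udgcat.extend A m) = pls A" "scl (udgcat.extend A m) = scl A" "dif (udgcat.extend A m) = dif A"
  "cmp (udgcat.extend A m) = cmp A" "idn (udgcat.extend A m) = idn A"
  "wp (udgcat.extend A \<lparr>wp = p\<rparr>) = p"
  by (simp_all add: udgcat.defs)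

text \<open>None of these notions reads the added field \<open>wp\<close>; as simp rules they turn
  statements about R(A) into statements about A.\<close>

lemma extend_derived [simp]:
  "Hom (udgcat.extend A m) = Hom A" "HomM (udgcat.extend A m) = HomM A"
  "add_units K (udgcat.extend A m) = add_units K A"
  "composable (udgcat.extend A m) = composable A" "deg_sum (udgcat.extend A m) = deg_sum A"
  "cocycles (udgcat.extend A m) = cocycles A" "coh_class (udgcat.extend A m) = coh_class A"
  "coh_map (udgcat.extend A m) = coh_map A" "dgfun_comp (udgcat.extend A m) = dgfun_comp A"
  "dgfun_id (udgcat.extend A m) = dgfun_id A"
  by ((intro ext)?; simp add: Hom_def HomM_def add_units_def composable_def deg_sum_def cocycles_def
      coh_class_def coh_map_def dgfun_comp_def dgfun_id_def cong: if_cong)+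

lemma cohomology_extend [simp]: "cohomology (udgcat.extend A m) = cohomology A"
  by (intro ext) (simp add: cohomology_def)

lemma H0_extend [simp]: "H0 (udgcat.extend A m) = H0 A" "H0_map (udgcat.extend A m) = H0_map A"
  by (simp_all add: H0_def H0_map_def fun_eq_iff)

lemma nonunital_dgcat_extend [simp]: "nonunital_dgcat K (udgcat.extend A m) \<longleftrightarrow> nonunital_dgcat K A"
  by (simp add: nonunital_dgcat_def)

lemma ainf_functor_extend [simp]: "ainf_functor K B (udgcat.extend A m) F0 F \<longleftrightarrow> ainf_functor K B A F0 F"
  by (simp add: ainf_functor_def)

lemma nonunital_dgfun_extend_left [simp]:
  "nonunital_dgfun K (udgcat.extend A m) D F \<longleftrightarrow> nonunital_dgfun K A D F"
  by (simp add: nonunital_dgfun_def)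

lemma nonunital_dgfun_extend_right [simp]:
  "nonunital_dgfun K C (udgcat.extend A m) F \<longleftrightarrow> nonunital_dgfun K C A F"
  by (simp add: nonunital_dgfun_def)

lemma dg_weq_extend [simp]: "dg_weq (udgcat.extend A m) (udgcat.extend B m') F \<longleftrightarrow> dg_weq A B F"
  by (simp add: dg_weq_def)

lemma dg_fib_extend [simp]: "dg_fib (udgcat.extend A m) (udgcat.extend B m') F \<longleftrightarrow> dg_fib A B F"
  by (simp add: dg_fib_def)

abbreviation "R_obj K A \<equiv> udgcat.extend A \<lparr>wp = p_dg K A\<rparr>"

lemma R_functor_simps [simp]: "FOb (R_functor K) A = R_obj K A" "FAr (R_functor K) A B F = F"
  by (simp_all add: R_functor_def)

lemma with_cofibrations_simps [simp]:
  "Ob (with_cofibrations \<C> W F) = Ob \<C>" "Ar (with_cofibrations \<C> W F) = Ar \<C>"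
  "Idt (with_cofibrations \<C> W F) = Idt \<C>" "Cm (with_cofibrations \<C> W F) = Cm \<C>"
  "weq (with_cofibrations \<C> W F) = W" "fib (with_cofibrations \<C> W F) = F"
  by (simp_all add: with_cofibrations_def cat.defs)

lemma (in unital_dg) weakly_unital_R_obj: "weakly_unital_dgcat K (R_obj K A)"
  unfolding weakly_unital_dgcat_def
proof (intro conjI ballI allI impI; (elim conjE)?)
  fix X assume "X \<in> Obj (R_obj K A)"
  then have X: "X \<in> Obj A" by simp
  note i = idn_closed[OF X]
  show "idn (R_obj K A) X \<in> Hom (R_obj K A) X X 0" "dif (R_obj K A) (idn (R_obj K A) X) = zer (R_obj K A) X X 1"
    "cmp (R_obj K A) (idn (R_obj K A) X) (idn (R_obj K A) X) = idn (R_obj K A) X"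
    using i dif_idn[OF X] cmp_idn_left[OF i] by simp_all
  show "wp (R_obj K A) [unit_of K (R_obj K A) X] = idn (R_obj K A) X"
    using p_dg_single[OF zer_closed[OF X X], of "\<one>\<^bsub>K\<^esub>"] scl_one[OF i] pls_zer_left[OF i]
    by (simp add: unit_of_def)
  fix n :: nat assume n: "2 \<le> n"
  \<comment> \<open>Units have degree 0, which leaves 1 - n as the degree of the zero.\<close>
  have "deg_sum A1 (replicate n (unit_of K A X)) = 0"
    by (induction n) (simp_all add: unit_of_def zer_HomD[OF X X])
  then show "wp (R_obj K A) (replicate n (unit_of K (R_obj K A) X)) = zer (R_obj K A) X X (1 - int n)"
    using n by (cases n) (simp_all add: p_dg_long unit_of_def zer_HomD[OF X X] last_replicate)
next
  show "wp (R_obj K A) [inc K f] = f" for f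
    by (simp add: inc_def p_dg_zero_scalar)
  fix fs assume fs: "composable (R_obj K A) fs" "2 \<le> length fs"
  then have ne: "fs \<noteq> []" by auto
  have "deg_sum A1 (map (inc K) gs) = deg_sum A gs" for gs
    by (induction gs) (simp_all add: inc_def)
  then show "wp (R_obj K A) (map (inc K) fs) = zer (R_obj K A) (Dom (R_obj K A) (last fs))
      (Cod (R_obj K A) (hd fs)) (deg_sum (R_obj K A) fs + 1 - int (length fs))"
    using fs ne by (simp add: p_dg_long last_map hd_map inc_def)
qed (use nonunital ainf_functor_p_dg in \<open>simp_all add: zer_HomD\<close>)

lemma weakly_unital_dgcat_R:
  assumes "field K" "unital_dgcat K A"
  shows "weakly_unital_dgcat K (R_obj K A)"
  by (rule unital_dg.weakly_unital_R_obj[OF unital_dg.intro[OF assms]])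

text \<open>Higher components are zeros on both sides, in hom-spaces that F relates; p_1 is
  respected because F is linear and strictly unital.\<close>

lemma weakly_unital_dgfun_R:
  assumes K: "field K" and A: "unital_dgcat K A" and B: "unital_dgcat K B" and F: "unital_dgfun K A B F"
  shows "weakly_unital_dgfun K (R_obj K A) (R_obj K B) F"
proof -
  interpret A: unital_dg K A using K A by (rule unital_dg.intro)
  interpret B: unital_dg K B using K B by (rule unital_dg.intro)
  have F': "nonunital_dgfun K A B F" and idn: "X \<in> Obj A \<Longrightarrow> farr F (idn A X) = idn B (fobj F X)" for X
    using F unfolding unital_dgfun_def by auto
  interpret F: nonunital_dg_functor K A B F using F' by unfold_locales
  have "farr F (p_dg K A fs) = p_dg K B (map (unit_map F) fs)" if fs: "composable (add_units K A) fs" for fs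
  proof (cases "2 \<le> length fs")
    case True
    then have ne: "fs \<noteq> []" by auto
    have e: "hd fs \<in> Arr (add_units K A)" "last fs \<in> Arr (add_units K A)" by (rule composable_ends[OF fs])+
    have "set gs \<subseteq> Arr (add_units K A) \<Longrightarrow> deg_sum (add_units K B) (map (unit_map F) gs) = deg_sum (add_units K A) gs" for gs
      by (induction gs) (auto simp: F.farr_Arr case_prod_beta)
    then show ?thesis
      using True fs e F.farr_zer[OF A.Dom_Obj A.Cod_Obj] F.farr_Arr
      by (simp add: A.p_dg_long B.p_dg_long ne last_map hd_map composable_def case_prod_beta)
  next
    case False
    then obtain f c where x: "fs = [(f, c)]" using fs by (cases fs; cases "tl fs") auto
    have f: "f \<in> Arr A" and c: "c \<in> carrier K" and e: "c \<noteq> \<zero>\<^bsub>K\<^esub> \<Longrightarrow> Dom A f = Cod A f \<and> Deg A f = 0"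
      using fs x by (simp_all add: composable_Cons)
    show ?thesis
    proof (cases "c = \<zero>\<^bsub>K\<^esub>")
      case True
      then show ?thesis by (simp add: x A.p_dg_zero_scalar B.p_dg_zero_scalar)
    next
      case False
      then have f0: "f \<in> Hom A (Dom A f) (Dom A f) 0" using f e by (simp add: Hom_def)
      note i = A.idn_closed[OF A.Dom_Obj[OF f]]
      show ?thesis
        using F.farr_pls[OF f0 A.scl_closed[OF c i]] F.farr_scl[OF c i] idn[OF A.Dom_Obj[OF f]]
        by (simp add: x A.p_dg_single[OF f0] B.p_dg_single[OF F.farr_Hom[OF f0]])
    qed
  qed
  then show ?thesis
    using F' by (simp add: weakly_unital_dgfun_def)
qed

section \<open>The two categories of dg categories\<close>

lemma dgfun_comp_assoc:
  assumes "nonunital_dgfun K C D F" "nonunital_dgfun K D E G" "nonunital_dgcat K C" "nonunital_dgcat K D"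
  shows "dgfun_comp C H (dgfun_comp C G F) = dgfun_comp C (dgfun_comp D H G) F"
proof -
  interpret nonunital_dg_functor K C D F using assms by unfold_locales
  show ?thesis by (rule dgfun_eqI[where S = "Obj C" and T = "Arr C"]) (simp_all add: fobj_closed farr_Arr)
qed

lemma dgfun_comp_id:
  assumes "nonunital_dgfun K C D F" "nonunital_dgcat K C" "nonunital_dgcat K D"
  shows dgfun_comp_id_left: "dgfun_comp C (dgfun_id D) F = F"
    and dgfun_comp_id_right: "dgfun_comp C F (dgfun_id C) = F"
proof -
  interpret nonunital_dg_functor K C D F using assms by unfold_locales
  note e = nonunital_dgfun_ext[OF assms(1)]
  show "dgfun_comp C (dgfun_id D) F = F" "dgfun_comp C F (dgfun_id C) = F"
    by (rule dgfun_eqI[where S = "Obj C" and T = "Arr C"]; simp add: fobj_closed farr_Arr e)+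
qed

lemma weakly_unital_dgfunD:
  assumes "weakly_unital_dgfun K C D F"
  shows weakly_unital_dgfun_nonunital: "nonunital_dgfun K C D F"
    and weakly_unital_dgfun_wp: "composable (add_units K C) fs \<Longrightarrow> farr F (wp C fs) = wp D (map (unit_map F) fs)"
  using assms by (simp_all add: weakly_unital_dgfun_def)

lemma weakly_unital_dgcat_nonunital: "weakly_unital_dgcat K C \<Longrightarrow> nonunital_dgcat K C"
  by (simp add: weakly_unital_dgcat_def)

lemma unital_dgcat_nonunital: "unital_dgcat K C \<Longrightarrow> nonunital_dgcat K C"
  by (simp add: unital_dgcat_def)

lemma unital_dgfun_nonunital: "unital_dgfun K C D F \<Longrightarrow> nonunital_dgfun K C D F"
  by (simp add: unital_dgfun_def)

lemma weakly_unital_dgfun_comp: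
  fixes C :: "('o, 'm, 'k) wudgcat"
  assumes K: "field K" and C: "weakly_unital_dgcat K C" and D: "weakly_unital_dgcat K D" and E: "weakly_unital_dgcat K E"
    and F: "weakly_unital_dgfun K C D F" and G: "weakly_unital_dgfun K D E G"
  shows "weakly_unital_dgfun K C E (dgfun_comp C G F)"
proof -
  interpret C: weakly_unital_dg K C using K C by (rule weakly_unital_dg.intro)
  note n = weakly_unital_dgcat_nonunital
  interpret F: nonunital_dg_functor K C D F
    using n[OF C] n[OF D] weakly_unital_dgfun_nonunital[OF F] by unfold_locales
  have "farr (dgfun_comp C G F) (wp C fs) = wp E (map (unit_map (dgfun_comp C G F)) fs)"
    if fs: "composable (add_units K C) fs" for fs
  proof -
    \<comment> \<open>The composite functor is defined by its formula only on \<open>Arr C\<close>;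
      composability puts the arrow parts of the entries there.\<close>
    have eq: "map (unit_map (dgfun_comp C G F)) fs = map (unit_map G) (map (unit_map F) fs)"
      using fs by (auto simp: composable_def case_prod_beta)
    show ?thesis
      unfolding eq using HomD(1)[OF C.wp_closed[OF fs]] weakly_unital_dgfun_wp[OF F fs]
        weakly_unital_dgfun_wp[OF G F.composable_unit_map[OF fs]] by (simp del: map_map)
  qed
  then show ?thesis
    using nonunital_dgfun_comp[OF n[OF C] n[OF D] n[OF E]] F G
    by (simp add: weakly_unital_dgfun_def)
qed

lemma unital_dgfun_comp:
  assumes C: "unital_dgcat K C" and D: "unital_dgcat K D" and E: "unital_dgcat K E"
    and F: "unital_dgfun K C D F" and G: "unital_dgfun K D E G"
  shows "unital_dgfun K C E (dgfun_comp C G F)"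
proof -
  note n = unital_dgcat_nonunital
  interpret F: nonunital_dg_functor K C D F
    using n[OF C] n[OF D] unital_dgfun_nonunital[OF F] by unfold_locales
  have "idn C X \<in> Arr C" if "X \<in> Obj C" for X
    using C that HomD(1)[of "idn C X" C] unfolding unital_dgcat_def by blast
  then show ?thesis
    using nonunital_dgfun_comp[OF n[OF C] n[OF D] n[OF E]] F G F.fobj_closed
    by (simp add: unital_dgfun_def)
qed

lemma category_Cat_dg: "category (Cat_dg K)"
  unfolding category_def
proof (intro conjI ballI)
  fix A B C D F G H
  note n = unital_dgcat_nonunital and nf = unital_dgfun_nonunital
  { assume A: "A \<in> Ob (Cat_dg K)"
    then have "nonunital_dgfun K A A (dgfun_id A)" by (intro nonunital_dgfun_id n) (simp add: Cat_dg_def)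
    moreover have "idn A X \<in> Arr A" if "X \<in> Obj A" for X
      using A that HomD(1)[of "idn A X" A] unfolding Cat_dg_def unital_dgcat_def by auto
    ultimately show "Idt (Cat_dg K) A \<in> Ar (Cat_dg K) A A"
      by (simp add: Cat_dg_def unital_dgfun_def) }
  { assume "A \<in> Ob (Cat_dg K)" "B \<in> Ob (Cat_dg K)" "F \<in> Ar (Cat_dg K) A B"
    then show "Cm (Cat_dg K) A B B (Idt (Cat_dg K) B) F = F" "Cm (Cat_dg K) A A B F (Idt (Cat_dg K) A) = F"
      using dgfun_comp_id[OF nf n n] by (simp_all add: Cat_dg_def) }
  { assume "A \<in> Ob (Cat_dg K)" "B \<in> Ob (Cat_dg K)" "C \<in> Ob (Cat_dg K)" "F \<in> Ar (Cat_dg K) A B" "G \<in> Ar (Cat_dg K) B C"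
    then show "Cm (Cat_dg K) A B C G F \<in> Ar (Cat_dg K) A C"
      using unital_dgfun_comp by (auto simp: Cat_dg_def) }
  { assume "A \<in> Ob (Cat_dg K)" "B \<in> Ob (Cat_dg K)" "C \<in> Ob (Cat_dg K)" "D \<in> Ob (Cat_dg K)"
      "F \<in> Ar (Cat_dg K) A B" "G \<in> Ar (Cat_dg K) B C" "H \<in> Ar (Cat_dg K) C D"
    then show "Cm (Cat_dg K) A C D H (Cm (Cat_dg K) A B C G F) = Cm (Cat_dg K) A B D (Cm (Cat_dg K) B C D H G) F"
      using dgfun_comp_assoc[OF nf nf n n] by (simp add: Cat_dg_def) }
qed

lemma category_Cat_dgwu:
  assumes K: "field K"
  shows "category (Cat_dgwu K)"
  unfolding category_def
proof (intro conjI ballI)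
  fix A B C D F G H
  note n = weakly_unital_dgcat_nonunital and nf = weakly_unital_dgfun_nonunital
  { assume "A \<in> Ob (Cat_dgwu K)"
    then have A: "weakly_unital_dgcat K A" by (simp add: Cat_dgwu_def)
    interpret weakly_unital_dg K A using K A by (rule weakly_unital_dg.intro)
    \<comment> \<open>\<open>dgfun_id\<close> is undefined outside \<open>Arr A\<close>, hence the
      restriction to composable strings.\<close>
    have "map (unit_map (dgfun_id A)) fs = fs" if "composable (add_units K A) fs" for fs
      using that by (intro map_idI) (auto simp: composable_def)
    then show "Idt (Cat_dgwu K) A \<in> Ar (Cat_dgwu K) A A"
      using nonunital_dgfun_id[OF n[OF A]] HomD(1)[OF wp_closed]
      by (simp add: Cat_dgwu_def weakly_unital_dgfun_def) }
  { assume "A \<in> Ob (Cat_dgwu K)" "B \<in> Ob (Cat_dgwu K)" "F \<in> Ar (Cat_dgwu K) A B"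
    then show "Cm (Cat_dgwu K) A B B (Idt (Cat_dgwu K) B) F = F" "Cm (Cat_dgwu K) A A B F (Idt (Cat_dgwu K) A) = F"
      using dgfun_comp_id[OF nf n n] by (simp_all add: Cat_dgwu_def) }
  { assume "A \<in> Ob (Cat_dgwu K)" "B \<in> Ob (Cat_dgwu K)" "C \<in> Ob (Cat_dgwu K)" "F \<in> Ar (Cat_dgwu K) A B" "G \<in> Ar (Cat_dgwu K) B C"
    then show "Cm (Cat_dgwu K) A B C G F \<in> Ar (Cat_dgwu K) A C"
      using weakly_unital_dgfun_comp[OF K] by (auto simp: Cat_dgwu_def) }
  { assume "A \<in> Ob (Cat_dgwu K)" "B \<in> Ob (Cat_dgwu K)" "C \<in> Ob (Cat_dgwu K)" "D \<in> Ob (Cat_dgwu K)"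
      "F \<in> Ar (Cat_dgwu K) A B" "G \<in> Ar (Cat_dgwu K) B C" "H \<in> Ar (Cat_dgwu K) C D"
    then show "Cm (Cat_dgwu K) A C D H (Cm (Cat_dgwu K) A B C G F) = Cm (Cat_dgwu K) A B D (Cm (Cat_dgwu K) B C D H G) F"
      using dgfun_comp_assoc[OF nf nf n n] by (simp add: Cat_dgwu_def) }
qed

section \<open>The adjunction\<close>

context weakly_unital_dg
begin

sublocale L: unital_dg K "L_obj K C"
  using field unital_dgcat_L_obj by (rule unital_dg.intro)

text \<open>Values of p_n with n \<ge> 2 lie in the ideal and become zero, as \<open>p_dg\<close>
  demands. For one argument \<open>wp_single\<close> and \<open>p_dg_single\<close> have the same
  form, and \<open>rep\<close> respects sums and scalars.\<close>

lemma weakly_unital_quot_fun: "weakly_unital_dgfun K C (R_obj K (L_obj K C)) (quot_fun K C)"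
proof -
  interpret q: nonunital_dg_functor K C "L_obj K C" "quot_fun K C"
    using nonunital_dgfun_quot_fun by unfold_locales
  have "rep K C (wp C fs) = p_dg K (L_obj K C) (map (unit_map (quot_fun K C)) fs)"
    if fs: "composable (add_units K C) fs" for fs
  proof (cases "2 \<le> length fs")
    case True
    then have ne: "fs \<noteq> []" by auto
    have e: "fst (hd fs) \<in> Arr C" "fst (last fs) \<in> Arr C" using composable_ends[OF fs] by auto
    have "set gs \<subseteq> Arr (add_units K C) \<Longrightarrow>
        deg_sum (add_units K (L_obj K C)) (map (unit_map (quot_fun K C)) gs) = deg_sum (add_units K C) gs" for gs
      by (induction gs) (auto simp: rep_HomD case_prod_beta)
    then show ?thesis
      using True fs e rep_ideal[OF wp_in_ideal[OF fs True] wp_closed[OF fs]]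
      by (simp add: L.p_dg_long ne last_map hd_map composable_def case_prod_beta rep_HomD)
  next
    case False
    then obtain f c where x: "fs = [(f, c)]" using fs by (cases fs; cases "tl fs") auto
    have f: "f \<in> Arr C" and c: "c \<in> carrier K" and e: "c \<noteq> \<zero>\<^bsub>K\<^esub> \<Longrightarrow> Dom C f = Cod C f \<and> Deg C f = 0"
      using fs x by (simp_all add: composable_Cons)
    show ?thesis
    proof (cases "c = \<zero>\<^bsub>K\<^esub>")
      case True
      then show ?thesis using f by (simp add: x L.p_dg_zero_scalar wp_inc)
    next
      case False
      then have f0: "f \<in> Hom C (Dom C f) (Dom C f) 0" using f e by (simp add: Hom_def)
      note i = idn_closed[OF Dom_Obj[OF f]]
      note ci = scl_closed[OF c i]
      \<comment> \<open>Sum, multiple and identity are those of \<open>L_obj K C\<close>, which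
        explains the nested \<open>rep\<close>.\<close>
      have "p_dg K (L_obj K C) [(rep K C f, c)] =
          rep K C (pls C (rep K C f) (rep K C (scl C c (rep K C (idn C (Dom C f))))))"
        using L.p_dg_single[of "rep K C f" "Dom C f"] f0 by (simp add: Hom_L_obj)
      then show ?thesis
        using f by (simp add: x wp_single[OF f0 c] rep_scl[OF c i] rep_pls[OF f0 ci])
    qed
  qed
  then show ?thesis
    using nonunital_dgfun_quot_fun HomD(1)[OF wp_closed] by (simp add: weakly_unital_dgfun_def)
qed

text \<open>An arrow of the quotient is some \<open>rep K C g\<close>, which \<open>rep\<close>
  fixes, so a functor on the quotient is recovered from its composite with the projection.\<close>

lemma descend_comp_quot_fun:
  assumes F: "nonunital_dgfun K (L_obj K C) D F"
  shows "descend K C (dgfun_comp C F (quot_fun K C)) = F"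
proof (rule dgfun_eqI[where S = "Obj C" and T = "Arr (L_obj K C)"])
  show "fobj F \<in> extensional (Obj C)" "farr F \<in> extensional (Arr (L_obj K C))"
    using nonunital_dgfun_ext[OF F] by simp_all
  show "farr (descend K C (dgfun_comp C F (quot_fun K C))) f = farr F f" if "f \<in> Arr (L_obj K C)" for f
    using that by (auto simp: rep_HomD rep_rep)
  show "farr (descend K C (dgfun_comp C F (quot_fun K C))) \<in> extensional (Arr (L_obj K C))"
    by (rule descend_simps(3))
qed simp_all

end

text \<open>An element of the right-hand Hom-set of the adjunction, to be carried to the left-hand
  one by \<open>descend\<close>.\<close>

locale weakly_unital_functor_to_R = weakly_unital_dg K C + A: unital_dg K A
  for K :: "'k ring" and C :: "('o, 'm, 'k) wudgcat" and A :: "('p, 'n, 'k) udgcat" +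
  fixes F :: "('o, 'm, 'p, 'n) dgfun"
  assumes weakly_unital_dgfun: "weakly_unital_dgfun K C (R_obj K A) F"
begin

sublocale F: nonunital_dg_functor K C A F
  using weakly_unital_dgfun_nonunital[OF weakly_unital_dgfun] by unfold_locales simp

lemma farr_wp: "composable (add_units K C) fs \<Longrightarrow> farr F (wp C fs) = p_dg K A (map (unit_map F) fs)"
  using weakly_unital_dgfun_wp[OF weakly_unital_dgfun] by simp

text \<open>The generators of the ideal are killed; the zero is written in terms of its own ends and
  degree, as \<open>farr_rep\<close> expects.\<close>

lemma farr_wp_long:
  assumes fs: "composable (add_units K C) fs" and n: "2 \<le> length fs"
  shows "farr F (wp C fs) = zer A (Dom A (farr F (wp C fs))) (Cod A (farr F (wp C fs))) (Deg A (farr F (wp C fs)))"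
proof -
  note e = composable_ends[OF F.composable_unit_map[OF fs]]
  have "Dom A (fst (last (map (unit_map F) fs))) \<in> Obj A" "Cod A (fst (hd (map (unit_map F) fs))) \<in> Obj A"
    using e A.Dom_Obj A.Cod_Obj by simp_all
  then show ?thesis
    unfolding farr_wp[OF fs] using n by (simp add: A.p_dg_long A.zer_HomD)
qed

lemma farr_F_rep: "f \<in> Arr C \<Longrightarrow> farr F (rep K C f) = farr F f"
  using A.nonunital F.dgfun farr_wp_long by (rule farr_rep)

text \<open>Commuting with p_1 at the unit 1_X is what preserves identities: p_1 sends the unit to
  the identity both in C and in R(A).\<close>

lemma farr_idn:
  assumes X: "X \<in> Obj C"
  shows "farr F (idn C X) = idn A (fobj F X)"
proof -
  have ob: "fobj F X \<in> Obj A" by (rule F.fobj_closed[OF X])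
  note i = A.idn_closed[OF ob]
  have "composable (add_units K C) [(zer C X X 0, \<one>\<^bsub>K\<^esub>)]"
    by (simp add: composable_Cons zer_HomD[OF X X])
  then have "farr F (idn C X) = p_dg K A [(zer A (fobj F X) (fobj F X) 0, \<one>\<^bsub>K\<^esub>)]"
    using farr_wp wp_unit[OF X] F.farr_zer[OF X X] by fastforce
  then show ?thesis
    using A.p_dg_single[OF A.zer_closed[OF ob ob]] A.scl_one[OF i] A.pls_zer_left[OF i] by simp
qed

lemma unital_dgfun_descend: "unital_dgfun K (L_obj K C) A (descend K C F)"
  using nonunital_dgfun_descend[OF A.nonunital F.dgfun farr_wp_long] farr_F_rep farr_idn
    HomD(1)[OF idn_closed] by (simp add: unital_dgfun_def)

lemma comp_descend_quot_fun: "dgfun_comp C (descend K C F) (quot_fun K C) = F"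
  using nonunital_dgfun_ext[OF F.dgfun]
  by (intro dgfun_eqI[where S = "Obj C" and T = "Arr C"]) (simp_all add: farr_F_rep)

end

section \<open>The functor L on arrows\<close>

lemma L_functor_ob [simp]: "FOb (L_functor K) C = L_obj K C"
  by (simp add: L_functor_def)

text \<open>L(F) is the descent of the composite of F with the projection of D; the composite is
  weakly unital because the projection is so as a functor to R(L(D)).\<close>

lemma weakly_unital_dgfun_quot_comp:
  assumes K: "field K" and C: "weakly_unital_dgcat K C" and D: "weakly_unital_dgcat K D"
    and F: "weakly_unital_dgfun K C D F"
  shows "weakly_unital_functor_to_R K C (L_obj K D) (dgfun_comp C (quot_fun K D) F)"
proof -
  interpret D: weakly_unital_dg K D using K D by (rule weakly_unital_dg.intro)
  have "weakly_unital_dgfun K C (R_obj K (L_obj K D)) (dgfun_comp C (quot_fun K D) F)"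
    by (rule weakly_unital_dgfun_comp[OF K C D D.L.weakly_unital_R_obj F D.weakly_unital_quot_fun])
  then show ?thesis
    using K C D.unital_dgcat_L_obj
    by (intro weakly_unital_functor_to_R.intro weakly_unital_dg.intro unital_dg.intro
        weakly_unital_functor_to_R_axioms.intro)
qed

text \<open>The defining formula of \<open>L_functor\<close> agrees with a descended functor, whence
  unitality. Functoriality and naturality are afterwards checked from the values on
  \<open>rep K C f\<close>.\<close>

lemma L_functor_ar:
  assumes K: "field K" and C: "weakly_unital_dgcat K C" and D: "weakly_unital_dgcat K D"
    and F: "weakly_unital_dgfun K C D F"
  shows "FAr (L_functor K) C D F = descend K C (dgfun_comp C (quot_fun K D) F)"
    and "unital_dgfun K (L_obj K C) (L_obj K D) (FAr (L_functor K) C D F)"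
    and "X \<in> Obj C \<Longrightarrow> fobj (FAr (L_functor K) C D F) X = fobj F X"
    and "f \<in> Arr C \<Longrightarrow> farr (FAr (L_functor K) C D F) (rep K C f) = rep K D (farr F f)"
    and "fobj (FAr (L_functor K) C D F) \<in> extensional (Obj C)"
    and "farr (FAr (L_functor K) C D F) \<in> extensional (Arr (L_obj K C))"
proof -
  interpret q: weakly_unital_functor_to_R K C "L_obj K D" "dgfun_comp C (quot_fun K D) F"
    by (rule weakly_unital_dgfun_quot_comp[OF assms])
  interpret F: nonunital_dg_functor K C D F
    using weakly_unital_dgcat_nonunital[OF C] weakly_unital_dgcat_nonunital[OF D]
      weakly_unital_dgfun_nonunital[OF F] by unfold_locales
  note e = nonunital_dgfun_ext[OF F.dgfun]
  have 1: "fobj (FAr (L_functor K) C D F) = fobj F"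
    "f \<in> Arr (L_obj K C) \<Longrightarrow> farr (FAr (L_functor K) C D F) f = rep K D (farr F f)" for f
    by (simp_all add: L_functor_def)
  have 2: "farr (FAr (L_functor K) C D F) \<in> extensional (Arr (L_obj K C))"
    by (simp only: L_functor_def functr.simps dgfun.simps restrict_extensional)
  show eq: "FAr (L_functor K) C D F = descend K C (dgfun_comp C (quot_fun K D) F)"
  proof (rule dgfun_eqI[where S = "Obj C" and T = "Arr (L_obj K C)"])
    show "farr (FAr (L_functor K) C D F) f = farr (descend K C (dgfun_comp C (quot_fun K D) F)) f"
      if "f \<in> Arr (L_obj K C)" for f
      using that 1(2)[OF that] by (auto simp: q.rep_HomD F.farr_Arr)
    show "farr (descend K C (dgfun_comp C (quot_fun K D) F)) \<in> extensional (Arr (L_obj K C))"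
      by (rule descend_simps(3))
    show "farr (FAr (L_functor K) C D F) \<in> extensional (Arr (L_obj K C))" by (rule 2)
  qed (simp_all add: 1 e F.fobj_closed)
  show "unital_dgfun K (L_obj K C) (L_obj K D) (FAr (L_functor K) C D F)"
    unfolding eq by (rule q.unital_dgfun_descend)
  show "X \<in> Obj C \<Longrightarrow> fobj (FAr (L_functor K) C D F) X = fobj F X" by (simp add: 1)
  show "fobj (FAr (L_functor K) C D F) \<in> extensional (Obj C)" by (simp add: 1 e)
  show "farr (FAr (L_functor K) C D F) \<in> extensional (Arr (L_obj K C))" by (rule 2)
  show "farr (FAr (L_functor K) C D F) (rep K C f) = rep K D (farr F f)" if f: "f \<in> Arr C"
    unfolding eq using q.farr_F_rep[OF f] f by (simp add: F.farr_Arr)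
qed

lemma is_functor_L:
  fixes K :: "'k ring"
  assumes K: "field K"
  shows "is_functor (Cat_dgwu K) (Cat_dg K)
    (L_functor K :: (('o, 'm, 'k) wudgcat, ('o, 'm, 'o, 'm) dgfun, ('o, 'm, 'k) udgcat, ('o, 'm, 'o, 'm) dgfun) functr)"
  unfolding is_functor_def
proof (intro conjI ballI)
  fix C D E :: "('o, 'm, 'k) wudgcat" and F G :: "('o, 'm, 'o, 'm) dgfun"
  assume "C \<in> Ob (Cat_dgwu K)"
  then have C: "weakly_unital_dgcat K C" by (simp add: Cat_dgwu_def)
  interpret C: weakly_unital_dg K C using K C by (rule weakly_unital_dg.intro)
  show "FOb (L_functor K) C \<in> Ob (Cat_dg K)"
    using C.unital_dgcat_L_obj by (simp add: Cat_dg_def)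
  have id: "weakly_unital_dgfun K C C (dgfun_id C)"
    using category_idt[OF category_Cat_dgwu[OF K], of C] C by (simp add: Cat_dgwu_def)
  note l = L_functor_ar[OF K C C id]
  have "FAr (L_functor K) C C (dgfun_id C) = dgfun_id (L_obj K C)"
    by (rule dgfun_eqI[where S = "Obj (L_obj K C)" and T = "Arr (L_obj K C)"])
      (use l(3-6) in \<open>auto simp: dgfun_id_def\<close>)
  then show "FAr (L_functor K) C C (Idt (Cat_dgwu K) C) = Idt (Cat_dg K) (FOb (L_functor K) C)"
    by (simp add: Cat_dgwu_def Cat_dg_def)
  assume "D \<in> Ob (Cat_dgwu K)" "F \<in> Ar (Cat_dgwu K) C D"
  then have D: "weakly_unital_dgcat K D" and F: "weakly_unital_dgfun K C D F" by (simp_all add: Cat_dgwu_def)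
  interpret D: weakly_unital_dg K D using K D by (rule weakly_unital_dg.intro)
  interpret F: nonunital_dg_functor K C D F
    using weakly_unital_dgfun_nonunital[OF F] by unfold_locales
  note lF = L_functor_ar[OF K C D F]
  show "FAr (L_functor K) C D F \<in> Ar (Cat_dg K) (FOb (L_functor K) C) (FOb (L_functor K) D)"
    using lF(2) by (simp add: Cat_dg_def)
  assume "E \<in> Ob (Cat_dgwu K)" "G \<in> Ar (Cat_dgwu K) D E"
  then have E: "weakly_unital_dgcat K E" and G: "weakly_unital_dgfun K D E G" by (simp_all add: Cat_dgwu_def)
  note lG = L_functor_ar[OF K D E G]
  have GF: "weakly_unital_dgfun K C E (dgfun_comp C G F)"
    by (rule weakly_unital_dgfun_comp[OF K C D E F G])
  note lGF = L_functor_ar[OF K C E GF]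
  have "FAr (L_functor K) C E (dgfun_comp C G F) =
      dgfun_comp (L_obj K C) (FAr (L_functor K) D E G) (FAr (L_functor K) C D F)"
    (is "?l = ?r")
  proof (rule dgfun_eqI[where S = "Obj (L_obj K C)" and T = "Arr (L_obj K C)"])
    show "fobj ?l X = fobj ?r X" if "X \<in> Obj (L_obj K C)" for X
      using that lF(3) lG(3) lGF(3) F.fobj_closed by simp
    show "farr ?l f = farr ?r f" if f: "f \<in> Arr (L_obj K C)" for f
    proof -
      obtain g where g: "g \<in> Arr C" "f = rep K C g" using f by auto
      have "farr ?r f = farr (FAr (L_functor K) D E G) (farr (FAr (L_functor K) C D F) f)"
        using f by (rule dgfun_comp_simps(2))
      then show ?thesis
        using g lF(4) lG(4) lGF(4) F.farr_Arr(1) by simp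
    qed
    show "farr ?l \<in> extensional (Arr (L_obj K C))" by (rule lGF(6))
    show "farr ?r \<in> extensional (Arr (L_obj K C))" by (rule dgfun_comp_simps(4))
    show "fobj ?l \<in> extensional (Obj (L_obj K C))" using lGF(5) by simp
    show "fobj ?r \<in> extensional (Obj (L_obj K C))" by (rule dgfun_comp_simps(3))
  qed
  then show "FAr (L_functor K) C E (Cm (Cat_dgwu K) C D E G F) =
      Cm (Cat_dg K) (FOb (L_functor K) C) (FOb (L_functor K) D) (FOb (L_functor K) E)
        (FAr (L_functor K) D E G) (FAr (L_functor K) C D F)"
    by (simp add: Cat_dgwu_def Cat_dg_def)
qed

lemma is_functor_R:
  assumes K: "field K"
  shows "is_functor (Cat_dg K) (Cat_dgwu K) (R_functor K)"
  by (simp add: is_functor_def Cat_dg_def Cat_dgwu_def weakly_unital_dgcat_R[OF K] weakly_unital_dgfun_R[OF K])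

lemma adjunction_L_R:
  fixes K :: "'k ring"
  assumes K: "field K"
  shows "adjunction (Cat_dgwu K) (Cat_dg K)
    (L_functor K :: (('o, 'm, 'k) wudgcat, ('o, 'm, 'o, 'm) dgfun, ('o, 'm, 'k) udgcat, ('o, 'm, 'o, 'm) dgfun) functr)
    (R_functor K)"
  unfolding adjunction_def
\<comment> \<open>The bijection is precomposition with the unit \<open>quot_fun K C\<close>.\<close>
proof (intro conjI exI[of _ "\<lambda>C A F. dgfun_comp C F (quot_fun K C)"] ballI)
  show "category (Cat_dgwu K)" by (rule category_Cat_dgwu[OF K])
  show "category (Cat_dg K)" by (rule category_Cat_dg)
  show "is_functor (Cat_dgwu K) (Cat_dg K) (L_functor K)" by (rule is_functor_L[OF K])
  show "is_functor (Cat_dg K) (Cat_dgwu K) (R_functor K)" by (rule is_functor_R[OF K])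
next
  fix C :: "('o, 'm, 'k) wudgcat" and A :: "('o, 'm, 'k) udgcat"
  assume "C \<in> Ob (Cat_dgwu K)" "A \<in> Ob (Cat_dg K)"
  then have C: "weakly_unital_dgcat K C" and A: "unital_dgcat K A" by (simp_all add: Cat_dgwu_def Cat_dg_def)
  interpret C: weakly_unital_dg K C using K C by (rule weakly_unital_dg.intro)
  interpret A: unital_dg K A using K A by (rule unital_dg.intro)
  show "bij_betw (\<lambda>F. dgfun_comp C F (quot_fun K C)) (Ar (Cat_dg K) (FOb (L_functor K) C) A)
      (Ar (Cat_dgwu K) C (FOb (R_functor K) A))"
  \<comment> \<open>The inverse factors a functor through the quotient.\<close>
  proof (rule bij_betw_byWitness[where f' = "descend K C"]; clarsimp simp: Cat_dg_def Cat_dgwu_def)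
    show "descend K C (dgfun_comp C F (quot_fun K C)) = F" if "unital_dgfun K (L_obj K C) A F" for F
      by (rule C.descend_comp_quot_fun[OF unital_dgfun_nonunital[OF that]])
    show "weakly_unital_dgfun K C (R_obj K A) (dgfun_comp C F (quot_fun K C))"
      if F: "unital_dgfun K (L_obj K C) A F" for F
      using weakly_unital_dgfun_comp[OF K C C.L.weakly_unital_R_obj A.weakly_unital_R_obj
          C.weakly_unital_quot_fun weakly_unital_dgfun_R[OF K C.unital_dgcat_L_obj A F]] .
    fix F assume "weakly_unital_dgfun K C (R_obj K A) F"
    then interpret F: weakly_unital_functor_to_R K C A F by unfold_locales
    show "dgfun_comp C (descend K C F) (quot_fun K C) = F" by (rule F.comp_descend_quot_fun)
    show "unital_dgfun K (L_obj K C) A (descend K C F)" by (rule F.unital_dgfun_descend)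
  qed
next
  fix C C' :: "('o, 'm, 'k) wudgcat" and A A' :: "('o, 'm, 'k) udgcat" and h k u :: "('o, 'm, 'o, 'm) dgfun"
  assume "C \<in> Ob (Cat_dgwu K)" "C' \<in> Ob (Cat_dgwu K)" "A \<in> Ob (Cat_dg K)" "A' \<in> Ob (Cat_dg K)"
    "h \<in> Ar (Cat_dgwu K) C' C" "k \<in> Ar (Cat_dg K) A A'" "u \<in> Ar (Cat_dg K) (FOb (L_functor K) C) A"
  then have C: "weakly_unital_dgcat K C" and C': "weakly_unital_dgcat K C'" and h: "weakly_unital_dgfun K C' C h"
    by (simp_all add: Cat_dgwu_def Cat_dg_def)
  interpret C': weakly_unital_dg K C' using K C' by (rule weakly_unital_dg.intro)
  interpret h: nonunital_dg_functor K C' C h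
    using weakly_unital_dgfun_nonunital[OF h] weakly_unital_dgcat_nonunital[OF C] by unfold_locales
  note l = L_functor_ar(3,4)[OF K C' C h]
  let ?Lh = "FAr (L_functor K) C' C h"
  show "dgfun_comp C' (Cm (Cat_dg K) (FOb (L_functor K) C') A A' k
        (Cm (Cat_dg K) (FOb (L_functor K) C') (FOb (L_functor K) C) A u ?Lh)) (quot_fun K C') =
      Cm (Cat_dgwu K) C' (FOb (R_functor K) A) (FOb (R_functor K) A') (FAr (R_functor K) A A' k)
        (Cm (Cat_dgwu K) C' C (FOb (R_functor K) A) (dgfun_comp C u (quot_fun K C)) h)"
    \<comment> \<open>On an arrow f of C' both sides give k(u(rep(h f))), by the value of L(h) on
      representatives.\<close>
    by (rule dgfun_eqI[where S = "Obj C'" and T = "Arr C'"])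
      (simp_all add: Cat_dg_def Cat_dgwu_def l h.fobj_closed h.farr_Arr)
qed

text \<open>The two model structures are given, so their existence is a premise of the Quillen pair:
  it supplies liftings in the source, and factorizations and retracts in the target.\<close>

theorem proposition3p2:
  fixes K :: "'k ring"
  assumes "field K"
  defines "dgwu \<equiv> (Model_dgwu K :: (('o, 'm, 'k) wudgcat, ('o, 'm, 'o, 'm) dgfun) mcat)"
    and "dg \<equiv> (Model_dg K :: (('o, 'm, 'k) udgcat, ('o, 'm, 'o, 'm) dgfun) mcat)"
  shows "adjunction dgwu dg (L_functor K) (R_functor K) \<and>
         right_quillen dg dgwu (R_functor K) \<and>
         (model_structure dgwu \<longrightarrow> model_structure dg \<longrightarrow>
            quillen_pair dgwu dg (L_functor K) (R_functor K))"
proof (intro conjI impI)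
  show adj: "adjunction dgwu dg (L_functor K) (R_functor K)"
    \<comment> \<open>A model category has the objects, arrows and composition of its underlying
      category, so this is the same adjunction.\<close>
    using adjunction_L_R[OF assms(1)]
    by (simp add: dgwu_def dg_def Model_dgwu_def Model_dg_def adjunction_def category_def is_functor_def)
  show rq: "right_quillen dg dgwu (R_functor K)"
    \<comment> \<open>By \<open>dg_weq_extend\<close> and \<open>dg_fib_extend\<close> each
      condition on R(F) is the same condition on F.\<close>
    by (simp add: right_quillen_def dgwu_def dg_def Model_dgwu_def Model_dg_def)
  assume "model_structure dgwu" "model_structure dg"
  then show "quillen_pair dgwu dg (L_functor K) (R_functor K)"
    unfolding quillen_pair_def using adj left_quillen_if_right_quillen[OF adj rq] by blast
qed

end
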